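(* Let $\Omega$ be an open subset of $\mathbb{R}^n$, $n \geq 3$, such that $\partial\Omega$ is $C^2$ near some point $\hat x \in \partial\Omega$, let $\Gamma$ be a non-empty open subset of $\mathbb{R}^n$ and let $f\in C^0(\bar \Gamma)$ be such that $(f,\Gamma)$ satisfies the structural conditions (S1)--(S5) listed in the context. Assume that (i) $u_1 \in USC(\Omega \cup \{\hat x\};[0,\infty))$ and $u_2 \in LSC(\Omega \cup \{\hat x\};(0,\infty])$ are a sub-solution and a super-solution to $f(\lambda(A^u)) = 1$ in $\Omega$ in the viscosity sense, respectively, and (ii) $u_1 < u_2$ in $\Omega$, and $u_1(\hat x) = u_2(\hat x)$. If one of $\ln u_1$ and $\ln u_2$ belongs to $C^{1,1}(\Omega \cup \{\hat x\})$, then $$\liminf_{s \rightarrow 0^+} \frac{(u_2 - u_1)(\hat x - s \nu(\hat x))}{s} > 0,$$ where $\nu(\hat x)$ is the outward unit normal to $\partial\Omega$ at $\hat x$.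
   Context: For $n \geq 3$ and a positive function $u$, the conformal Hessian of $u$ is $$A^u = -\frac{2}{n-2} u^{-\frac{n+2}{n-2}} \nabla^2 u + \frac{2n}{(n-2)^2} u^{-\frac{2n}{n-2}} \nabla u \otimes \nabla u - \frac{2}{(n-2)^2} u^{-\frac{2n}{n-2}} |\nabla u|^2 I,$$ where $I$ is the $n\times n$ identity matrix; $\lambda(A^u)$ denotes the eigenvalues of $A^u$. Let $\Gamma_n := \{\mu \in \mathbb{R}^n: \mu_i > 0 \text{ for all } i\}$. Structural conditions on $(f,\Gamma)$: (S1) (symmetry) if $\lambda \in \Gamma$ and $\lambda'$ is a permutation of $\lambda$, then $\lambda' \in \Gamma$ and $f(\lambda') = f(\lambda)$. (S2) (ellipticity) if $\lambda \in \Gamma$ and $\mu \in \bar\Gamma_n$, then $\lambda + \mu \in \Gamma$ and $f(\lambda + \mu) \geq f(\lambda)$. (S3) (local strict ellipticity) for any compact subset $K$ of $\Gamma$, there is some constant $\delta(K) > 0$ such that $f(\lambda + \mu) - f(\lambda) \geq \delta(K) |\mu|$ for all $\lambda \in K$, $\mu \in \bar\Gamma_n$. (S4) (local Lipschitz) for any compact subset $K$ of $\Gamma$, there is some constant $C(K) > 0$ such that $|f(\lambda') - f(\lambda)| \leq C(K) |\lambda' - \lambda|$ for all $\lambda, \lambda' \in K$. (S5) $f^{-1}([1,\infty)) \subset \Gamma$. $USC(X;S)$ and $LSC(X;S)$ denote the upper, respectively lower, semi-continuous functions on $X$ with values in $S$. Viscosity sub-/super-solutions of $f(\lambda(A^u))=1$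 in an open set $\Omega$: - $u \in USC(\Omega;[0,\infty))$ is a viscosity sub-solution if for any $x_0\in\Omega$ and any positive $\varphi \in C^2(\Omega)$ with $(u-\varphi)(x_0)=0$ and $u-\varphi\leq 0$ near $x_0$, either $\lambda(A^\varphi(x_0)) \notin \bar\Gamma$ or $f(\lambda(A^\varphi(x_0))) \leq 1$. - $u \in LSC(\Omega;(0,\infty])$ is a viscosity super-solution if for any $x_0\in\Omega$ and any positive $\varphi \in C^2(\Omega)$ with $(u-\varphi)(x_0)=0$ and $u-\varphi\geq 0$ near $x_0$, one has $\lambda(A^\varphi(x_0)) \in \bar\Gamma$ and $f(\lambda(A^\varphi(x_0))) \geq 1$. *)

theory Defs
  imports "HOL-Analysis.Analysis"
begin

section \<open>Differential calculus\<close>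

definition grad :: "(real ^ 'n \<Rightarrow> real) \<Rightarrow> real ^ 'n \<Rightarrow> real ^ 'n" where
  "grad u x = (\<chi> i. frechet_derivative u (at x) (axis i 1))"

definition hessian :: "(real ^ 'n \<Rightarrow> real) \<Rightarrow> real ^ 'n \<Rightarrow> real ^ 'n ^ 'n" where
  "hessian u x = jacobian (grad u) (at x)"

text \<open>Meant for open \<open>S\<close>: \<^const>\<open>grad\<close> and \<^const>\<open>hessian\<close> use unrestricted derivatives.\<close>

definition C2_on :: "(real ^ 'n) set \<Rightarrow> (real ^ 'n \<Rightarrow> real) \<Rightarrow> bool" where
  "C2_on S u \<longleftrightarrow>
     (\<forall>x\<in>S. u differentiable (at x)) \<and>
     (\<forall>x\<in>S. grad u differentiable (at x)) \<and>
     continuous_on S (hessian u)"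

text \<open>The set \<open>E\<close> need not be open (here \<open>E\<close> is an open set together with one boundary point),
  so the derivative is taken within \<open>E\<close>. As usual for \<open>C\<^sup>1\<^sup>,\<^sup>1(E)\<close>, the Lipschitz bound on the
  gradient is local in \<open>E\<close>, boundary points of \<open>E\<close> lying in \<open>E\<close> included.\<close>

definition C11_on :: "(real ^ 'n) set \<Rightarrow> (real ^ 'n \<Rightarrow> real) \<Rightarrow> bool" where
  "C11_on E w \<longleftrightarrow>
     (\<exists>G. (\<forall>x\<in>E. (w has_derivative (\<lambda>h. G x \<bullet> h)) (at x within E)) \<and>
          (\<forall>x\<in>E. \<exists>r>0. \<exists>L. L-lipschitz_on (E \<inter> ball x r) G))"

section \<open>Domains with a \<open>C\<^sup>2\<close> boundary near a point\<close>

definition C2_defining_function ::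
  "(real ^ 'n) set \<Rightarrow> real ^ 'n \<Rightarrow> (real ^ 'n) set \<Rightarrow> (real ^ 'n \<Rightarrow> real) \<Rightarrow> bool" where
  "C2_defining_function \<Omega> z U \<rho> \<longleftrightarrow>
     open U \<and> z \<in> U \<and> C2_on U \<rho> \<and>
     \<Omega> \<inter> U = {x \<in> U. \<rho> x < 0} \<and>
     frontier \<Omega> \<inter> U = {x \<in> U. \<rho> x = 0} \<and>
     (\<forall>x \<in> frontier \<Omega> \<inter> U. grad \<rho> x \<noteq> 0)"

definition C2_boundary_near :: "(real ^ 'n) set \<Rightarrow> real ^ 'n \<Rightarrow> bool" where
  "C2_boundary_near \<Omega> z \<longleftrightarrow> (\<exists>U \<rho>. C2_defining_function \<Omega> z U \<rho>)"

text \<open>The vector \<open>\<nu>\<close> does not depend on the choice of the defining function.\<close>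

definition outward_unit_normal :: "(real ^ 'n) set \<Rightarrow> real ^ 'n \<Rightarrow> real ^ 'n \<Rightarrow> bool" where
  "outward_unit_normal \<Omega> z \<nu> \<longleftrightarrow>
     (\<exists>U \<rho>. C2_defining_function \<Omega> z U \<rho> \<and> \<nu> = grad \<rho> z /\<^sub>R norm (grad \<rho> z))"

section \<open>Semicontinuity relative to a set\<close>

definition usc_on :: "'a::topological_space set \<Rightarrow> ('a \<Rightarrow> 'b::linorder) \<Rightarrow> bool" where
  "usc_on X u \<longleftrightarrow> (\<forall>x\<in>X. \<forall>c. u x < c \<longrightarrow> (\<forall>\<^sub>F y in at x within X. u y < c))"

definition lsc_on :: "'a::topological_space set \<Rightarrow> ('a \<Rightarrow> 'b::linorder) \<Rightarrow> bool" where
  "lsc_on X u \<longleftrightarrow> (\<forall>x\<in>X. \<forall>c. c < u x \<longrightarrow> (\<forall>\<^sub>F y in at x within X. c < u y))"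

section \<open>The conformal Hessian and its eigenvalues\<close>

definition conformal_hessian :: "(real ^ 'n \<Rightarrow> real) \<Rightarrow> real ^ 'n \<Rightarrow> real ^ 'n ^ 'n" where
  "conformal_hessian u x =
     (let n = real CARD('n); g = grad u x in
        (- (2 / (n - 2)) * u x powr (- ((n + 2) / (n - 2)))) *\<^sub>R hessian u x
      + (2 * n / (n - 2)\<^sup>2 * u x powr (- (2 * n / (n - 2)))) *\<^sub>R (\<chi> i j. g $ i * g $ j)
      - (2 / (n - 2)\<^sup>2 * u x powr (- (2 * n / (n - 2))) * (norm g)\<^sup>2) *\<^sub>R mat 1)"

text \<open>The eigenvalues of \<open>A\<close>, listed with multiplicity in some order. They exist when \<open>A\<close> is
  symmetric, and the unspecified order is immaterial, since the vector is only ever tested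
  against permutation-invariant \<open>\<Gamma>\<close> and \<open>f\<close>.\<close>

definition eigenvalues :: "real ^ 'n ^ 'n \<Rightarrow> real ^ 'n" where
  "eigenvalues A = (SOME \<mu>. \<forall>t. det (mat t - A) = (\<Prod>i\<in>UNIV. t - \<mu> $ i))"

section \<open>Structural conditions on \<open>(f, \<Gamma>)\<close>\<close>

definition Gamma_pos :: "(real ^ 'n) set" where
  "Gamma_pos = {\<mu>. \<forall>i. \<mu> $ i > 0}"

definition S1 :: "(real ^ 'n \<Rightarrow> real) \<Rightarrow> (real ^ 'n) set \<Rightarrow> bool" where
  "S1 f \<Gamma> \<longleftrightarrow> (\<forall>\<mu>\<in>\<Gamma>. \<forall>p. p permutes UNIV \<longrightarrow>
     (\<chi> i. \<mu> $ p i) \<in> \<Gamma> \<and> f (\<chi> i. \<mu> $ p i) = f \<mu>)"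

definition S2 :: "(real ^ 'n \<Rightarrow> real) \<Rightarrow> (real ^ 'n) set \<Rightarrow> bool" where
  "S2 f \<Gamma> \<longleftrightarrow> (\<forall>l\<in>\<Gamma>. \<forall>\<mu>\<in>closure Gamma_pos. l + \<mu> \<in> \<Gamma> \<and> f (l + \<mu>) \<ge> f l)"

definition S3 :: "(real ^ 'n \<Rightarrow> real) \<Rightarrow> (real ^ 'n) set \<Rightarrow> bool" where
  "S3 f \<Gamma> \<longleftrightarrow> (\<forall>K. compact K \<and> K \<subseteq> \<Gamma> \<longrightarrow>
     (\<exists>\<delta>>0. \<forall>l\<in>K. \<forall>\<mu>\<in>closure Gamma_pos. f (l + \<mu>) - f l \<ge> \<delta> * norm \<mu>))"

definition S4 :: "(real ^ 'n \<Rightarrow> real) \<Rightarrow> (real ^ 'n) set \<Rightarrow> bool" where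
  "S4 f \<Gamma> \<longleftrightarrow> (\<forall>K. compact K \<and> K \<subseteq> \<Gamma> \<longrightarrow>
     (\<exists>C>0. \<forall>l\<in>K. \<forall>l'\<in>K. \<bar>f l' - f l\<bar> \<le> C * norm (l' - l)))"

text \<open>The domain of \<open>f\<close> is \<open>closure \<Gamma>\<close>; the values of the total function \<open>f\<close> elsewhere are
  irrelevant.\<close>

definition S5 :: "(real ^ 'n \<Rightarrow> real) \<Rightarrow> (real ^ 'n) set \<Rightarrow> bool" where
  "S5 f \<Gamma> \<longleftrightarrow> {l \<in> closure \<Gamma>. f l \<ge> 1} \<subseteq> \<Gamma>"

section \<open>Viscosity sub- and super-solutions of \<open>f(\<lambda>(A\<^sup>u)) = 1\<close>\<close>

definition viscosity_subsolution ::
  "(real ^ 'n \<Rightarrow> real) \<Rightarrow> (real ^ 'n) set \<Rightarrow> (real ^ 'n) set \<Rightarrow> (real ^ 'n \<Rightarrow> real) \<Rightarrow> bool" where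
  "viscosity_subsolution f \<Gamma> \<Omega> u \<longleftrightarrow>
     usc_on \<Omega> u \<and> (\<forall>x\<in>\<Omega>. 0 \<le> u x) \<and>
     (\<forall>x0\<in>\<Omega>. \<forall>\<phi>. C2_on \<Omega> \<phi> \<and> (\<forall>x\<in>\<Omega>. 0 < \<phi> x) \<and>
        u x0 = \<phi> x0 \<and> (\<forall>\<^sub>F x in nhds x0. u x \<le> \<phi> x) \<longrightarrow>
        eigenvalues (conformal_hessian \<phi> x0) \<notin> closure \<Gamma> \<or>
        f (eigenvalues (conformal_hessian \<phi> x0)) \<le> 1)"

definition viscosity_supersolution ::
  "(real ^ 'n \<Rightarrow> real) \<Rightarrow> (real ^ 'n) set \<Rightarrow> (real ^ 'n) set \<Rightarrow> (real ^ 'n \<Rightarrow> ereal) \<Rightarrow> bool" where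
  "viscosity_supersolution f \<Gamma> \<Omega> u \<longleftrightarrow>
     lsc_on \<Omega> u \<and> (\<forall>x\<in>\<Omega>. 0 < u x) \<and>
     (\<forall>x0\<in>\<Omega>. \<forall>\<phi>. C2_on \<Omega> \<phi> \<and> (\<forall>x\<in>\<Omega>. 0 < \<phi> x) \<and>
        u x0 = ereal (\<phi> x0) \<and> (\<forall>\<^sub>F x in nhds x0. ereal (\<phi> x) \<le> u x) \<longrightarrow>
        eigenvalues (conformal_hessian \<phi> x0) \<in> closure \<Gamma> \<and>
        f (eigenvalues (conformal_hessian \<phi> x0)) \<ge> 1)"

end

theory Submission
  imports Defs
begin

text \<open>
  Write \<open>w = ln u\<close>. The conformal Hessian of \<open>u\<close> becomes an exponential factor times an expression in
  \<open>\<nabla>w\<close> and \<open>\<nabla>\<^sup>2w\<close>, and test functions \<open>exp\<close> of quadratic polynomials suffice. On the part of an interior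
  ball near \<open>xh\<close> one shows \<open>ln u2 \<ge> ln u1 + \<epsilon> h\<close> for the Hopf barrier
  \<open>h x = exp (- \<alpha> |x - y|\<^sup>2) - exp (- \<alpha> R\<^sup>2)\<close>; this gives the linear growth along the normal. If the
  inequality fails, a translate of \<open>ln u1 + \<epsilon> h\<close> touches \<open>ln u2\<close> from below at an interior point.

  Only one of the two functions is \<open>C\<^sup>1\<^sup>,\<^sup>1\<close> and the other is merely semicontinuous, so the contact point
  need not admit second-order jets. Perturbing the touching function by small linear terms and doubling
  the variables with a quadratic penalty yields a set of contact points on which the slope of the
  perturbation is a Lipschitz function; its image contains a ball, so the set is not negligible. By
  Rademacher's theorem for the gradient of the \<open>C\<^sup>1\<^sup>,\<^sup>1\<close> function, one of these points has a
  second-order expansion, which gives a pair of ordered jets for the two viscosity inequalities.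

  At such a pair, the conformal Hessian of the sub-solution exceeds that of the super-solution by a
  rank-one matrix of trace of order \<open>\<epsilon> \<alpha>\<^sup>2 exp (- \<alpha> |x - y|\<^sup>2)\<close>, up to an error of order \<open>1 / \<alpha>\<close> relative
  to this. Eigenvalue monotonicity turns the rank-one gain into a gain in \<open>f\<close> through (S3), while (S4)
  controls the loss; for \<open>\<alpha>\<close> large the two viscosity inequalities contradict each other.
\<close>

section \<open>Almost everywhere differentiability of Lipschitz functions\<close>

text \<open>The equation has no explicit dependence on position, so the two jets may sit at
  different points; only their values, slopes and quadratic forms have to be compared. This is what
  makes a contact between two doubled variables usable. The equation does depend on value and slope,
  and without a favourable sign, so the comparison must be quantitative. The translate that produces
  the contact is lowered by less than \<epsilon> times the barrier, hence the change of value is of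
  the order of the barrier itself and can be charged to its second derivatives. The order of the
  choices breaks an apparent circle. The bound on the jets comes from the \<open>C11\<close>
  function near \<open>xh\<close> alone, with some room to spare; \<alpha> is chosen from this
  bound, the radius and the pair (f, \<Gamma>); then \<epsilon> is taken so small in terms of
  \<alpha> that the barrier uses up only the spare room; finally the contact error \<eta> is taken
  small compared with the least value of \<epsilon> exp (- \<alpha> |x - y|^2) on the ball.\<close>

lemma cball_segment_real: "cball (x + t / 2) (\<bar>t\<bar> / 2) = {min x (x + t)..max x (x + t)}" for x t :: real
  by (auto simp: cball_eq_atLeastAtMost)

text \<open>The segment between \<open>x\<close> and \<open>x + t\<close> is written as a closed
  ball about its midpoint so that the Vitali theorem for balls applies to \<open>t\<close> of either
  sign. The points of \<open>E\<close> are endpoints of their segments, not centres.\<close>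

lemma Vitali_covering_segments:
  fixes E :: "real set"
  assumes "open U" "E \<subseteq> U"
    and small: "\<And>x d. x \<in> E \<Longrightarrow> 0 < d \<Longrightarrow> \<exists>t. t \<noteq> 0 \<and> \<bar>t\<bar> < d \<and> P x t"
  obtains C where "countable C"
    "\<And>x t. (x, t) \<in> C \<Longrightarrow> x \<in> E \<and> t \<noteq> 0 \<and> P x t \<and> cball (x + t / 2) (\<bar>t\<bar> / 2) \<subseteq> U"
    "disjoint_family_on (\<lambda>(x, t). cball (x + t / 2) (\<bar>t\<bar> / 2)) C"
    "negligible (E - (\<Union>(x, t)\<in>C. cball (x + t / 2) (\<bar>t\<bar> / 2)))"
proof -
  let ?K = "{(x, t). x \<in> E \<and> t \<noteq> 0 \<and> P x t \<and> cball (x + t / 2) (\<bar>t\<bar> / 2) \<subseteq> U}"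
  let ?a = "\<lambda>(x::real, t). x + t / 2" and ?r = "\<lambda>(x::real, t::real). \<bar>t\<bar> / 2"
  obtain C where C: "countable C" "C \<subseteq> ?K"
    "pairwise (\<lambda>i j. disjnt (cball (?a i) (?r i)) (cball (?a j) (?r j))) C"
    "negligible (E - (\<Union>i\<in>C. cball (?a i) (?r i)))"
  proof (rule Vitali_covering_theorem_cballs[of ?K ?r E ?a])
    show "0 < ?r i" if "i \<in> ?K" for i using that by auto
    fix x d assume x: "x \<in> E" "0 < (d::real)"
    obtain e where e: "e > 0" "cball x e \<subseteq> U"
      using assms x open_contains_cball by (meson subsetD)
    obtain t where t: "t \<noteq> 0" "\<bar>t\<bar> < min d e" "P x t"
      using small[OF x(1), of "min d e"] x e by auto
    have "cball (x + t / 2) (\<bar>t\<bar> / 2) \<subseteq> cball x e"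
      using t by (auto simp: cball_eq_atLeastAtMost)
    then have "(x, t) \<in> ?K" using x t e by auto
    moreover have "x \<in> cball (?a (x, t)) (?r (x, t))" by (auto simp: cball_segment_real)
    moreover have "?r (x, t) < d" using t by auto
    ultimately show "\<exists>i. i \<in> ?K \<and> x \<in> cball (?a i) (?r i) \<and> ?r i < d" by blast
  qed blast
  show thesis
  proof (rule that[of C])
    show "countable C" by fact
    show "x \<in> E \<and> t \<noteq> 0 \<and> P x t \<and> cball (x + t / 2) (\<bar>t\<bar> / 2) \<subseteq> U" if "(x, t) \<in> C" for x t
      using C(2) that by auto
    show "disjoint_family_on (\<lambda>(x, t). cball (x + t / 2) (\<bar>t\<bar> / 2)) C"
      using C(3) unfolding disjoint_family_on_def pairwise_def disjnt_def by (simp add: case_prod_beta)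
    show "negligible (E - (\<Union>(x, t)\<in>C. cball (x + t / 2) (\<bar>t\<bar> / 2)))"
      using C(4) by (simp add: case_prod_beta)
  qed
qed

text \<open>A difference quotient of a monotone function is the ratio of its Stieltjes measure to
  Lebesgue measure on the segment, so slope conditions become inequalities between measures that add
  up over disjoint segments.\<close>

lemma emeasure_interval_measure_segment:
  fixes \<phi> :: "real \<Rightarrow> real"
  assumes "mono \<phi>" "continuous_on UNIV \<phi>" "t \<noteq> 0"
  shows "emeasure (interval_measure \<phi>) (cball (x + t / 2) (\<bar>t\<bar> / 2)) =
    ennreal ((\<phi> (x + t) - \<phi> x) / t) * emeasure lebesgue (cball (x + t / 2) (\<bar>t\<bar> / 2))"
    and "0 \<le> (\<phi> (x + t) - \<phi> x) / t"
proof -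
  have m: "\<phi> a \<le> \<phi> b" if "a \<le> b" for a b using assms(1) that by (auto simp: mono_def)
  show q: "0 \<le> (\<phi> (x + t) - \<phi> x) / t"
    using m[of x "x + t"] m[of "x + t" x] by (cases "t \<ge> 0") (auto simp: zero_le_divide_iff)
  have 1: "emeasure (interval_measure \<phi>) {a..b} = ennreal (\<phi> b - \<phi> a)" if "a \<le> b" for a b
    by (intro emeasure_interval_measure_Icc that m) (auto simp: assms)
  show "emeasure (interval_measure \<phi>) (cball (x + t / 2) (\<bar>t\<bar> / 2)) =
    ennreal ((\<phi> (x + t) - \<phi> x) / t) * emeasure lebesgue (cball (x + t / 2) (\<bar>t\<bar> / 2))"
    unfolding cball_segment_real using assms(3) q
    by (subst 1) (auto simp: min_def max_def ennreal_mult[symmetric] field_simps)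
qed

text \<open>For fixed \<open>t\<close> the condition is open in \<open>x\<close> by continuity, so
  the uncountable union over \<open>t\<close> is harmless, and \<open>d\<close> can be restricted to
  the values 1 / (n + 1).\<close>

lemma borel_frequently_quotient:
  fixes \<phi> :: "real \<Rightarrow> real"
  assumes "continuous_on UNIV \<phi>" "open S"
  shows "{x. \<forall>d>0. \<exists>t. t \<noteq> 0 \<and> \<bar>t\<bar> < d \<and> (\<phi> (x + t) - \<phi> x) / t \<in> S} \<in> sets borel"
proof -
  have "{x. \<forall>d>0. \<exists>t. t \<noteq> 0 \<and> \<bar>t\<bar> < d \<and> (\<phi> (x + t) - \<phi> x) / t \<in> S} =
    (\<Inter>n::nat. \<Union>t\<in>{t. t \<noteq> 0 \<and> \<bar>t\<bar> < 1 / (real n + 1)}. {x. (\<phi> (x + t) - \<phi> x) / t \<in> S})"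
    (is "?L = ?R")
  proof
    show "?L \<subseteq> ?R" by force
    show "?R \<subseteq> ?L"
    proof (intro subsetI, clarify)
      fix x d assume x: "x \<in> ?R" and d: "(0::real) < d"
      obtain n :: nat where n: "1 / (real n + 1) < d"
        using reals_Archimedean[OF d] by (auto simp: inverse_eq_divide add.commute)
      have "x \<in> (\<Union>t\<in>{t. t \<noteq> 0 \<and> \<bar>t\<bar> < 1 / (real n + 1)}. {x. (\<phi> (x + t) - \<phi> x) / t \<in> S})"
        using x by blast
      then show "\<exists>t. t \<noteq> 0 \<and> \<bar>t\<bar> < d \<and> (\<phi> (x + t) - \<phi> x) / t \<in> S"
        using n by force
    qed
  qed
  moreover have "open {x. (\<phi> (x + t) - \<phi> x) / t \<in> S}" if "t \<noteq> 0" for t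
  proof -
    have c: "continuous_on UNIV (\<lambda>x. (\<phi> (x + t) - \<phi> x) / t)"
      using that by (intro continuous_intros continuous_on_compose2[OF assms(1)]) auto
    show ?thesis using open_vimage[OF assms(2) c] by (simp add: vimage_def)
  qed
  ultimately show ?thesis
    by (simp only:) (intro sets.countable_INT'; auto intro!: borel_open open_UN)
qed

lemma emeasure_UN_count_space_mono:
  assumes "countable C" "disjoint_family_on K C"
    and "\<And>i. i \<in> C \<Longrightarrow> K i \<in> sets M" "\<And>i. i \<in> C \<Longrightarrow> K i \<in> sets N"
    and "\<And>i. i \<in> C \<Longrightarrow> c * emeasure M (K i) \<le> d * emeasure N (K i)"
  shows "c * emeasure M (\<Union>i\<in>C. K i) \<le> d * emeasure N (\<Union>i\<in>C. K i)"
  using assms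
  by (auto simp: emeasure_UN_countable nn_integral_cmult[symmetric] intro!: nn_integral_mono)

text \<open>Double Vitali covering. Segments of slope below \<open>p\<close> cover almost all of a
  bounded piece \<open>F\<close> of \<open>E\<close> inside an open set barely larger than
  \<open>F\<close>; segments of slope above \<open>q\<close>, placed inside the first ones, still
  cover almost all of \<open>F\<close>. Comparing Stieltjes measures gives q |F| \<le> p (|F| + e)
  for every e > 0, which forces |F| = 0.\<close>

lemma negligible_derivates_differ:
  fixes \<phi> :: "real \<Rightarrow> real"
  assumes mono: "mono \<phi>" and cont: "continuous_on UNIV \<phi>" and "p < q"
  defines "E \<equiv> {x. (\<forall>d>0. \<exists>t. t \<noteq> 0 \<and> \<bar>t\<bar> < d \<and> (\<phi> (x + t) - \<phi> x) / t < p) \<and>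
                   (\<forall>d>0. \<exists>t. t \<noteq> 0 \<and> \<bar>t\<bar> < d \<and> (\<phi> (x + t) - \<phi> x) / t > q)}"
  shows "negligible E"
proof -
  let ?K = "\<lambda>(x::real, t). cball (x + t / 2) (\<bar>t\<bar> / 2)"
  let ?\<nu> = "interval_measure \<phi>"
  have sE: "E \<in> sets borel"
  proof -
    have "E = {x. \<forall>d>0. \<exists>t. t \<noteq> 0 \<and> \<bar>t\<bar> < d \<and> (\<phi> (x + t) - \<phi> x) / t \<in> {..<p}} \<inter>
              {x. \<forall>d>0. \<exists>t. t \<noteq> 0 \<and> \<bar>t\<bar> < d \<and> (\<phi> (x + t) - \<phi> x) / t \<in> {q<..}}"
      by (auto simp: E_def)
    then show ?thesis
      by (simp only:) (intro sets.Int borel_frequently_quotient cont; simp)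
  qed
  have "negligible (E \<inter> cbox a b)" for a b
  proof (cases "E \<inter> cbox a b = {}")
    case False
    define F where "F = E \<inter> cbox a b"
    have sF: "F \<in> sets lebesgue" using sE unfolding F_def by (metis sets.Int sets_completionI_sets sets_lborel borel_closed closed_cbox)
    have mF: "F \<in> lmeasurable"
      using sF unfolding F_def by (metis bounded_cbox bounded_Int bounded_set_imp_lmeasurable)
    obtain x0 where "x0 \<in> E" using False by blast
    then obtain t where "t \<noteq> 0" "(\<phi> (x0 + t) - \<phi> x0) / t < p"
      unfolding E_def using zero_less_one by blast
    \<comment> \<open>Quotients of a monotone function are nonnegative, and one of them lies below
      \<open>p\<close>.\<close>
    then have p0: "0 < p" using emeasure_interval_measure_segment(2)[OF mono cont, of t x0] by linarith
    have ineq: "q * measure lebesgue F \<le> p * (measure lebesgue F + e)" if e: "e > 0" for e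
    proof -
      obtain U where U: "open U" "F \<subseteq> U" "U \<in> lmeasurable" "measure lebesgue U < measure lebesgue F + e"
      proof (rule sets_lebesgue_outer_open[OF sF e])
        fix T assume T: "open T" "F \<subseteq> T" "T - F \<in> lmeasurable" "emeasure lebesgue (T - F) < ennreal e"
        have TF: "T = F \<union> (T - F)" using T(2) by auto
        have mT: "T \<in> lmeasurable" using mF T(3) TF by (metis fmeasurable.Un)
        have "measure lebesgue (T - F) < e"
          using T(3,4) e by (simp add: emeasure_eq_measure2 ennreal_less_iff)
        then have "measure lebesgue T < measure lebesgue F + e"
          using measurable_measure_Diff[OF mT sF T(2)] by simp
        then show thesis using that T(1,2) mT by blast
      qed
      have "\<exists>t. t \<noteq> 0 \<and> \<bar>t\<bar> < d \<and> (\<phi> (x + t) - \<phi> x) / t < p" if "x \<in> F" "0 < d" for x d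
        using that by (auto simp: F_def E_def)
      from Vitali_covering_segments[of U F "\<lambda>x t. (\<phi> (x + t) - \<phi> x) / t < p", OF U(1,2) this]
      obtain C where C: "countable C"
        "\<And>x t. (x, t) \<in> C \<Longrightarrow> x \<in> F \<and> t \<noteq> 0 \<and> (\<phi> (x + t) - \<phi> x) / t < p \<and> ?K (x, t) \<subseteq> U"
        "disjoint_family_on ?K C" "negligible (F - (\<Union>i\<in>C. ?K i))"
        by auto
      \<comment> \<open>The second covering needs an open set that contains its segments. Passing to
        the interiors of the first family loses only countably many endpoints.\<close>
      define V where "V = (\<Union>(x, t)\<in>C. ball (x + t / 2) (\<bar>t\<bar> / 2))"
      have oV: "open V" unfolding V_def by auto
      have "negligible ((\<Union>i\<in>C. ?K i) - V)"
      proof (rule negligible_subset)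
        show "(\<Union>i\<in>C. ?K i) - V \<subseteq> (\<Union>(x,t)\<in>C. {x, x + t})"
          unfolding V_def cball_segment_real by (force simp: ball_eq_greaterThanLessThan min_def max_def split: if_splits)
        show "negligible (\<Union>(x,t)\<in>C. {x, x + t})"
          using C(1) by (auto simp: negligible_iff_null_sets intro!: null_sets_completionI countable_imp_null_set_lborel)
      qed
      then have nV: "negligible (F - V)"
        using negligible_subset[of "(F - (\<Union>i\<in>C. ?K i)) \<union> ((\<Union>i\<in>C. ?K i) - V)" "F - V"] C(4) by auto
      have "\<exists>t. t \<noteq> 0 \<and> \<bar>t\<bar> < d \<and> (\<phi> (x + t) - \<phi> x) / t > q" if "x \<in> F \<inter> V" "0 < d" for x d
        using that by (auto simp: F_def E_def)
      from Vitali_covering_segments[of V "F \<inter> V" "\<lambda>x t. (\<phi> (x + t) - \<phi> x) / t > q", OF oV _ this]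
      obtain D where D: "countable D"
        "\<And>x t. (x, t) \<in> D \<Longrightarrow> x \<in> F \<inter> V \<and> t \<noteq> 0 \<and> (\<phi> (x + t) - \<phi> x) / t > q \<and> ?K (x, t) \<subseteq> V"
        "disjoint_family_on ?K D" "negligible (F \<inter> V - (\<Union>i\<in>D. ?K i))"
        by auto
      have sK [measurable]: "?K i \<in> sets borel" "?K i \<in> sets lebesgue" for i
        by (auto split: prod.splits)
      have sUK: "(\<Union>i\<in>C. ?K i) \<in> sets borel" "(\<Union>i\<in>D. ?K i) \<in> sets borel"
        using C(1) D(1) sK(1) by (auto intro!: sets.countable_UN'')
      have sUL: "(\<Union>i\<in>D. ?K i) \<in> sets lebesgue"
        using sUK(2) by (auto intro: sets_completionI_sets)
      have "ennreal q * emeasure lebesgue F \<le> ennreal q * emeasure lebesgue (\<Union>i\<in>D. ?K i)"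
      proof (rule mult_left_mono)
        have "emeasure lebesgue F \<le> emeasure lebesgue ((\<Union>i\<in>D. ?K i) \<union> ((F - V) \<union> (F \<inter> V - (\<Union>i\<in>D. ?K i))))"
          by (intro emeasure_mono sets.Un sUL negligible_imp_sets[OF nV] negligible_imp_sets[OF D(4)]) auto
        also have "\<dots> = emeasure lebesgue (\<Union>i\<in>D. ?K i)"
          using sUK(2) nV D(4) negligible_Un[OF nV D(4)]
          by (intro emeasure_Un_null_set) (auto simp: negligible_iff_null_sets intro: sets_completionI_sets)
        finally show "emeasure lebesgue F \<le> emeasure lebesgue (\<Union>i\<in>D. ?K i)" .
      qed auto
      also have "\<dots> \<le> 1 * emeasure ?\<nu> (\<Union>i\<in>D. ?K i)"
      proof (rule emeasure_UN_count_space_mono[OF D(1,3)])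
        fix i assume "i \<in> D"
        then obtain x t where i: "i = (x, t)" "t \<noteq> 0" "(\<phi> (x + t) - \<phi> x) / t > q"
          using D(2) by (cases i) auto
        show "ennreal q * emeasure lebesgue (?K i) \<le> 1 * emeasure ?\<nu> (?K i)"
          unfolding i(1) using i(2,3)
          by (simp add: emeasure_interval_measure_segment(1)[OF mono cont i(2)]) (intro mult_right_mono ennreal_leI, auto)
      qed (use sK in auto)
      also have "\<dots> \<le> 1 * emeasure ?\<nu> (\<Union>i\<in>C. ?K i)"
      proof -
        have "(\<Union>i\<in>D. ?K i) \<subseteq> V" using D(2) by fastforce
        also have "V \<subseteq> (\<Union>i\<in>C. ?K i)" unfolding V_def by force
        finally show ?thesis using sUK by (auto intro!: emeasure_mono)
      qed
      also have "\<dots> \<le> ennreal p * emeasure lebesgue (\<Union>i\<in>C. ?K i)"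
      proof (rule emeasure_UN_count_space_mono[OF C(1,3)])
        fix i assume "i \<in> C"
        then obtain x t where i: "i = (x, t)" "t \<noteq> 0" "(\<phi> (x + t) - \<phi> x) / t < p"
          using C(2) by (cases i) auto
        show "1 * emeasure ?\<nu> (?K i) \<le> ennreal p * emeasure lebesgue (?K i)"
          unfolding i(1) using i(2,3)
          by (simp add: emeasure_interval_measure_segment(1)[OF mono cont i(2)]) (intro mult_right_mono ennreal_leI, auto)
      qed (use sK in auto)
      also have "\<dots> \<le> ennreal p * emeasure lebesgue U"
        using C(2) U(3) by (intro mult_left_mono emeasure_mono) (fastforce simp: fmeasurableD)+
      also have "\<dots> = ennreal (p * measure lebesgue U)"
        using p0 U(3) by (simp add: emeasure_eq_measure2 ennreal_mult)
      also have "ennreal q * emeasure lebesgue F = ennreal (q * measure lebesgue F)"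
        using p0 \<open>p < q\<close> mF by (simp add: emeasure_eq_measure2 ennreal_mult)
      finally have "q * measure lebesgue F \<le> p * measure lebesgue U"
        using p0 by (simp add: ennreal_le_iff)
      also have "\<dots> \<le> p * (measure lebesgue F + e)" using U(4) p0 by auto
      finally show ?thesis .
    qed
    have "q * measure lebesgue F \<le> p * measure lebesgue F"
    proof (rule field_le_epsilon)
      fix e :: real assume "e > 0"
      then show "q * measure lebesgue F \<le> p * measure lebesgue F + e"
        using ineq[of "e / p"] p0 by (simp add: distrib_left)
    qed
    then have "(q - p) * measure lebesgue F \<le> 0" by (simp add: algebra_simps)
    then have "measure lebesgue F = 0"
      using \<open>p < q\<close> by (metis diff_gt_0_iff_gt measure_nonneg mult_le_0_iff linorder_not_less order_antisym)
    then show ?thesis using mF F_def negligible_iff_measure by blast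
  qed auto
  then show ?thesis by (subst negligible_on_intervals) blast
qed


lemma frequently_at_0_iff: "(\<exists>\<^sub>F t in at (0::real). P t) \<longleftrightarrow> (\<forall>d>0. \<exists>t. t \<noteq> 0 \<and> \<bar>t\<bar> < d \<and> P t)"
  by (auto simp: frequently_at)

text \<open>Boundedness keeps liminf and limsup finite, so failure to converge leaves a gap between
  them. Taking the two levels rational lets the exceptional points be collected in a countable
  union.\<close>

lemma bounded_not_convergent_oscillates:
  fixes Q :: "'a \<Rightarrow> real"
  assumes bnd: "\<And>t. \<bar>Q t\<bar> \<le> M" and F: "F \<noteq> bot" and nc: "\<nexists>l. (Q \<longlongrightarrow> l) F"
  obtains p q where "p \<in> \<rat>" "q \<in> \<rat>" "p < q" "\<exists>\<^sub>F t in F. Q t < p" "\<exists>\<^sub>F t in F. Q t > q"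
proof -
  let ?R = "\<lambda>t. ereal (Q t)"
  have b: "ereal (- M) \<le> Liminf F ?R" "Limsup F ?R \<le> ereal M"
    using bnd by (auto intro!: Liminf_bounded Limsup_bounded always_eventually simp: abs_le_iff minus_le_iff)
  have le: "Liminf F ?R \<le> Limsup F ?R" using F by (rule Liminf_le_Limsup)
  have "Liminf F ?R \<noteq> Limsup F ?R"
  proof
    assume eq: "Liminf F ?R = Limsup F ?R"
    then have "\<bar>Limsup F ?R\<bar> \<noteq> \<infinity>" using b by (cases "Limsup F ?R") auto
    then obtain l where "Limsup F ?R = ereal l" by auto
    then have "(?R \<longlongrightarrow> ereal l) F" using eq F by (metis tendsto_iff_Liminf_eq_Limsup)
    then have "(Q \<longlongrightarrow> l) F" by simp
    then show False using nc by blast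
  qed
  then have "Liminf F ?R < Limsup F ?R" using le by auto
  then obtain c d where cd: "Liminf F ?R < ereal c" "ereal c < ereal d" "ereal d < Limsup F ?R"
    using ereal_dense2 by (metis less_ereal.simps(1))
  obtain p where p: "p \<in> \<rat>" "c < p" "p < (c + d) / 2" using Rats_dense_in_real[of c "(c+d)/2"] cd(2) by auto
  obtain q where q: "q \<in> \<rat>" "(c + d) / 2 < q" "q < d" using Rats_dense_in_real[of "(c+d)/2" d] cd(2) by auto
  show thesis
  proof (rule that[of p q])
    show "\<exists>\<^sub>F t in F. Q t < p"
    proof (rule ccontr)
      assume "\<not> ?thesis"
      then have "\<forall>\<^sub>F t in F. ereal c \<le> ?R t"
        unfolding not_frequently using p by (auto elim!: eventually_mono)
      then show False using Liminf_bounded cd(1) by (metis leD)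
    qed
    show "\<exists>\<^sub>F t in F. Q t > q"
    proof (rule ccontr)
      assume "\<not> ?thesis"
      then have "\<forall>\<^sub>F t in F. ?R t \<le> ereal d"
        unfolding not_frequently using q by (auto elim!: eventually_mono)
      then show False using Limsup_bounded cd(3) by (metis leD)
    qed
  qed (use p q in auto)
qed

text \<open>Adding \<open>L * x\<close> makes the function monotone and shifts every difference
  quotient by the constant \<open>L\<close>, so convergence of the quotients is not
  affected.\<close>

lemma negligible_lipschitz_not_differentiable_real:
  fixes \<phi> :: "real \<Rightarrow> real"
  assumes "L-lipschitz_on UNIV \<phi>"
  shows "negligible {x. \<nexists>l. ((\<lambda>t. (\<phi> (x + t) - \<phi> x) / t) \<longlongrightarrow> l) (at 0)}"
proof -
  define \<psi> where "\<psi> = (\<lambda>x. \<phi> x + L * x)"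
  have lip: "\<bar>\<phi> x - \<phi> y\<bar> \<le> L * \<bar>x - y\<bar>" for x y
    using lipschitz_onD[OF assms, of x y] by (simp add: dist_real_def)
  have L: "L \<ge> 0" using assms lipschitz_on_nonneg by blast
  have mono: "mono \<psi>"
  proof (rule monoI)
    fix x y :: real assume "x \<le> y"
    then show "\<psi> x \<le> \<psi> y" using lip[of y x] by (auto simp: \<psi>_def algebra_simps)
  qed
  have cont: "continuous_on UNIV \<psi>"
    unfolding \<psi>_def using assms by (intro continuous_intros lipschitz_on_continuous_on)
  let ?E = "\<lambda>p q. {x. (\<forall>d>0. \<exists>t. t \<noteq> 0 \<and> \<bar>t\<bar> < d \<and> (\<psi> (x + t) - \<psi> x) / t < p) \<and>
                   (\<forall>d>0. \<exists>t. t \<noteq> 0 \<and> \<bar>t\<bar> < d \<and> (\<psi> (x + t) - \<psi> x) / t > q)}"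
  have neg: "negligible (\<Union>(p, q)\<in>{(p, q). p \<in> \<rat> \<and> q \<in> \<rat> \<and> p < q}. ?E p q)"
  proof (rule negligible_countable_Union)
    have "countable (\<rat> \<times> \<rat> :: (real \<times> real) set)" by (simp add: countable_rat)
    then have "countable {(p, q). p \<in> \<rat> \<and> q \<in> \<rat> \<and> p < (q::real)}"
      by (rule countable_subset[rotated]) auto
    then show "countable ((\<lambda>(p, q). ?E p q) ` {(p, q). p \<in> \<rat> \<and> q \<in> \<rat> \<and> p < (q::real)})" by simp
    fix X assume "X \<in> (\<lambda>(p, q). ?E p q) ` {(p, q). p \<in> \<rat> \<and> q \<in> \<rat> \<and> p < (q::real)}"
    then show "negligible X" using negligible_derivates_differ[OF mono cont] by auto
  qed
  show ?thesis
  proof (rule negligible_subset[OF neg], intro subsetI, clarify)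
    fix x assume nc: "\<nexists>l. ((\<lambda>t. (\<phi> (x + t) - \<phi> x) / t) \<longlongrightarrow> l) (at 0)"
    define Q where "Q = (\<lambda>t. (\<psi> (x + t) - \<psi> x) / t)"
    have Q: "Q t = (\<phi> (x + t) - \<phi> x) / t + L" if "t \<noteq> 0" for t
      using that by (simp add: Q_def \<psi>_def field_simps)
    have nQ: "\<nexists>l. (Q \<longlongrightarrow> l) (at 0)"
    proof
      assume "\<exists>l. (Q \<longlongrightarrow> l) (at 0)"
      then obtain l where "(Q \<longlongrightarrow> l) (at 0)" by blast
      then have "((\<lambda>t. Q t - L) \<longlongrightarrow> l - L) (at 0)" by (intro tendsto_intros)
      then have "((\<lambda>t. (\<phi> (x + t) - \<phi> x) / t) \<longlongrightarrow> l - L) (at 0)"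
        by (rule Lim_transform_eventually) (auto simp: eventually_at_filter Q)
      then show False using nc by blast
    qed
    have "\<bar>Q t\<bar> \<le> 2 * L" for t
    proof (cases "t = 0")
      case False
      have "\<bar>(\<phi> (x + t) - \<phi> x) / t\<bar> \<le> L" using lip[of "x + t" x] False by (simp add: divide_le_eq)
      then show ?thesis using Q[OF False] L by linarith
    qed (use L in \<open>auto simp: Q_def\<close>)
    from bounded_not_convergent_oscillates[OF this _ nQ]
    obtain p q where "p \<in> \<rat>" "q \<in> \<rat>" "p < q" "\<exists>\<^sub>F t in at 0. Q t < p" "\<exists>\<^sub>F t in at 0. Q t > q"
      by (metis at_neq_bot)
    then show "x \<in> (\<Union>(p, q)\<in>{(p, q). p \<in> \<rat> \<and> q \<in> \<rat> \<and> p < q}. ?E p q)"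
      unfolding frequently_at_0_iff Q_def by blast
  qed
qed

text \<open>By translation invariance and Tonelli, the measure of a Borel set is the average over
  \<open>t \<in> [0, 1]\<close> of the measures of its translates by \<open>- t *\<^sub>R u\<close>, hence the integral of the measures of
  its sections in direction \<open>u\<close>.\<close>

lemma negligible_if_line_sections_negligible:
  fixes N :: "'a::euclidean_space set"
  assumes N[measurable]: "N \<in> sets borel" and sec: "\<And>x. negligible {t::real. x + t *\<^sub>R u \<in> N}"
  shows "negligible N"
proof -
  have t0: "(\<integral>\<^sup>+ t\<in>{0..1}. indicator N (x + t *\<^sub>R u) \<partial>lborel) = 0" for x
  proof -
    have m: "{t. x + t *\<^sub>R u \<in> N} \<in> sets borel"
    proof -
      have "(\<lambda>t. x + t *\<^sub>R u) -` N \<inter> space borel \<in> sets borel" by (rule measurable_sets[of _ borel borel]) auto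
      then show ?thesis by (simp add: vimage_def)
    qed
    have "emeasure lborel {t. x + t *\<^sub>R u \<in> N} = 0"
    proof -
      have "emeasure lebesgue {t. x + t *\<^sub>R u \<in> N} = 0"
        using sec[of x] negligible_iff_emeasure0 negligible_imp_sets by blast
      then show ?thesis using m by simp
    qed
    then have null: "{t. x + t *\<^sub>R u \<in> N} \<in> null_sets lborel" using m by auto
    show ?thesis
    proof (subst nn_integral_0_iff_AE)
      show "AE t in lborel. indicator N (x + t *\<^sub>R u) * indicator {0..1} t = (0::ennreal)"
        using AE_not_in[OF null] by eventually_elim (auto split: split_indicator)
    qed measurable
  qed
  have "emeasure lborel N = (\<integral>\<^sup>+ x. indicator N x \<partial>lborel)" by simp
  have tr: "(\<integral>\<^sup>+ x. indicator N (x + t *\<^sub>R u) \<partial>lborel) = emeasure lborel N" for t :: real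
  proof -
    have "emeasure lborel N = (\<integral>\<^sup>+ x. indicator N x \<partial>distr lborel borel ((+) (t *\<^sub>R u)))"
      unfolding lborel_distr_plus by simp
    also have "\<dots> = (\<integral>\<^sup>+ x. indicator N (t *\<^sub>R u + x) \<partial>lborel)"
      by (subst nn_integral_distr) auto
    finally show ?thesis by (simp add: add.commute)
  qed
  have "emeasure lborel N = (\<integral>\<^sup>+ t. indicator {0..1} (t::real) * emeasure lborel N \<partial>lborel)"
    by (subst nn_integral_multc) auto
  also have "\<dots> = (\<integral>\<^sup>+ t. (\<integral>\<^sup>+ x. indicator N (x + t *\<^sub>R u) * indicator {0..1} t \<partial>lborel) \<partial>(lborel :: real measure))"
    by (subst nn_integral_multc) (auto simp: tr mult.commute)
  also have "\<dots> = (\<integral>\<^sup>+ x. (\<integral>\<^sup>+ t. indicator N (x + t *\<^sub>R u) * indicator {0..1} t \<partial>(lborel :: real measure)) \<partial>lborel)"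
    by (rule lborel_pair.Fubini') measurable
  also have "\<dots> = 0" by (simp add: t0)
  finally show ?thesis using N by (simp add: negligible_iff_emeasure0)
qed

section \<open>Directional derivatives and Rademacher's theorem\<close>

text \<open>A relation instead of a value: existence for almost every \<open>x\<close> is one claim,
  additivity in the direction where the values exist is another.\<close>

definition dirder :: "('a::euclidean_space \<Rightarrow> real) \<Rightarrow> 'a \<Rightarrow> 'a \<Rightarrow> real \<Rightarrow> bool" where
  "dirder g x u l \<longleftrightarrow> ((\<lambda>t. (g (x + t *\<^sub>R u) - g x) / t) \<longlongrightarrow> l) (at 0)"

lemma abs_diff_le_double: "\<bar>x - l\<bar> < e \<Longrightarrow> \<bar>y - l\<bar> < e \<Longrightarrow> \<bar>x - y\<bar> \<le> 2 * e" for x y l e :: real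
  by linarith

text \<open>The Cauchy form does not mention the limit and quantifies over natural numbers. For
  continuous \<open>g\<close> the inner condition, with its non-strict inequality, is closed in
  \<open>x\<close>, so the set where the derivative exists is Borel.\<close>

lemma dirder_iff_Cauchy:
  "(\<exists>l. dirder g x u l) \<longleftrightarrow>
   (\<forall>k::nat. \<exists>m::nat. \<forall>s t. 0 < \<bar>s\<bar> \<and> \<bar>s\<bar> < 1 / (real m + 1) \<and> 0 < \<bar>t\<bar> \<and> \<bar>t\<bar> < 1 / (real m + 1) \<longrightarrow>
      \<bar>(g (x + s *\<^sub>R u) - g x) / s - (g (x + t *\<^sub>R u) - g x) / t\<bar> \<le> 1 / (real k + 1))"
  (is "_ \<longleftrightarrow> (\<forall>k. \<exists>m. ?P k m)")
proof
  let ?Q = "\<lambda>t. (g (x + t *\<^sub>R u) - g x) / t"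
  assume "\<exists>l. dirder g x u l"
  then obtain l where l: "(?Q \<longlongrightarrow> l) (at 0)" by (auto simp: dirder_def)
  show "\<forall>k. \<exists>m. ?P k m"
  proof
    fix k :: nat
    define e where "e = 1 / (2 * (real k + 1))"
    have e: "e > 0" "1 / (real k + 1) = 2 * e" by (auto simp: e_def field_simps)
    have "\<forall>\<^sub>F t in at 0. dist (?Q t) l < e"
      by (rule tendstoD[OF l e(1)])
    then obtain d where d: "d > 0" "\<And>t. t \<noteq> 0 \<Longrightarrow> \<bar>t\<bar> < d \<Longrightarrow> \<bar>?Q t - l\<bar> < e"
      unfolding eventually_at dist_real_def by (metis diff_zero UNIV_I)
    obtain m :: nat where m: "1 / (real m + 1) < d"
      using reals_Archimedean[OF d(1)] by (auto simp: inverse_eq_divide add.commute)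
    have "\<bar>?Q s - ?Q t\<bar> \<le> 1 / (real k + 1)"
      if "0 < \<bar>s\<bar>" "\<bar>s\<bar> < 1 / (real m + 1)" "0 < \<bar>t\<bar>" "\<bar>t\<bar> < 1 / (real m + 1)" for s t
    proof -
      have "\<bar>?Q s - l\<bar> < e" "\<bar>?Q t - l\<bar> < e"
        using d(2)[of s] d(2)[of t] that m by auto
      then show ?thesis unfolding e(2) by (rule abs_diff_le_double)
    qed
    then show "\<exists>m. ?P k m" by blast
  qed
next
  let ?Q = "\<lambda>t. (g (x + t *\<^sub>R u) - g x) / t"
  assume P: "\<forall>k. \<exists>m. ?P k m"
  \<comment> \<open>Completeness of the reals is applied to the image filter of the
    quotients.\<close>
  have "cauchy_filter (filtermap ?Q (at 0))"
    unfolding cauchy_filter_metric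
  proof (intro allI impI)
    fix e :: real assume e: "e > 0"
    obtain k :: nat where k: "1 / (real k + 1) < e"
      using reals_Archimedean[OF e] by (auto simp: inverse_eq_divide add.commute)
    obtain m where m: "?P k m" using P by blast
    show "\<exists>P. eventually P (filtermap ?Q (at 0)) \<and> (\<forall>y z. P y \<and> P z \<longrightarrow> dist y z < e)"
    proof (intro exI[of _ "\<lambda>y. \<exists>t. t \<noteq> 0 \<and> \<bar>t\<bar> < 1 / (real m + 1) \<and> y = ?Q t"] conjI allI impI)
      show "\<forall>\<^sub>F y in filtermap ?Q (at 0). \<exists>t. t \<noteq> 0 \<and> \<bar>t\<bar> < 1 / (real m + 1) \<and> y = ?Q t"
        unfolding eventually_filtermap eventually_at
        by (rule exI[of _ "1 / (real m + 1)"]) auto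
      fix y z assume yz: "(\<exists>t. t \<noteq> 0 \<and> \<bar>t\<bar> < 1 / (real m + 1) \<and> y = ?Q t) \<and>
        (\<exists>t. t \<noteq> 0 \<and> \<bar>t\<bar> < 1 / (real m + 1) \<and> z = ?Q t)"
      then have "\<bar>y - z\<bar> \<le> 1 / (real k + 1)" using m by auto
      then show "dist y z < e" using k by (simp add: dist_real_def)
    qed
  qed
  moreover have "filtermap ?Q (at 0) \<noteq> bot" by (simp add: filtermap_bot_iff)
  ultimately have "\<exists>l. filtermap ?Q (at 0) \<le> nhds l"
    using complete_UNIV[where 'a = real] unfolding complete_uniform by auto
  then show "\<exists>l. dirder g x u l" by (auto simp: dirder_def filterlim_def)
qed

lemma borel_dirder_exists:
  fixes g :: "'a::euclidean_space \<Rightarrow> real"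
  assumes "continuous_on UNIV g"
  shows "{x. \<nexists>l. dirder g x u l} \<in> sets borel"
proof -
  let ?S = "\<lambda>m::nat. {(s, t). 0 < \<bar>s\<bar> \<and> \<bar>s\<bar> < 1 / (real m + 1) \<and> 0 < \<bar>t\<bar> \<and> \<bar>t\<bar> < 1 / (real m + 1)}"
  let ?C = "\<lambda>k m. \<Inter>(s, t)\<in>?S m. {x. \<bar>(g (x + s *\<^sub>R u) - g x) / s - (g (x + t *\<^sub>R u) - g x) / t\<bar> \<le> 1 / (real k + 1)}"
  have eq: "{x. \<exists>l. dirder g x u l} = (\<Inter>k::nat. \<Union>m::nat. ?C k m)"
    unfolding dirder_iff_Cauchy by auto
  have "closed (?C k m)" for k m
  proof (rule closed_INT, clarify)
    fix s t :: real assume "0 < \<bar>s\<bar>" "0 < \<bar>t\<bar>"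
    then have "continuous_on UNIV (\<lambda>x. \<bar>(g (x + s *\<^sub>R u) - g x) / s - (g (x + t *\<^sub>R u) - g x) / t\<bar>)"
      by (intro continuous_intros continuous_on_compose2[OF assms]) auto
    then show "closed {x. \<bar>(g (x + s *\<^sub>R u) - g x) / s - (g (x + t *\<^sub>R u) - g x) / t\<bar> \<le> 1 / (real k + 1)}"
      by (intro closed_Collect_le continuous_on_const)
  qed
  then have "(\<Inter>k::nat. \<Union>m::nat. ?C k m) \<in> sets borel"
    by (intro sets.countable_INT'' sets.countable_UN'' borel_closed) auto
  then have "- {x. \<exists>l. dirder g x u l} \<in> sets borel" unfolding eq by (rule borel_comp)
  then show ?thesis by (simp add: Compl_eq)
qed

text \<open>On each line in direction \<open>u\<close> the function is Lipschitz in one variable, so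
  the one-dimensional result applies to every section.\<close>

lemma negligible_not_dirder:
  fixes g :: "'a::euclidean_space \<Rightarrow> real"
  assumes lip: "L-lipschitz_on UNIV g"
  shows "negligible {x. \<nexists>l. dirder g x u l}"
proof (rule negligible_if_line_sections_negligible[where u = u])
  show "{x. \<nexists>l. dirder g x u l} \<in> sets borel"
    using lip by (intro borel_dirder_exists lipschitz_on_continuous_on)
  fix x
  have "(L * norm u)-lipschitz_on UNIV (\<lambda>t. g (x + t *\<^sub>R u))"
  proof (rule lipschitz_onI)
    fix s t :: real
    have "dist (g (x + s *\<^sub>R u)) (g (x + t *\<^sub>R u)) \<le> L * dist (x + s *\<^sub>R u) (x + t *\<^sub>R u)"
      by (rule lipschitz_onD[OF lip]) auto
    also have "dist (x + s *\<^sub>R u) (x + t *\<^sub>R u) = norm u * dist s t"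
      by (simp add: dist_norm flip: scaleR_left_diff_distrib)
    finally show "dist (g (x + s *\<^sub>R u)) (g (x + t *\<^sub>R u)) \<le> L * norm u * dist s t" by (simp add: mult.assoc)
  qed (use lipschitz_on_nonneg[OF lip] in auto)
  from negligible_lipschitz_not_differentiable_real[OF this]
  show "negligible {t. x + t *\<^sub>R u \<in> {x. \<nexists>l. dirder g x u l}}"
    by (simp add: dirder_def algebra_simps)
qed

text \<open>Points at least \<open>d\<close> apart have different values of
  \<open>\<lfloor>t / d\<rfloor>\<close>.\<close>

lemma countable_separated_reals:
  fixes T :: "real set"
  assumes "0 < d" and sep: "\<And>s t. s \<in> T \<Longrightarrow> t \<in> T \<Longrightarrow> s < t \<Longrightarrow> d \<le> t - s"
  shows "countable T"
proof (rule countableI')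
  have *: "\<lfloor>s / d\<rfloor> \<noteq> \<lfloor>t / d\<rfloor>" if "s \<in> T" "t \<in> T" "s < t" for s t
  proof -
    have "1 \<le> (t - s) / d" using sep[OF that] \<open>0 < d\<close> by (simp add: field_simps)
    then have "s / d + 1 \<le> t / d" by (simp add: diff_divide_distrib)
    then show ?thesis by linarith
  qed
  show "inj_on (\<lambda>t. \<lfloor>t / d\<rfloor>) T"
    by (rule inj_onI) (metis * linorder_neqE_linordered_idom)
qed

text \<open>On a set where the difference quotients in directions \<open>u\<close>, \<open>v\<close>, \<open>u + v\<close> are uniformly close
  to \<open>a\<close>, \<open>b\<close>, \<open>c\<close> with \<open>c \<noteq> a + b\<close>, two points of a line parallel to \<open>u\<close> cannot be close.\<close>

lemma negligible_dirder_not_additive: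
  fixes g :: "'a::euclidean_space \<Rightarrow> real"
  assumes cont: "continuous_on UNIV g"
  shows "negligible {x. \<exists>a b c. dirder g x u a \<and> dirder g x v b \<and> dirder g x (u + v) c \<and> c \<noteq> a + b}"
proof -
  let ?Q = "\<lambda>x u t. (g (x + t *\<^sub>R u) - g x) / t"
  let ?near = "\<lambda>u a (k::nat) (m::nat). \<Inter>t\<in>{t. 0 < t \<and> t < 1 / (real m + 1)}. {x. \<bar>?Q x u t - a\<bar> \<le> 1 / (real k + 1)}"
  let ?C = "\<lambda>(a, b, c, k, m). ?near u a k m \<inter> ?near v b k m \<inter> ?near (u + v) c k m"
  let ?I = "{(a, b, c, k::nat, m::nat). a \<in> \<rat> \<and> b \<in> \<rat> \<and> c \<in> \<rat> \<and> \<bar>c - a - b\<bar> > 3 / (real k + 1)}"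
  have cnear: "closed (?near w a k m)" for w a k m
  proof (rule closed_INT, clarify)
    fix t :: real assume "0 < t"
    then have "continuous_on UNIV (\<lambda>x. \<bar>?Q x w t - a\<bar>)"
      by (intro continuous_intros continuous_on_compose2[OF cont]) auto
    then show "closed {x. \<bar>?Q x w t - a\<bar> \<le> 1 / (real k + 1)}"
      by (intro closed_Collect_le continuous_on_const)
  qed
  have negC: "negligible (?C i)" if "i \<in> ?I" for i
  proof -
    obtain a b c k m where i: "i = (a, b, c, k, m)" and far: "\<bar>c - a - b\<bar> > 3 / (real k + 1)"
      using \<open>i \<in> ?I\<close> by auto
    show ?thesis
    proof (rule negligible_if_line_sections_negligible[where u = u])
      show "?C i \<in> sets borel" unfolding i by (simp only: prod.case) (intro borel_closed closed_Int cnear)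
      fix x
      let ?T = "{t. x + t *\<^sub>R u \<in> ?C i}"
      have sep: "1 / (real m + 1) \<le> t - s" if "s \<in> ?T" "t \<in> ?T" "s < t" for s t
      proof (rule ccontr)
        assume close: "\<not> 1 / (real m + 1) \<le> t - s"
        define d where "d = t - s"
        define z where "z = x + s *\<^sub>R u"
        have d: "0 < d" "d < 1 / (real m + 1)" using close \<open>s < t\<close> by (auto simp: d_def)
        have zt: "x + t *\<^sub>R u = z + d *\<^sub>R u" by (simp add: z_def d_def algebra_simps)
        have "z \<in> ?C i" "z + d *\<^sub>R u \<in> ?C i" using that(1,2) by (auto simp: zt z_def)
        then have "\<bar>?Q z u d - a\<bar> \<le> 1 / (real k + 1)" "\<bar>?Q (z + d *\<^sub>R u) v d - b\<bar> \<le> 1 / (real k + 1)"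
          "\<bar>?Q z (u + v) d - c\<bar> \<le> 1 / (real k + 1)"
          using d unfolding i by auto
        \<comment> \<open>The step along \<open>u + v\<close> from \<open>z\<close> is a step along
          \<open>u\<close> to \<open>z + d *\<^sub>R u\<close> followed by a step along
          \<open>v\<close>. The second quotient is controlled because
          \<open>z + d *\<^sub>R u\<close> belongs to the same set.\<close>
        moreover have "?Q z (u + v) d = ?Q z u d + ?Q (z + d *\<^sub>R u) v d"
          using d by (simp add: algebra_simps flip: add_divide_distrib diff_divide_distrib)
        ultimately have "\<bar>c - a - b\<bar> \<le> 3 * (1 / (real k + 1))" by linarith
        then show False using far by simp
      qed
      have "countable ?T" by (rule countable_separated_reals[OF _ sep]) auto
      then show "negligible ?T"
        by (auto simp: negligible_iff_null_sets intro!: null_sets_completionI countable_imp_null_set_lborel)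
    qed
  qed
  have neg: "negligible (\<Union>i\<in>?I. ?C i)"
  proof (rule negligible_countable_Union)
    have "countable (\<rat> \<times> \<rat> \<times> \<rat> \<times> (UNIV :: nat set) \<times> (UNIV :: nat set) :: (real \<times> real \<times> real \<times> nat \<times> nat) set)"
      by (simp add: countable_rat)
    then have "countable ?I" by (rule countable_subset[rotated]) auto
    then show "countable (?C ` ?I)" by (rule countable_image)
    show "negligible X" if "X \<in> ?C ` ?I" for X using that negC by blast
  qed
  show ?thesis
  proof (rule negligible_subset[OF neg], intro subsetI, clarify)
    fix x a b c assume D: "dirder g x u a" "dirder g x v b" "dirder g x (u + v) c" and ne: "c \<noteq> a + b"
    obtain k :: nat where k: "1 / (real k + 1) < \<bar>c - a - b\<bar> / 5"
      using ne reals_Archimedean[of "\<bar>c - a - b\<bar> / 5"] by (auto simp: inverse_eq_divide add.commute)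
    \<comment> \<open>In units of \<open>e\<close> the defect |c - a - b| exceeds 10. Rounding the
      three numbers to rationals costs less than 3, which leaves more than 6 = 3 / (k + 1); a
      quotient within 1 of its limit stays within 2 = 1 / (k + 1) of the rational.\<close>
    define e where "e = 1 / (2 * (real k + 1))"
    have e: "e > 0" "1 / (real k + 1) = 2 * e" "3 / (real k + 1) = 6 * e" by (auto simp: e_def field_simps)
    have rat: "\<exists>r\<in>\<rat>. \<bar>r - y\<bar> < e" for y
    proof -
      obtain r where "r \<in> \<rat>" "y < r" "r < y + e" using Rats_dense_in_real[of y "y + e"] e(1) by auto
      then show ?thesis by (intro bexI[of _ r]) auto
    qed
    obtain a' b' c' where r: "a' \<in> \<rat>" "b' \<in> \<rat>" "c' \<in> \<rat>" "\<bar>a' - a\<bar> < e" "\<bar>b' - b\<bar> < e" "\<bar>c' - c\<bar> < e"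
      using rat[of a] rat[of b] rat[of c] by blast
    have "\<forall>\<^sub>F t in at 0. \<bar>?Q x u t - a\<bar> < e \<and> \<bar>?Q x v t - b\<bar> < e \<and> \<bar>?Q x (u + v) t - c\<bar> < e"
      using D e(1) unfolding dirder_def tendsto_iff dist_real_def by (simp add: eventually_conj_iff)
    then obtain d where d: "d > 0" "\<And>t. t \<noteq> 0 \<Longrightarrow> \<bar>t\<bar> < d \<Longrightarrow>
      \<bar>?Q x u t - a\<bar> < e \<and> \<bar>?Q x v t - b\<bar> < e \<and> \<bar>?Q x (u + v) t - c\<bar> < e"
      unfolding eventually_at dist_real_def by auto
    obtain m :: nat where m: "1 / (real m + 1) < d"
      using reals_Archimedean[OF d(1)] by (auto simp: inverse_eq_divide add.commute)
    have close: "\<bar>?Q x u t - a'\<bar> \<le> 1 / (real k + 1) \<and> \<bar>?Q x v t - b'\<bar> \<le> 1 / (real k + 1) \<and>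
      \<bar>?Q x (u + v) t - c'\<bar> \<le> 1 / (real k + 1)" if "0 < t" "t < 1 / (real m + 1)" for t
      using d(2)[of t] that m r(4-6) unfolding e(2) by auto
    have "\<bar>c' - a' - b'\<bar> > 3 / (real k + 1)"
          proof (cases "c - a - b \<ge> 0")
      case True
      then have "c' - a' - b' > 6 * e" using k r(4-6) e(1) unfolding e(2) abs_less_iff by simp
      then show ?thesis unfolding e(3) by (rule less_le_trans) simp
    next
      case False
      then have "- (c' - a' - b') > 6 * e" using k r(4-6) e(1) unfolding e(2) abs_less_iff by simp
      then show ?thesis unfolding e(3) by (rule less_le_trans) simp
    qed
    then have "(a', b', c', k, m) \<in> ?I" using r by auto
    moreover have "x \<in> ?C (a', b', c', k, m)" using close by auto
    ultimately show "x \<in> (\<Union>i\<in>?I. ?C i)" by blast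
  qed
qed

lemma dirder_scale:
  assumes "dirder g x u l"
  shows "dirder g x (r *\<^sub>R u) (r * l)"
proof (cases "r = 0")
  case False
  have "LIM t at 0. t * r :> at 0"
    using False by (auto simp: filterlim_at eventually_at_filter intro!: tendsto_eq_intros)
  from filterlim_compose[OF assms[unfolded dirder_def] this]
  have "((\<lambda>t. (g (x + (t * r) *\<^sub>R u) - g x) / (t * r)) \<longlongrightarrow> l) (at 0)" .
  then have "((\<lambda>t. r * ((g (x + (t * r) *\<^sub>R u) - g x) / (t * r))) \<longlongrightarrow> r * l) (at 0)"
    by (intro tendsto_intros)
  moreover have "r * ((g (x + (t * r) *\<^sub>R u) - g x) / (t * r)) = (g (x + t *\<^sub>R r *\<^sub>R u) - g x) / t" for t
    using False by (cases "t = 0") auto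
  ultimately show ?thesis unfolding dirder_def by simp
qed (simp add: dirder_def)

text \<open>For almost every \<open>x\<close> the derivatives exist in all directions with rational
  coordinates and are additive among these, countably many conditions in all. This determines a
  linear candidate. The Lipschitz bound and compactness of the unit sphere make the convergence
  uniform in the direction, which is Frechet differentiability.\<close>

theorem Rademacher:
  fixes g :: "'a::euclidean_space \<Rightarrow> real"
  assumes lip: "L-lipschitz_on UNIV g"
  shows "negligible {x. \<not> g differentiable (at x)}"
proof -
  define R where "R = {u::'a. \<forall>b\<in>Basis. u \<bullet> b \<in> \<rat>}"
  have cR: "countable R"
  proof -
    have "countable ((\<lambda>f. \<Sum>b\<in>Basis. f b *\<^sub>R b) ` (PiE Basis (\<lambda>_. \<rat>)) :: 'a set)"
      by (intro countable_image countable_PiE) (auto simp: countable_rat)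
    moreover have "R \<subseteq> (\<lambda>f. \<Sum>b\<in>Basis. f b *\<^sub>R b) ` (PiE Basis (\<lambda>_. \<rat>))"
    proof
      fix u assume "u \<in> R"
      then have "u = (\<lambda>f. \<Sum>b\<in>Basis. f b *\<^sub>R b) (restrict (\<lambda>b. u \<bullet> b) Basis)" "restrict (\<lambda>b. u \<bullet> b) Basis \<in> PiE Basis (\<lambda>_. \<rat>)"
        by (auto simp: R_def euclidean_representation cong: sum.cong)
      then show "u \<in> (\<lambda>f. \<Sum>b\<in>Basis. f b *\<^sub>R b) ` (PiE Basis (\<lambda>_. \<rat>))" by blast
    qed
    ultimately show ?thesis by (rule countable_subset[rotated])
  qed
  have dense: "\<exists>u\<in>R. dist v u < e" if "e > 0" for v e
  proof -
    obtain a b where ab: "\<forall>i\<in>Basis. a \<bullet> i \<in> \<rat>" "v \<in> box a b" "box a b \<subseteq> ball v (e / 2)"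
      using rational_boxes[of "e / 2" v] \<open>e > 0\<close> by auto
    have "a \<in> cbox a b" using ab(2) by (force simp: mem_box)
    then have "a \<in> closure (box a b)" using ab(2) by (metis closure_box empty_iff)
    also have "\<dots> \<subseteq> cball v (e / 2)" using closure_mono[OF ab(3)] by (simp add: \<open>e > 0\<close>)
    finally have "dist v a < e" using \<open>e > 0\<close> by auto
    then show ?thesis using ab(1) by (auto simp: R_def)
  qed
  have cont: "continuous_on UNIV g" using lip by (rule lipschitz_on_continuous_on)
  define N1 where "N1 = (\<Union>u\<in>R. {x. \<nexists>l. dirder g x u l})"
  define N2 where "N2 = (\<Union>(u, v)\<in>R \<times> R. {x. \<exists>a b c. dirder g x u a \<and> dirder g x v b \<and> dirder g x (u + v) c \<and> c \<noteq> a + b})"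
  have "negligible N1"
    unfolding N1_def using cR negligible_not_dirder[OF lip] by (intro negligible_countable_Union) auto
  moreover have "negligible N2"
    unfolding N2_def using cR negligible_dirder_not_additive[OF cont]
    by (intro negligible_countable_Union) auto
  ultimately have neg: "negligible (N1 \<union> N2)" by simp
  show ?thesis
  proof (rule negligible_subset[OF neg], rule ccontr)
    assume "\<not> {x. \<not> g differentiable (at x)} \<subseteq> N1 \<union> N2"
    then obtain x where x: "\<not> g differentiable (at x)" "x \<notin> N1" "x \<notin> N2" by auto
    have ex: "\<exists>l. dirder g x u l" if "u \<in> R" for u using x(2) that by (auto simp: N1_def)
    have add: "c = a + b" if "u \<in> R" "v \<in> R" "dirder g x u a" "dirder g x v b" "dirder g x (u + v) c" for u v a b c
      using x(3) that by (auto simp: N2_def)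
    have BR: "b \<in> R" if "b \<in> Basis" for b using that by (auto simp: R_def inner_Basis)
    have "\<forall>b\<in>Basis. \<exists>l. dirder g x b l" using ex BR by blast
    then obtain D where D: "\<And>b. b \<in> Basis \<Longrightarrow> dirder g x b (D b)" by metis
    define \<ll> where "\<ll> = (\<lambda>h. \<Sum>b\<in>Basis. (h \<bullet> b) * D b)"
    have bl: "bounded_linear \<ll>"
      unfolding \<ll>_def by (intro bounded_linear_sum bounded_linear_mult_const bounded_linear_inner_left)
    have DR: "dirder g x u (\<ll> u)" if u: "u \<in> R" for u
    proof -
      \<comment> \<open>Additivity is known only between members of \<open>R\<close>, so the sum is
        built one coordinate at a time; every partial sum of a rational vector is again in
        \<open>R\<close>.\<close>
      have "dirder g x (\<Sum>b\<in>F. (u \<bullet> b) *\<^sub>R b) (\<Sum>b\<in>F. (u \<bullet> b) * D b)" if "F \<subseteq> Basis" for F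
      proof -
        have "finite F" using that finite_Basis finite_subset by blast
        then show ?thesis using that
        proof (induction F)
          case (insert b F)
          let ?v = "\<Sum>b\<in>F. (u \<bullet> b) *\<^sub>R b"
          have b: "dirder g x ((u \<bullet> b) *\<^sub>R b) ((u \<bullet> b) * D b)" using insert D by (intro dirder_scale) auto
          have v: "dirder g x ?v (\<Sum>b\<in>F. (u \<bullet> b) * D b)" using insert by auto
          have R: "(\<Sum>b\<in>G. (u \<bullet> b) *\<^sub>R b) \<in> R" if "G \<subseteq> Basis" for G
          proof -
            have "(\<Sum>b\<in>G. (u \<bullet> b) *\<^sub>R b) \<bullet> c \<in> \<rat>" if "c \<in> Basis" for c
              unfolding inner_sum_left inner_scaleR_left using \<open>G \<subseteq> Basis\<close> that u
              by (intro Rats_sum) (auto simp: R_def inner_Basis)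
            then show ?thesis by (auto simp: R_def)
          qed
          have R1: "(u \<bullet> b) *\<^sub>R b \<in> R" using R[of "{b}"] insert by auto
          have R2: "?v \<in> R" using R[of F] insert by auto
          have "(u \<bullet> b) *\<^sub>R b + ?v \<in> R" using R[of "insert b F"] insert by simp
          then obtain c where c: "dirder g x ((u \<bullet> b) *\<^sub>R b + ?v) c" using ex by blast
          have "c = (u \<bullet> b) * D b + (\<Sum>b\<in>F. (u \<bullet> b) * D b)" by (rule add[OF R1 R2 b v c])
          then show ?case using c insert by simp
        qed (simp add: dirder_def)
      qed
      from this[of Basis] show ?thesis by (simp add: euclidean_representation \<ll>_def)
    qed
    obtain K where K: "K > 0" "\<And>h. \<bar>\<ll> h\<bar> \<le> K * norm h"
      using bounded_linear.pos_bounded[OF bl] by (auto simp: mult.commute)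
    have L: "L \<ge> 0" using lip lipschitz_on_nonneg by blast
    have "(g has_derivative \<ll>) (at x)"
      unfolding has_derivative_at_alt
    proof (intro conjI allI impI bl)
      fix e :: real assume e: "e > 0"
      \<comment> \<open>Replacing a unit direction by one at distance below \<open>r\<close> costs
        \<open>L * r\<close> in the quotient of \<open>g\<close> and \<open>K * r\<close> in the
        linear map, together e / 2. The other half is the error in finitely many directions.\<close>
      define r where "r = e / (2 * (L + K))"
      have r: "r > 0" "(L + K) * r = e / 2" using e L K by (auto simp: r_def field_simps)
      have "sphere 0 1 \<subseteq> (\<Union>u\<in>R. ball u r)"
        using dense[OF r(1)] by (auto simp: dist_commute)
      then obtain S where S: "S \<subseteq> R" "finite S" "sphere 0 1 \<subseteq> (\<Union>u\<in>S. ball u r)"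
        by (rule compactE_image[OF compact_sphere, rotated]) auto
      have "\<forall>u\<in>S. \<forall>\<^sub>F t in at 0. dist ((g (x + t *\<^sub>R u) - g x) / t) (\<ll> u) < e / 2"
        using DR S(1) e unfolding dirder_def by (intro ballI tendstoD) auto
      then have "\<forall>\<^sub>F t in at 0. \<forall>u\<in>S. dist ((g (x + t *\<^sub>R u) - g x) / t) (\<ll> u) < e / 2"
        using S(2) by (intro eventually_ball_finite)
      then obtain d where d: "d > 0" "\<And>t u. t \<noteq> 0 \<Longrightarrow> \<bar>t\<bar> < d \<Longrightarrow> u \<in> S \<Longrightarrow> \<bar>(g (x + t *\<^sub>R u) - g x) / t - \<ll> u\<bar> < e / 2"
        unfolding eventually_at dist_real_def by (metis diff_zero UNIV_I)
      show "\<exists>d>0. \<forall>y. norm (y - x) < d \<longrightarrow> norm (g y - g x - \<ll> (y - x)) \<le> e * norm (y - x)"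
      proof (intro exI[of _ d] conjI allI impI d(1))
        fix y assume y: "norm (y - x) < d"
        show "norm (g y - g x - \<ll> (y - x)) \<le> e * norm (y - x)"
        proof (cases "y = x")
          case True
          then show ?thesis using bl by (simp add: linear_simps)
        next
          case False
          define t where "t = norm (y - x)"
          define v where "v = (1 / t) *\<^sub>R (y - x)"
          have t: "t > 0" "t < d" using False y by (auto simp: t_def)
          have v: "norm v = 1" "y = x + t *\<^sub>R v" using t by (auto simp: v_def t_def)
          then obtain u where u: "u \<in> S" "dist v u < r" using S(3) by (force simp: dist_commute)
          have 1: "\<bar>g y - g (x + t *\<^sub>R u)\<bar> \<le> L * (t * r)"
          proof -
            have "\<bar>g y - g (x + t *\<^sub>R u)\<bar> \<le> L * dist y (x + t *\<^sub>R u)"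
              using lipschitz_onD[OF lip, of y "x + t *\<^sub>R u"] by (simp add: dist_real_def)
            also have "dist y (x + t *\<^sub>R u) = t * dist v u"
              using t by (simp add: v(2) dist_norm flip: scaleR_diff_right)
            also have "L * (t * dist v u) \<le> L * (t * r)" using u t L by (intro mult_left_mono) auto
            finally show ?thesis .
          qed
          have 2: "\<bar>g (x + t *\<^sub>R u) - g x - t * \<ll> u\<bar> \<le> t * (e / 2)"
          proof -
            have "g (x + t *\<^sub>R u) - g x - t * \<ll> u = t * ((g (x + t *\<^sub>R u) - g x) / t - \<ll> u)"
              using t by (simp add: field_simps)
            also have "\<bar>\<dots>\<bar> = t * \<bar>(g (x + t *\<^sub>R u) - g x) / t - \<ll> u\<bar>" using t by (simp add: abs_mult)
            also have "\<dots> \<le> t * (e / 2)" using d(2)[of t u] t u by (intro mult_left_mono) auto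
            finally show ?thesis .
          qed
          have 3: "\<bar>t * \<ll> u - \<ll> (y - x)\<bar> \<le> K * (t * r)"
          proof -
            have "t * \<ll> u - \<ll> (y - x) = \<ll> (t *\<^sub>R u - t *\<^sub>R v)"
              using bl by (simp add: v(2) linear_simps)
            also have "\<bar>\<dots>\<bar> \<le> K * norm (t *\<^sub>R u - t *\<^sub>R v)" by (rule K)
            also have "norm (t *\<^sub>R u - t *\<^sub>R v) = t * dist v u"
              using t by (simp add: dist_norm norm_minus_commute flip: scaleR_diff_right)
            also have "K * (t * dist v u) \<le> K * (t * r)" using u t K by (intro mult_left_mono) auto
            finally show ?thesis .
          qed
          have "\<bar>g y - g x - \<ll> (y - x)\<bar> \<le> L * (t * r) + t * (e / 2) + K * (t * r)"
            using 1 2 3 by linarith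
          also have "\<dots> = t * ((L + K) * r) + t * (e / 2)" by (simp add: algebra_simps)
          also have "\<dots> = e * t" unfolding r(2) by simp
          finally show ?thesis by (simp add: t_def)
        qed
      qed
    qed
    then show False using x(1) by (auto simp: differentiable_def)
  qed
qed

section \<open>Second-order expansions and contact points\<close>

text \<open>Composing with the nearest-point projection onto the closed ball extends
  \<open>G\<close> to the whole space with the same Lipschitz constant and without changing it on
  the ball. Rademacher's theorem then applies to each component.\<close>

lemma negligible_lipschitz_not_differentiable_ball:
  fixes G :: "'a::euclidean_space \<Rightarrow> 'b::euclidean_space"
  assumes "L-lipschitz_on (cball x0 r) G" "r > 0"
  shows "negligible {x \<in> ball x0 r. \<not> G differentiable (at x)}"
proof -
  let ?c = "closest_point (cball x0 r)"
  have ne: "cball x0 r \<noteq> {}" using assms(2) by auto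
  have cp: "1-lipschitz_on UNIV ?c"
    using closest_point_lipschitz[OF convex_cball closed_cball ne] by (auto intro!: lipschitz_onI)
  have range: "?c ` UNIV \<subseteq> cball x0 r" using closest_point_in_set[OF closed_cball ne] by auto
  have lip: "L-lipschitz_on UNIV (G \<circ> ?c)"
    using lipschitz_on_compose[OF cp lipschitz_on_subset[OF assms(1) range]] by simp
  have "negligible {x. \<not> (\<lambda>x. (G \<circ> ?c) x \<bullet> i) differentiable (at x)}" if "i \<in> Basis" for i
  proof (rule Rademacher)
    show "L-lipschitz_on UNIV (\<lambda>x. (G \<circ> ?c) x \<bullet> i)"
    proof (rule lipschitz_onI)
      fix x y
      have "dist ((G \<circ> ?c) x \<bullet> i) ((G \<circ> ?c) y \<bullet> i) = \<bar>((G \<circ> ?c) x - (G \<circ> ?c) y) \<bullet> i\<bar>"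
        by (simp add: dist_real_def inner_diff_left)
      also have "\<dots> \<le> norm ((G \<circ> ?c) x - (G \<circ> ?c) y)"
        using Basis_le_norm[OF that] by blast
      also have "\<dots> \<le> L * dist x y" using lipschitz_onD[OF lip, of x y] by (simp add: dist_norm)
      finally show "dist ((G \<circ> ?c) x \<bullet> i) ((G \<circ> ?c) y \<bullet> i) \<le> L * dist x y" .
    qed (use lipschitz_on_nonneg[OF lip] in auto)
  qed
  then have neg: "negligible (\<Union>i\<in>Basis. {x. \<not> (\<lambda>x. (G \<circ> ?c) x \<bullet> i) differentiable (at x)})"
    by (intro negligible_Union) auto
  show ?thesis
  proof (rule negligible_subset[OF neg], rule subsetI, rule ccontr)
    fix x assume x: "x \<in> {x \<in> ball x0 r. \<not> G differentiable (at x)}"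
      and "x \<notin> (\<Union>i\<in>Basis. {x. \<not> (\<lambda>x. (G \<circ> ?c) x \<bullet> i) differentiable (at x)})"
    then have "(G \<circ> ?c) differentiable (at x)"
      by (subst differentiable_componentwise_within) auto
    then obtain D where D: "((G \<circ> ?c) has_derivative D) (at x)" by (auto simp: differentiable_def)
    have "(G has_derivative D) (at x)"
    proof (rule has_derivative_transform_within_open[OF D open_ball])
      show "x \<in> ball x0 r" using x by auto
      fix y assume "y \<in> ball x0 r"
      then have "y \<in> cball x0 r" by auto
      then show "(G \<circ> ?c) y = G y" by (simp add: closest_point_self)
    qed
    then show False using x by (auto simp: differentiable_def)
  qed
qed

text \<open>After subtracting the linear part at \<open>x\<close>, the derivative along the segment
  is at most \<open>M * norm (z - x)\<close>. Only increments of \<open>G\<close> from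
  \<open>x\<close> enter.\<close>

lemma gradient_lipschitz_at_expansion:
  fixes W :: "'a::euclidean_space \<Rightarrow> real"
  assumes S: "convex S" "x \<in> S" "z \<in> S" and dW: "\<And>y. y \<in> S \<Longrightarrow> (W has_derivative (\<lambda>h. G y \<bullet> h)) (at y)"
    and lip: "\<And>y. y \<in> S \<Longrightarrow> norm (G y - G x) \<le> M * norm (y - x)" and M: "M \<ge> 0"
  shows "\<bar>W z - W x - G x \<bullet> (z - x)\<bar> \<le> M * (norm (z - x))\<^sup>2"
proof -
  have "norm ((W z - G x \<bullet> z) - (W x - G x \<bullet> x)) \<le> (M * norm (z - x)) * norm (z - x)"
  proof (rule differentiable_bound[where S = "closed_segment x z"])
    fix w assume w: "w \<in> closed_segment x z"
    then have wS: "w \<in> S" using closed_segment_subset[OF S(2,3,1)] by blast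
    have "((\<lambda>y. W y - G x \<bullet> y) has_derivative (\<lambda>h. G w \<bullet> h - G x \<bullet> h)) (at w)"
      by (auto intro!: derivative_eq_intros dW wS)
    then show "((\<lambda>y. W y - G x \<bullet> y) has_derivative (\<lambda>h. (G w - G x) \<bullet> h)) (at w within closed_segment x z)"
      by (auto simp: inner_diff_left intro: has_derivative_at_withinI)
    show "onorm (\<lambda>h. (G w - G x) \<bullet> h) \<le> M * norm (z - x)"
    proof (rule onorm_le)
      fix h
      have "norm (G w - G x) \<le> M * norm (w - x)" by (rule lip[OF wS])
      also have "\<dots> \<le> M * norm (z - x)"
        using segment_bound(1)[OF w] M by (intro mult_left_mono) (auto simp: norm_minus_commute)
      finally show "norm ((G w - G x) \<bullet> h) \<le> M * norm (z - x) * norm h"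
        using Cauchy_Schwarz_ineq2[of "G w - G x" h] mult_right_mono[of "norm (G w - G x)" "M * norm (z - x)" "norm h"] by auto
    qed
  qed auto
  then show ?thesis by (simp add: inner_diff_right power2_eq_square mult.assoc)
qed

text \<open>\<open>G\<close> is differentiable at the single point \<open>x\<close>, so there is no
  second derivative to integrate. The mean value theorem for \<theta> turns the remainder into the
  first-order error of \<open>G\<close> at an intermediate point, paired with
  \<open>h\<close>.\<close>

lemma second_order_expansion:
  fixes W :: "'a::euclidean_space \<Rightarrow> real"
  assumes S: "open S" "x \<in> S" and dW: "\<And>y. y \<in> S \<Longrightarrow> (W has_derivative (\<lambda>h. G y \<bullet> h)) (at y)"
    and D: "(G has_derivative D) (at x)" and e: "e > 0"
  shows "\<forall>\<^sub>F h in nhds 0. \<bar>W (x + h) - W x - G x \<bullet> h - D h \<bullet> h / 2\<bar> \<le> e * (norm h)\<^sup>2"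
proof -
  have bl: "bounded_linear D" using D by (rule has_derivative_bounded_linear)
  obtain d1 where d1: "d1 > 0" "ball x d1 \<subseteq> S" using S openE by blast
  obtain d2 where d2: "d2 > 0" "\<And>y. norm (y - x) < d2 \<Longrightarrow> norm (G y - G x - D (y - x)) \<le> e * norm (y - x)"
    using D e unfolding has_derivative_at_alt by blast
  have "\<bar>W (x + h) - W x - G x \<bullet> h - D h \<bullet> h / 2\<bar> \<le> e * (norm h)\<^sup>2" if h: "norm h < min d1 d2" for h
  proof -
    define \<theta> where "\<theta> = (\<lambda>t::real. W (x + t *\<^sub>R h) - t * (G x \<bullet> h) - t\<^sup>2 * (D h \<bullet> h) / 2)"
    have \<theta>': "(\<theta> has_real_derivative (G (x + t *\<^sub>R h) \<bullet> h - G x \<bullet> h - t * (D h \<bullet> h))) (at t)"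
      if t: "0 \<le> t" "t \<le> 1" for t
    proof -
      have "norm (t *\<^sub>R h) \<le> norm h" using t by (simp add: mult_left_le_one_le)
      then have "x + t *\<^sub>R h \<in> S" using h d1(2) by (auto simp: dist_norm)
      then have "((\<lambda>t. W (x + t *\<^sub>R h)) has_derivative (\<lambda>s. G (x + t *\<^sub>R h) \<bullet> (s *\<^sub>R h))) (at t)"
        by (intro has_derivative_compose[OF _ dW]) (auto intro!: derivative_eq_intros)
      then have "((\<lambda>t. W (x + t *\<^sub>R h)) has_real_derivative (G (x + t *\<^sub>R h) \<bullet> h)) (at t)"
        by (simp add: has_field_derivative_def mult.commute fun_eq_iff has_derivative_eq_rhs)
      then show ?thesis unfolding \<theta>_def by (auto intro!: derivative_eq_intros)
    qed
    obtain z where z: "0 < z" "z < 1"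
      "\<theta> 1 - \<theta> 0 = (1 - 0) * (G (x + z *\<^sub>R h) \<bullet> h - G x \<bullet> h - z * (D h \<bullet> h))"
      using MVT2[of 0 1 \<theta> "\<lambda>t. G (x + t *\<^sub>R h) \<bullet> h - G x \<bullet> h - t * (D h \<bullet> h)"] \<theta>' by auto
    have "W (x + h) - W x - G x \<bullet> h - D h \<bullet> h / 2 = \<theta> 1 - \<theta> 0" by (simp add: \<theta>_def)
    also have "\<dots> = (G (x + z *\<^sub>R h) - G x - D (z *\<^sub>R h)) \<bullet> h"
      using z(3) bl by (simp add: inner_diff_left linear_simps)
    finally have "\<bar>W (x + h) - W x - G x \<bullet> h - D h \<bullet> h / 2\<bar> \<le> norm (G (x + z *\<^sub>R h) - G x - D (z *\<^sub>R h)) * norm h"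
      using Cauchy_Schwarz_ineq2 by auto
    also have "\<dots> \<le> (e * norm h) * norm h"
    proof (rule mult_right_mono)
      have zh: "norm (z *\<^sub>R h) \<le> norm h" using z by (simp add: mult_left_le_one_le)
      then have "norm (G (x + z *\<^sub>R h) - G x - D (z *\<^sub>R h)) \<le> e * norm (z *\<^sub>R h)"
        using d2(2)[of "x + z *\<^sub>R h"] h by simp
      also have "\<dots> \<le> e * norm h" using zh e by (intro mult_left_mono) auto
      finally show "norm (G (x + z *\<^sub>R h) - G x - D (z *\<^sub>R h)) \<le> e * norm h" .
    qed simp
    finally show ?thesis by (simp add: power2_eq_square mult.assoc)
  qed
  then show ?thesis
    unfolding eventually_nhds_metric by (intro exI[of _ "min d1 d2"]) (use d1 d2 in \<open>auto simp: dist_norm\<close>)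
qed

section \<open>Lower semicontinuous functions and attainment of minima\<close>

lemma lsc_onD:
  fixes f :: "'a::metric_space \<Rightarrow> real"
  assumes "lsc_on S f" "x \<in> S" "c < f x"
  obtains d where "d > 0" "\<And>y. y \<in> S \<Longrightarrow> dist y x < d \<Longrightarrow> c < f y"
  using assms unfolding lsc_on_def eventually_at by metis

lemma lsc_onI:
  fixes f :: "'a::metric_space \<Rightarrow> real"
  assumes "\<And>x c. x \<in> S \<Longrightarrow> c < f x \<Longrightarrow> \<exists>d>0. \<forall>y\<in>S. dist y x < d \<longrightarrow> c < f y"
  shows "lsc_on S f"
  using assms unfolding lsc_on_def eventually_at by metis

lemma lsc_on_add:
  fixes f g :: "'a::metric_space \<Rightarrow> real"
  assumes f: "lsc_on S f" and g: "lsc_on S g"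
  shows "lsc_on S (\<lambda>x. f x + g x)"
proof (rule lsc_onI)
  fix x c assume x: "x \<in> S" and c: "c < f x + g x"
  define e where "e = (f x + g x - c) / 2"
  have e: "e > 0" using c by (simp add: e_def)
  obtain d1 where d1: "d1 > 0" "\<And>y. y \<in> S \<Longrightarrow> dist y x < d1 \<Longrightarrow> f x - e < f y"
    using lsc_onD[OF f x, of "f x - e"] e by auto
  obtain d2 where d2: "d2 > 0" "\<And>y. y \<in> S \<Longrightarrow> dist y x < d2 \<Longrightarrow> g x - e < g y"
    using lsc_onD[OF g x, of "g x - e"] e by auto
  have "c < f y + g y" if "y \<in> S" "dist y x < min d1 d2" for y
  proof -
    have "f x - e < f y" "g x - e < g y" using d1(2)[of y] d2(2)[of y] that by auto
    moreover have "c = f x - e + (g x - e)" by (simp add: e_def field_simps)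
    ultimately show ?thesis by linarith
  qed
  then show "\<exists>d>0. \<forall>y\<in>S. dist y x < d \<longrightarrow> c < f y + g y"
    using d1(1) d2(1) by (intro exI[of _ "min d1 d2"]) auto
qed

lemma continuous_on_imp_lsc_on:
  fixes f :: "'a::metric_space \<Rightarrow> real"
  assumes "continuous_on S f"
  shows "lsc_on S f"
proof (rule lsc_onI)
  fix x c assume "x \<in> S" "c < f x"
  then obtain d where d: "d > 0" "\<And>y. y \<in> S \<Longrightarrow> dist y x < d \<Longrightarrow> dist (f y) (f x) < f x - c"
    using assms unfolding continuous_on_iff by (metis diff_gt_0_iff_gt)
  have "c < f y" if "y \<in> S" "dist y x < d" for y using d(2)[OF that] by (simp add: dist_real_def)
  then show "\<exists>d>0. \<forall>y\<in>S. dist y x < d \<longrightarrow> c < f y" using d(1) by blast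
qed

lemma lsc_on_subset: "lsc_on S f \<Longrightarrow> T \<subseteq> S \<Longrightarrow> lsc_on T f"
  unfolding lsc_on_def by (metis at_le filter_leD subset_eq)

text \<open>If no point is minimal, every \<open>x\<close> has a better point \<open>b x\<close>,
  and \<open>f (b x)\<close> is still beaten by no value near \<open>x\<close>. Of the finitely many
  \<open>b z\<close> of a subcover the best one lies in some member of the subcover and must exceed
  that member's own \<open>f (b z)\<close>, a contradiction.\<close>

lemma lsc_attains_inf:
  fixes f :: "'a::metric_space \<Rightarrow> real"
  assumes S: "compact S" "S \<noteq> {}" and f: "lsc_on S f"
  obtains x where "x \<in> S" "\<And>y. y \<in> S \<Longrightarrow> f x \<le> f y"
proof (rule ccontr)
  assume "\<not> thesis"
  then have "\<forall>x\<in>S. \<exists>y\<in>S. f y < f x" using that by (meson not_le)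
  then obtain b where b: "\<And>x. x \<in> S \<Longrightarrow> b x \<in> S \<and> f (b x) < f x" by metis
  have "\<forall>x\<in>S. \<exists>d>0. \<forall>y\<in>S. dist y x < d \<longrightarrow> f (b x) < f y"
    using b lsc_onD[OF f] by metis
  then obtain d where d: "\<And>x. x \<in> S \<Longrightarrow> d x > 0"
    "\<And>x y. x \<in> S \<Longrightarrow> y \<in> S \<Longrightarrow> dist y x < d x \<Longrightarrow> f (b x) < f y" by metis
  have "S \<subseteq> (\<Union>x\<in>S. ball x (d x))" using d(1) by force
  then obtain T where T: "T \<subseteq> S" "finite T" "S \<subseteq> (\<Union>x\<in>T. ball x (d x))"
    by (rule compactE_image[OF S(1), rotated]) auto
  have "T \<noteq> {}" using T(3) S(2) by auto
  then have fin: "finite (f ` b ` T)" "f ` b ` T \<noteq> {}" using T(2) by auto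
  obtain x where x: "x \<in> T" "f (b x) = Min (f ` b ` T)" using Min_in[OF fin] by auto
  then have "b x \<in> S" using b T(1) by auto
  then obtain z where z: "z \<in> T" "b x \<in> ball z (d z)" using T(3) by auto
  then have "f (b z) < f (b x)" using d(2)[of z "b x"] \<open>b x \<in> S\<close> T(1) by (auto simp: dist_commute)
  moreover have "f (b x) \<le> f (b z)" unfolding x(2) using fin z(1) by (intro Min_le) auto
  ultimately show False by simp
qed

lemma lsc_on_snd:
  fixes S :: "'a::metric_space set" and g :: "'b::metric_space \<Rightarrow> real"
  assumes "lsc_on T g"
  shows "lsc_on (S \<times> T) (\<lambda>z. g (snd z))"
proof (rule lsc_onI, clarify)
  fix x y c assume "x \<in> S" "y \<in> T" "c < g (snd (x, y))"
  then obtain d where d: "d > 0" "\<And>z. z \<in> T \<Longrightarrow> dist z y < d \<Longrightarrow> c < g z"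
    using lsc_onD[OF assms, of y c] by auto
  show "\<exists>d>0. \<forall>w\<in>S \<times> T. dist w (x, y) < d \<longrightarrow> c < g (snd w)"
  proof (intro exI[of _ d] conjI ballI impI d(1))
    fix w assume "w \<in> S \<times> T" "dist w (x, y) < d"
    then show "c < g (snd w)"
      using d(2)[of "snd w"] dist_snd_le[of w "(x, y)"] by auto
  qed
qed

lemma norm_add_power2: "(norm (a + b))\<^sup>2 = (norm a)\<^sup>2 + 2 * (a \<bullet> b) + (norm b)\<^sup>2" for a b :: "'a::real_inner"
  by (simp add: power2_norm_eq_inner inner_add_left inner_add_right inner_commute)

text \<open>A substitute for Jensen's lemma that needs no semiconvexity of \<open>g\<close>: the points \<open>x\<close> at which
  \<open>g y - W x + k |x - x0|\<^sup>2 + |x - y|\<^sup>2 / (2 \<delta>) - p \<bullet> (x - x0)\<close> attains its minimum, for some slope \<open>p\<close>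
  in a small ball, determine \<open>p\<close> in a Lipschitz way; hence they form a non-negligible set and \<open>G\<close> is
  differentiable at one of them. Shifting \<open>x\<close> and \<open>y\<close> by the same \<open>h\<close> transfers the expansion of \<open>W\<close>
  at \<open>x\<close> to a lower bound of \<open>g\<close> near \<open>y\<close>.\<close>

lemma perturbed_contact_point:
  fixes g W :: "'a::euclidean_space \<Rightarrow> real" and G :: "'a \<Rightarrow> 'a"
  assumes r: "r > 0" and lsc: "lsc_on (cball x0 r) g"
    and le: "\<And>x. x \<in> cball x0 r \<Longrightarrow> W x \<le> g x" and eq: "g x0 = W x0"
    and dW: "\<And>x. x \<in> cball x0 r \<Longrightarrow> (W has_derivative (\<lambda>h. G x \<bullet> h)) (at x)"
    and lip: "L-lipschitz_on (cball x0 r) G" and \<eta>: "\<eta> > 0"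
  obtains x y p D where "x \<in> ball x0 r" "x \<in> ball x0 \<eta>" "y \<in> ball x0 r" "y \<in> ball x0 \<eta>"
    "(G has_derivative D) (at x)" "norm (p - G x) \<le> \<eta>" "\<bar>g y - W x\<bar> \<le> \<eta>"
    "\<forall>\<^sub>F h in nhds 0. g y + p \<bullet> h + D h \<bullet> h / 2 - \<eta> * (norm h)\<^sup>2 \<le> g (y + h)"
proof -
  let ?S = "cball x0 r"
  have x0S: "x0 \<in> ?S" using r by auto
  have L: "L \<ge> 0" using lip lipschitz_on_nonneg by blast
  define B where "B = norm (G x0) + L * r"
  have B: "B \<ge> 0" using L r by (simp add: B_def)
  have GB: "norm (G x) \<le> B" if "x \<in> ?S" for x
  proof -
    have "norm (G x - G x0) \<le> L * dist x x0"
      using lipschitz_onD[OF lip that x0S] by (simp add: dist_norm)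
    also have "\<dots> \<le> L * r" using that L by (intro mult_left_mono) (auto simp: dist_commute)
    finally show ?thesis using norm_triangle_ineq2[of "G x" "G x0"] by (simp add: B_def)
  qed
  have WB: "\<bar>W x - W y\<bar> \<le> B * norm (x - y)" if "x \<in> ?S" "y \<in> ?S" for x y
  proof -
    have "norm (W x - W y) \<le> B * norm (x - y)"
    proof (rule differentiable_bound[where S = ?S])
      show "(W has_derivative (\<lambda>h. G z \<bullet> h)) (at z within ?S)" if "z \<in> ?S" for z
        using dW[OF that] has_derivative_at_withinI by blast
      show "onorm (\<lambda>h. G z \<bullet> h) \<le> B" if "z \<in> ?S" for z
      proof (rule onorm_le)
        show "norm (G z \<bullet> h) \<le> B * norm h" for h
          using Cauchy_Schwarz_ineq2[of "G z" h] GB[OF that] mult_right_mono[of "norm (G z)" B "norm h"] by auto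
      qed
    qed (use that in auto)
    then show ?thesis by simp
  qed
  \<comment> \<open>\<open>k\<close> weighs the penalty that makes \<open>x0\<close> a strict
    contact, \<open>m\<close> is the radius in which all contact points must stay, and
    \<open>s\<close> bounds the total defect so that this radius results. \<delta> and \<rho> are
    chosen so that the two error terms in the comparison with \<open>x0\<close> are at most s / 2
    each.\<close>
  define k where "k = \<eta> / 4"
  define m where "m = min (min r \<eta>) 1 / (4 * (B + 1))"
  define s where "s = min k 1 * m\<^sup>2 / 16"
  define \<delta> where "\<delta> = min (1/4) (s / (2 * (B\<^sup>2 + 1)))"
  define \<rho> where "\<rho> = min (min 1 (\<eta> / 2)) (sqrt (k * s))"
  have k: "k > 0" using \<eta> by (simp add: k_def)
  have m: "m > 0" "m \<le> r / 4" "m \<le> \<eta> / 4" "m \<le> 1" "m * (B + 1) \<le> \<eta> / 4"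
  proof -
    let ?q = "min (min r \<eta>) 1"
    have q: "?q > 0" using r \<eta> by auto
    then show "m > 0" using B by (simp add: m_def)
    have "m \<le> ?q / 4" unfolding m_def using B q by (intro divide_left_mono) auto
    then show "m \<le> r / 4" "m \<le> \<eta> / 4" "m \<le> 1" by auto
    have "m * (B + 1) = ?q / 4" unfolding m_def using B by (simp add: field_simps)
    then show "m * (B + 1) \<le> \<eta> / 4" by auto
  qed
  have s: "s > 0" using k m by (simp add: s_def)
  have \<delta>: "\<delta> > 0" "\<delta> \<le> 1/4" "B\<^sup>2 * \<delta> \<le> s / 2"
  proof -
    show "\<delta> > 0" using s by (simp add: \<delta>_def add_nonneg_pos)
    show "\<delta> \<le> 1/4" unfolding \<delta>_def by (rule min.cobounded1)
    have "B\<^sup>2 * \<delta> \<le> B\<^sup>2 * (s / (2 * (B\<^sup>2 + 1)))" by (intro mult_left_mono) (auto simp: \<delta>_def)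
    also have "\<dots> = (B\<^sup>2 / (B\<^sup>2 + 1)) * (s / 2)" by (simp add: field_simps)
    also have "\<dots> \<le> 1 * (s / 2)" using s by (intro mult_right_mono) (auto simp: divide_le_eq add_nonneg_pos)
    finally show "B\<^sup>2 * \<delta> \<le> s / 2" by simp
  qed
  have \<rho>: "\<rho> > 0" "\<rho> \<le> 1" "\<rho> \<le> \<eta> / 2" "\<rho>\<^sup>2 \<le> k * s"
  proof -
    show "\<rho> > 0" "\<rho> \<le> 1" "\<rho> \<le> \<eta> / 2" using \<eta> k s by (auto simp: \<rho>_def)
    have "\<rho>\<^sup>2 \<le> (sqrt (k * s))\<^sup>2" using \<open>\<rho> > 0\<close> by (intro power_mono) (auto simp: \<rho>_def)
    then show "\<rho>\<^sup>2 \<le> k * s" using k s by simp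
  qed
  define V where "V = (\<lambda>x. W x - k * (norm (x - x0))\<^sup>2)"
  define H where "H = (\<lambda>x. G x - (2 * k) *\<^sub>R (x - x0))"
  define M where "M = L + 2 * k"
  have M: "M \<ge> 0" using L k by (simp add: M_def)
  have dV: "(V has_derivative (\<lambda>h. H x \<bullet> h)) (at x)" if "x \<in> ?S" for x
  proof -
    have "(V has_derivative (\<lambda>h. G x \<bullet> h - k * (h \<bullet> (x - x0) + (x - x0) \<bullet> h))) (at x)"
      unfolding V_def power2_norm_eq_inner by (auto intro!: derivative_eq_intros dW that)
    also have "(\<lambda>h. G x \<bullet> h - k * (h \<bullet> (x - x0) + (x - x0) \<bullet> h)) = (\<lambda>h. H x \<bullet> h)"
      by (simp add: H_def fun_eq_iff algebra_simps inner_commute)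
    finally show ?thesis .
  qed
  have lipH: "norm (H x - H y) \<le> M * norm (x - y)" if "x \<in> ?S" "y \<in> ?S" for x y
  proof -
    have "H x - H y = (G x - G y) - (2 * k) *\<^sub>R (x - y)" by (simp add: H_def algebra_simps)
    then have "norm (H x - H y) \<le> norm (G x - G y) + norm ((2 * k) *\<^sub>R (x - y))"
      using norm_triangle_ineq4 by metis
    also have "norm (G x - G y) \<le> L * norm (x - y)" using lipschitz_onD[OF lip that] by (simp add: dist_norm)
    finally show ?thesis using k by (simp add: M_def distrib_right)
  qed
  have contV: "continuous_on ?S V"
    using dV by (meson continuous_at_imp_continuous_on has_derivative_continuous)
  have Vlow: "V z - V x \<ge> H x \<bullet> (z - x) - M * (norm (z - x))\<^sup>2" if "x \<in> ?S" "z \<in> ?S" for x z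
  proof -
    have "\<bar>V z - V x - H x \<bullet> (z - x)\<bar> \<le> M * (norm (z - x))\<^sup>2"
      by (rule gradient_lipschitz_at_expansion[OF convex_cball that dV lipH[OF _ that(1)] M])
    then show ?thesis by linarith
  qed
  define \<Phi> where "\<Phi> = (\<lambda>p x y. g y - V x + (norm (x - y))\<^sup>2 / (2 * \<delta>) - p \<bullet> (x - x0))"
  define contact where "contact = (\<lambda>p x y. x \<in> ?S \<and> y \<in> ?S \<and> (\<forall>x'\<in>?S. \<forall>y'\<in>?S. \<Phi> p x y \<le> \<Phi> p x' y'))"
  have ex: "\<exists>x y. contact p x y" for p
  proof -
    have "lsc_on (?S \<times> ?S) (\<lambda>z. g (snd z) + (- V (fst z) + (norm (fst z - snd z))\<^sup>2 / (2 * \<delta>) - p \<bullet> (fst z - x0)))"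
    proof (intro lsc_on_add lsc_on_snd lsc continuous_on_imp_lsc_on)
      have "continuous_on (?S \<times> ?S) (\<lambda>z. V (fst z))"
        by (rule continuous_on_compose2[OF contV continuous_on_fst]) auto
      then show "continuous_on (?S \<times> ?S) (\<lambda>z. - V (fst z) + (norm (fst z - snd z))\<^sup>2 / (2 * \<delta>) - p \<bullet> (fst z - x0))"
        using \<delta> by (intro continuous_intros) auto
    qed
    moreover have "compact (?S \<times> ?S)" "?S \<times> ?S \<noteq> {}" using x0S by (auto intro: compact_Times)
    ultimately obtain z where z: "z \<in> ?S \<times> ?S" "\<And>w. w \<in> ?S \<times> ?S \<Longrightarrow>
        g (snd z) + (- V (fst z) + (norm (fst z - snd z))\<^sup>2 / (2 * \<delta>) - p \<bullet> (fst z - x0)) \<le>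
        g (snd w) + (- V (fst w) + (norm (fst w - snd w))\<^sup>2 / (2 * \<delta>) - p \<bullet> (fst w - x0))"
      using lsc_attains_inf by blast
    have "\<Phi> p (fst z) (snd z) \<le> \<Phi> p (fst w) (snd w)" if "w \<in> ?S \<times> ?S" for w
      using z(2)[OF that] unfolding \<Phi>_def by linarith
    with z(1) show ?thesis unfolding contact_def by (intro exI[of _ "fst z"] exI[of _ "snd z"]) auto
  qed
  have close: "norm (x - x0) \<le> m / 2 \<and> norm (x - y) \<le> m / 2 \<and> \<bar>g y - W x\<bar> \<le> \<eta>"
    if c: "contact p x y" and p: "norm p < \<rho>" for p x y
  proof -
    let ?a = "norm (x - y)" and ?b = "norm (x - x0)"
    have xy: "x \<in> ?S" "y \<in> ?S" using c by (auto simp: contact_def)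
    have "\<Phi> p x y \<le> \<Phi> p x0 x0" using c x0S by (auto simp: contact_def)
    then have 1: "g y - W x + k * ?b\<^sup>2 + ?a\<^sup>2 / (2 * \<delta>) \<le> p \<bullet> (x - x0)" by (simp add: \<Phi>_def V_def eq)
    have 2: "p \<bullet> (x - x0) \<le> \<rho> * ?b"
      using norm_cauchy_schwarz[of p "x - x0"] p mult_right_mono[of "norm p" \<rho> ?b] by auto
    have 3: "W x - g y \<le> B * ?a" using WB[OF xy] le[OF xy(2)] by linarith
    have 4: "B * ?a \<le> ?a\<^sup>2 / (4 * \<delta>) + B\<^sup>2 * \<delta>"
    proof -
      have "0 \<le> (?a - 2 * \<delta> * B)\<^sup>2" by simp
      then have "4 * \<delta> * (B * ?a) \<le> ?a\<^sup>2 + 4 * \<delta> * (B\<^sup>2 * \<delta>)" by (simp add: power2_eq_square algebra_simps)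
      then show ?thesis using \<delta> by (simp add: field_simps)
    qed
    have 5: "\<rho> * ?b \<le> k * ?b\<^sup>2 / 2 + \<rho>\<^sup>2 / (2 * k)"
    proof -
      have "0 \<le> (k * ?b - \<rho>)\<^sup>2" by simp
      then have "2 * k * (\<rho> * ?b) \<le> k\<^sup>2 * ?b\<^sup>2 + \<rho>\<^sup>2" by (simp add: power2_eq_square algebra_simps)
      then show ?thesis using k by (simp add: field_simps power2_eq_square)
    qed
    have 6: "\<rho>\<^sup>2 / (2 * k) \<le> s / 2" using \<rho>(4) k by (simp add: field_simps)
    have 7: "?a\<^sup>2 / (2 * \<delta>) = ?a\<^sup>2 / (4 * \<delta>) + ?a\<^sup>2 / (4 * \<delta>)" by simp
    have 8: "k * ?b\<^sup>2 / 2 + ?a\<^sup>2 / (4 * \<delta>) \<le> s" using 1 2 3 4 5 6 7 \<delta>(3) by linarith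
    have 9: "0 \<le> ?a\<^sup>2 / (4 * \<delta>)" "0 \<le> k * ?b\<^sup>2 / 2" using \<delta>(1) k by auto
    have "k * ?b\<^sup>2 / 2 \<le> s" using 8 9 by linarith
    also have "s \<le> k * m\<^sup>2 / 16" by (simp add: s_def mult_right_mono)
    finally have "k * ?b\<^sup>2 \<le> k * (m\<^sup>2 / 8)" by simp
    then have "?b\<^sup>2 \<le> m\<^sup>2 / 8" using k by simp
    also have "\<dots> \<le> (m / 2)\<^sup>2" by (simp add: power_divide)
    finally have b: "?b \<le> m / 2" using m by (simp add: power_mono_iff)
    have "?a\<^sup>2 \<le> ?a\<^sup>2 / (4 * \<delta>)" using \<delta>(1,2) by (simp add: le_divide_eq mult_left_le)
    also have "\<dots> \<le> s" using 8 9 by linarith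
    also have "s \<le> m\<^sup>2 / 16" by (simp add: s_def mult_left_le_one_le k less_imp_le)
    also have "\<dots> \<le> (m / 2)\<^sup>2" by (simp add: power_divide)
    finally have a: "?a \<le> m / 2" using m by (simp add: power_mono_iff)
    have "g y - W x \<le> \<rho> * ?b" using 1 2 7 9 by linarith
    also have "\<dots> \<le> 1 * (m / 2)" using \<rho> b by (intro mult_mono) auto
    finally have u: "g y - W x \<le> \<eta>" using m \<eta> by linarith
    have "B * ?a \<le> B * m" using a m B by (intro mult_left_mono) auto
    also have "\<dots> \<le> \<eta>" using m \<eta> B by (simp add: algebra_simps)
    finally have "W x - g y \<le> \<eta>" using 3 by linarith
    then show ?thesis using a b u by auto
  qed
  \<comment> \<open>Only \<open>x\<close> is varied, because \<open>g\<close> has no derivative. The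
    stationarity condition expresses \<open>x - y\<close>, and hence \<open>y\<close>, through
    \<open>x\<close> and \<open>p\<close>.\<close>
  have slope: "(1 / \<delta>) *\<^sub>R (x - y) = H x + p" if c: "contact p x y" and p: "norm p < \<rho>" for p x y
  proof -
    have xS: "x \<in> ?S" "y \<in> ?S" using c by (auto simp: contact_def)
    have xb: "x \<in> ball x0 r" using close[OF c p] m by (auto simp: dist_norm norm_minus_commute)
    let ?f = "\<lambda>x. \<Phi> p x y"
    define c2 where "c2 = 1 / (2 * \<delta>)"
    have f: "?f = (\<lambda>x. g y - V x + c2 * ((x - y) \<bullet> (x - y)) - p \<bullet> (x - x0))"
      by (simp add: \<Phi>_def power2_norm_eq_inner c2_def)
    have "(?f has_derivative (\<lambda>h. - (H x \<bullet> h) + c2 * (h \<bullet> (x - y) + (x - y) \<bullet> h) - p \<bullet> h)) (at x)"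
      unfolding f by (auto intro!: derivative_eq_intros dV xS)
    moreover have "\<And>z. z \<in> ball x0 r \<Longrightarrow> ?f x \<le> ?f z" using c by (auto simp: contact_def)
    ultimately have zero: "(\<lambda>h. - (H x \<bullet> h) + c2 * (h \<bullet> (x - y) + (x - y) \<bullet> h) - p \<bullet> h) = (\<lambda>h. 0)"
      using differential_zero_maxmin[of x "ball x0 r" ?f] xb by blast
    have "((1 / \<delta>) *\<^sub>R (x - y) - (H x + p)) \<bullet> h = 0" for h
    proof -
      have "(1 / (2 * \<delta>)) * (h \<bullet> (x - y) + (x - y) \<bullet> h) = ((1 / \<delta>) *\<^sub>R (x - y)) \<bullet> h"
        by (simp only: inner_commute[of h] inner_scaleR_left) simp
      then show ?thesis unfolding c2_def[symmetric] using fun_cong[OF zero, of h] unfolding inner_diff_left[of _ "H x + p"] inner_add_left[of "H x" p] by linarith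
    qed
    then have "(1 / \<delta>) *\<^sub>R (x - y) - (H x + p) = 0" using inner_eq_zero_iff by blast
    then show ?thesis by simp
  qed
  define K where "K = 1 / \<delta> + 5 * M"
  have slope_lip: "norm (p - p') \<le> K * norm (x - x')"
    if c: "contact p x y" "norm p < \<rho>" and c': "contact p' x' y'" "norm p' < \<rho>" for p x y p' x' y'
  proof -
    let ?q = "H x + p" and ?q' = "H x' + p'"
    define d where "d = norm (x - x')"
    have S: "x \<in> ?S" "y \<in> ?S" "x' \<in> ?S" "y' \<in> ?S" using c c' by (auto simp: contact_def)
    have xy: "x - y = \<delta> *\<^sub>R ?q" "x' - y' = \<delta> *\<^sub>R ?q'"
    proof -
      have "v = \<delta> *\<^sub>R ((1 / \<delta>) *\<^sub>R v)" for v :: 'a using \<delta> by simp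
      then show "x - y = \<delta> *\<^sub>R ?q" "x' - y' = \<delta> *\<^sub>R ?q'"
        using slope[OF c] slope[OF c'] by metis+
    qed
    have dm: "d \<le> m" using close[OF c] close[OF c'] norm_triangle_ineq4[of "x - x0" "x' - x0"] by (auto simp: d_def)
    have qq: "norm (?q - ?q') \<le> (1 / \<delta> + 4 * M) * d"
    proof (cases "?q = ?q'")
      case True
      then show ?thesis using \<delta> M by (simp add: d_def)
    next
      case False
      define e where "e = sgn (?q - ?q')"
      have e: "norm e = 1" "(?q - ?q') \<bullet> e = norm (?q - ?q')"
      proof -
        show "norm e = 1" using False by (simp add: e_def norm_sgn)
        have "?q - ?q' = norm (?q - ?q') *\<^sub>R e" using False by (simp add: e_def sgn_div_norm)
        then have "(?q - ?q') \<bullet> e = norm (?q - ?q') * (e \<bullet> e)" by (metis inner_scaleR_left)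
        then show "(?q - ?q') \<bullet> e = norm (?q - ?q')" using \<open>norm e = 1\<close> by (simp add: norm_eq_1)
      qed
      have d0: "d \<ge> 0" by (simp add: d_def)
      \<comment> \<open>Each minimum is tested with the \<open>y\<close> of the other one, so that
        the values of \<open>g\<close> cancel in the sum. The free point \<open>z\<close> moves from
        \<open>x'\<close> by \<tau> in the direction \<open>e\<close> of \<open>?q - ?q'\<close>,
        which extracts the norm of this difference.\<close>
      have main: "\<tau> * norm (?q - ?q') \<le> (\<tau>\<^sup>2 + d\<^sup>2) / (2 * \<delta>) + M * (\<tau> + d)\<^sup>2"
        if \<tau>: "0 \<le> \<tau>" "\<tau> \<le> m" for \<tau>
      proof -
      define z where "z = x' + \<tau> *\<^sub>R e"
      have zx': "norm (z - x') = \<tau>" using \<tau> by (simp add: z_def e)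
      have zx: "norm (z - x) \<le> \<tau> + d"
        using norm_triangle_ineq[of "z - x'" "x' - x"] zx' by (simp add: d_def norm_minus_commute)
      have zS: "z \<in> ?S"
      proof -
        have "norm (z - x0) \<le> norm (z - x') + norm (x' - x0)" using norm_triangle_ineq[of "z - x'" "x' - x0"] by simp
        also have "\<dots> \<le> m + m / 2" using zx' \<tau> close[OF c'] by auto
        finally show ?thesis using m by (auto simp: dist_norm norm_minus_commute)
      qed
      have "\<Phi> p x y \<le> \<Phi> p z y'" "\<Phi> p' x' y' \<le> \<Phi> p' x' y"
        using c c' zS S by (auto simp: contact_def)
      then have i1: "V z - V x + p \<bullet> (z - x) \<le> g y' - g y + ((norm (z - y'))\<^sup>2 - (norm (x - y))\<^sup>2) / (2 * \<delta>)"
        and i2: "g y' - g y \<le> ((norm (x' - y))\<^sup>2 - (norm (x' - y'))\<^sup>2) / (2 * \<delta>)"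
        by (auto simp: \<Phi>_def inner_diff_right diff_divide_distrib)
      have i3: "H x \<bullet> (z - x) - M * (norm (z - x))\<^sup>2 \<le> V z - V x" by (rule Vlow[OF S(1) zS])
      have "?q \<bullet> (z - x) - M * (norm (z - x))\<^sup>2 \<le>
        ((norm (z - y'))\<^sup>2 - (norm (x' - y'))\<^sup>2 + ((norm (x' - y))\<^sup>2 - (norm (x - y))\<^sup>2)) / (2 * \<delta>)"
        using i1 i2 i3 by (simp add: inner_add_left add_divide_distrib diff_divide_distrib)
      moreover have "(norm (z - y'))\<^sup>2 - (norm (x' - y'))\<^sup>2 = 2 * \<delta> * (?q' \<bullet> (z - x')) + \<tau>\<^sup>2"
      proof -
        have "z - y' = (z - x') + (x' - y')" by simp
        then have "(norm (z - y'))\<^sup>2 = (norm (z - x'))\<^sup>2 + 2 * ((z - x') \<bullet> (x' - y')) + (norm (x' - y'))\<^sup>2"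
          by (metis norm_add_power2)
        then show ?thesis by (simp add: xy zx' inner_commute)
      qed
      moreover have "(norm (x' - y))\<^sup>2 - (norm (x - y))\<^sup>2 = 2 * \<delta> * (?q \<bullet> (x' - x)) + d\<^sup>2"
      proof -
        have "x' - y = (x' - x) + (x - y)" by simp
        then have "(norm (x' - y))\<^sup>2 = (norm (x' - x))\<^sup>2 + 2 * ((x' - x) \<bullet> (x - y)) + (norm (x - y))\<^sup>2"
          by (metis norm_add_power2)
        then show ?thesis by (simp add: xy d_def inner_commute norm_minus_commute)
      qed
      ultimately have "?q \<bullet> (z - x) - M * (norm (z - x))\<^sup>2 \<le>
        (2 * \<delta> * (?q' \<bullet> (z - x')) + \<tau>\<^sup>2 + (2 * \<delta> * (?q \<bullet> (x' - x)) + d\<^sup>2)) / (2 * \<delta>)" by simp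
      also have "\<dots> = ?q' \<bullet> (z - x') + ?q \<bullet> (x' - x) + (\<tau>\<^sup>2 + d\<^sup>2) / (2 * \<delta>)" using \<delta> by (simp add: field_simps)
      finally have "(?q - ?q') \<bullet> (z - x') \<le> (\<tau>\<^sup>2 + d\<^sup>2) / (2 * \<delta>) + M * (norm (z - x))\<^sup>2"
        by (simp add: inner_diff_right inner_diff_left inner_add_left)
      also have "(norm (z - x))\<^sup>2 \<le> (\<tau> + d)\<^sup>2" using zx by (intro power_mono) auto
      finally have "(?q - ?q') \<bullet> (z - x') \<le> (\<tau>\<^sup>2 + d\<^sup>2) / (2 * \<delta>) + M * (\<tau> + d)\<^sup>2" using M by (simp add: mult_left_mono)
      moreover have "(?q - ?q') \<bullet> (z - x') = \<tau> * norm (?q - ?q')"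
        unfolding z_def using e(2) by simp
      ultimately show ?thesis by simp
      qed
      \<comment> \<open>For d > 0 the choice \<tau> = d gives the Lipschitz bound. For d = 0 the
        limit \<tau> \<rightarrow> 0 shows that \<open>x\<close> alone determines the slope.\<close>
      show ?thesis
      proof (cases "d = 0")
        case False
        have "d * norm (?q - ?q') \<le> d * ((1 / \<delta> + 4 * M) * d)"
          using main[OF d0 dm] \<delta> by (simp add: power2_eq_square field_simps)
        then show ?thesis using False d0 by simp
      next
        case True
        have "norm (?q - ?q') \<le> \<tau> * (1 / (2 * \<delta>) + M)" if "0 < \<tau>" "\<tau> \<le> m" for \<tau>
        proof -
          have "\<tau> * norm (?q - ?q') \<le> \<tau> * (\<tau> * (1 / (2 * \<delta>) + M))"
            using main[of \<tau>] that True by (simp add: power2_eq_square field_simps)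
          then show ?thesis using that by simp
        qed
        then have ev: "\<forall>\<^sub>F \<tau> in at_right 0. norm (?q - ?q') \<le> \<tau> * (1 / (2 * \<delta>) + M)"
          using m(1) unfolding eventually_at_right_field by (meson less_imp_le)
        have "((\<lambda>\<tau>. \<tau> * (1 / (2 * \<delta>) + M)) \<longlongrightarrow> 0 * (1 / (2 * \<delta>) + M)) (at_right 0)"
          by (intro tendsto_intros)
        then have "norm (?q - ?q') \<le> 0 * (1 / (2 * \<delta>) + M)"
          by (rule tendsto_lowerbound[OF _ ev]) simp
        then show ?thesis using False by simp
      qed
    qed
    have "p - p' = (?q - ?q') - (H x - H x')" by simp
    then have "norm (p - p') \<le> norm (?q - ?q') + norm (H x - H x')" by (metis norm_triangle_ineq4)
    also have "\<dots> \<le> (1 / \<delta> + 4 * M) * d + M * d" using qq lipH[OF S(1,3)] by (simp add: d_def)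
    finally show ?thesis by (simp add: K_def d_def algebra_simps)
  qed
  define E where "E = {x. \<exists>p y. norm p < \<rho> \<and> contact p x y}"
  define P where "P = (\<lambda>x. SOME p. norm p < \<rho> \<and> (\<exists>y. contact p x y))"
  have P: "norm (P x) < \<rho> \<and> (\<exists>y. contact (P x) x y)" if "x \<in> E" for x
    unfolding P_def by (rule someI_ex) (use that in \<open>auto simp: E_def\<close>)
  \<comment> \<open>Every slope of norm below \<rho> has a contact point, so the Lipschitz map
    \<open>P\<close> sends \<open>E\<close> onto a set containing a ball. A Lipschitz image of a
    null set would be null.\<close>
  have "\<not> negligible E"
  proof
    assume "negligible E"
    then have "negligible (P ` E)"
    proof (rule negligible_locally_Lipschitz_image[rotated])
      fix x assume x: "x \<in> E"
      have "norm (P y - P x) \<le> K * norm (y - x)" if "y \<in> E" for y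
        using slope_lip P[OF x] P[OF that] by blast
      then show "\<exists>T B. open T \<and> x \<in> T \<and> (\<forall>y\<in>E \<inter> T. norm (P y - P x) \<le> B * norm (y - x))"
        by (intro exI[of _ UNIV] exI[of _ K]) auto
    qed simp
    moreover have "ball 0 \<rho> \<subseteq> P ` E"
    proof
      fix p :: 'a assume "p \<in> ball 0 \<rho>"
      then have p: "norm p < \<rho>" by simp
      obtain x y where c: "contact p x y" using ex by blast
      then have x: "x \<in> E" using p by (auto simp: E_def)
      obtain y' where c': "contact (P x) x y'" using P[OF x] by blast
      have "norm (p - P x) \<le> K * norm (x - x)" using slope_lip[OF c p c'] P[OF x] by blast
      then have "p = P x" by simp
      then show "p \<in> P ` E" using x by blast
    qed
    ultimately have "negligible (ball (0::'a) \<rho>)" using negligible_subset by blast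
    then show False using \<rho>(1) open_not_negligible[of "ball (0::'a) \<rho>"] by auto
  qed
  moreover have "negligible {x \<in> ball x0 r. \<not> G differentiable (at x)}"
    by (rule negligible_lipschitz_not_differentiable_ball[OF lip r])
  ultimately have "\<not> E \<subseteq> {x \<in> ball x0 r. \<not> G differentiable (at x)}"
    using negligible_subset by blast
  then obtain x where xE: "x \<in> E" and xd: "x \<in> ball x0 r \<Longrightarrow> G differentiable (at x)" by auto
  obtain p y where p: "norm p < \<rho>" and c: "contact p x y" using xE by (auto simp: E_def)
  have cl: "norm (x - x0) \<le> m / 2" "norm (x - y) \<le> m / 2" "\<bar>g y - W x\<bar> \<le> \<eta>" using close[OF c p] by auto
  have yx0: "norm (y - x0) \<le> m"
    using norm_triangle_ineq4[of "x - x0" "x - y"] cl by simp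
  have balls: "x \<in> ball x0 r" "x \<in> ball x0 \<eta>" "y \<in> ball x0 r" "y \<in> ball x0 \<eta>"
    using cl yx0 m by (auto simp: dist_norm norm_minus_commute)
  obtain D where D: "(G has_derivative D) (at x)" using xd[OF balls(1)] by (auto simp: differentiable_def)
  have xS: "x \<in> ?S" "y \<in> ?S" using c by (auto simp: contact_def)
  \<comment> \<open>The reported slope is \<open>H x + p\<close>, the gradient of the penalised
    function plus the perturbation; it differs from \<open>G x\<close> by the gradient of the
    penalty and by \<open>p\<close>.\<close>
  have np: "norm (H x + p - G x) \<le> \<eta>"
  proof -
    have "H x + p - G x = p - (2 * k) *\<^sub>R (x - x0)" by (simp add: H_def)
    also have "norm \<dots> \<le> norm p + norm ((2 * k) *\<^sub>R (x - x0))" by (rule norm_triangle_ineq4)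
    also have "\<dots> \<le> \<eta> / 2 + 2 * k * 1"
      using p \<rho>(3) k cl(1) m by (intro add_mono) (auto intro!: mult_left_mono)
    finally show ?thesis by (simp add: k_def)
  qed
  have dH: "(H has_derivative (\<lambda>h. D h - (2 * k) *\<^sub>R h)) (at x)"
    unfolding H_def by (auto intro!: derivative_eq_intros D)
  have ev1: "\<forall>\<^sub>F h in nhds 0. \<bar>V (x + h) - V x - H x \<bullet> h - (D h - (2 * k) *\<^sub>R h) \<bullet> h / 2\<bar> \<le> \<eta> / 2 * (norm h)\<^sup>2"
    using \<eta> dV by (intro second_order_expansion[OF open_ball balls(1) _ dH]) auto
  have ev2: "\<forall>\<^sub>F h in nhds 0. z + h \<in> ball x0 r" if "z \<in> ball x0 r" for z
  proof -
    have "((\<lambda>h. z + h) \<longlongrightarrow> z + 0) (nhds 0)" by (intro tendsto_intros filterlim_ident)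
    then show ?thesis using that by (intro topological_tendstoD) auto
  qed
  have "\<forall>\<^sub>F h in nhds 0. g y + (H x + p) \<bullet> h + D h \<bullet> h / 2 - \<eta> * (norm h)\<^sup>2 \<le> g (y + h)"
    using ev1 ev2[OF balls(1)] ev2[OF balls(3)]
  proof eventually_elim
    case (elim h)
    have "\<Phi> p x y \<le> \<Phi> p (x + h) (y + h)"
      using c elim(2,3) by (auto simp: contact_def)
    then have "g y + (V (x + h) - V x) + p \<bullet> h \<le> g (y + h)"
      by (simp add: \<Phi>_def inner_diff_right inner_add_right)
    moreover have "(D h - (2 * k) *\<^sub>R h) \<bullet> h / 2 = D h \<bullet> h / 2 - k * (norm h)\<^sup>2"
      by (simp add: inner_diff_left power2_norm_eq_inner diff_divide_distrib)
    ultimately have "g y + (H x + p) \<bullet> h + D h \<bullet> h / 2 - k * (norm h)\<^sup>2 - \<eta> / 2 * (norm h)\<^sup>2 \<le> g (y + h)"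
      using elim(1) unfolding abs_le_iff inner_add_left by linarith
    moreover have "k * (norm h)\<^sup>2 + \<eta> / 2 * (norm h)\<^sup>2 \<le> \<eta> * (norm h)\<^sup>2"
      using \<eta> by (simp add: k_def)
    ultimately show ?case by linarith
  qed
  then show thesis using that[OF balls D np cl(3)] by blast
qed

section \<open>Eigenvalues of symmetric matrices\<close>

lemma symmetric_matrix_inner:
  fixes A :: "real ^ 'n ^ 'n"
  assumes "transpose A = A"
  shows "x \<bullet> (A *v y) = (A *v x) \<bullet> y"
  by (metis assms dot_lmul_matrix transpose_matrix_vector)

text \<open>A maximiser \<open>v\<close> of the quadratic form on the unit sphere of
  \<open>S\<close> is an eigenvector: the defect \<open>w\<close> of the eigenvalue equation lies in
  \<open>S\<close> by invariance, and moving from \<open>v\<close> towards \<open>w\<close> would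
  increase the Rayleigh quotient unless \<open>w\<close> is zero.\<close>

lemma symmetric_eigenvector_in_subspace:
  fixes A :: "real ^ 'n ^ 'n"
  assumes sym: "transpose A = A" and S: "subspace S" and inv: "\<And>x. x \<in> S \<Longrightarrow> A *v x \<in> S"
    and ne: "S \<noteq> {0}"
  obtains v l where "v \<in> S" "norm v = 1" "A *v v = l *\<^sub>R v"
proof -
  let ?K = "S \<inter> sphere 0 1"
  have K1: "compact ?K" using S by (intro closed_Int_compact closed_subspace compact_sphere)
  have K2: "?K \<noteq> {}"
  proof -
    obtain x where "x \<in> S" "x \<noteq> 0" using ne S subspace_0 by blast
    then have "(1 / norm x) *\<^sub>R x \<in> ?K" using S by (auto simp: subspace_scale)
    then show ?thesis by blast
  qed
  have K3: "continuous_on ?K (\<lambda>x. x \<bullet> (A *v x))"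
    by (intro continuous_intros matrix_vector_mult_linear_continuous_on)
  obtain v where v: "v \<in> ?K" "\<And>x. x \<in> ?K \<Longrightarrow> x \<bullet> (A *v x) \<le> v \<bullet> (A *v v)"
    using continuous_attains_sup[OF K1 K2 K3] by blast
  define l where "l = v \<bullet> (A *v v)"
  have nv: "norm v = 1" "v \<bullet> v = 1" and vS: "v \<in> S" using v(1) by (auto simp: norm_eq_1)
  have max: "x \<bullet> (A *v x) \<le> l * (x \<bullet> x)" if "x \<in> S" for x
  proof (cases "x = 0")
    case False
    let ?y = "(1 / norm x) *\<^sub>R x"
    have "?y \<in> ?K" using that S False by (auto simp: subspace_scale)
    then have "?y \<bullet> (A *v ?y) \<le> l" using v(2) l_def by blast
    moreover have "?y \<bullet> (A *v ?y) = (x \<bullet> (A *v x)) / (x \<bullet> x)"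
      by (simp add: matrix_vector_mult_scaleR power2_eq_square[symmetric] power2_norm_eq_inner)
    ultimately have "(x \<bullet> (A *v x)) / (x \<bullet> x) \<le> l" by (simp only:)
    then show ?thesis using False by (simp add: pos_divide_le_eq)
  qed simp
  define w where "w = A *v v - l *\<^sub>R v"
  have wS: "w \<in> S" unfolding w_def using inv vS S by (intro subspace_diff subspace_scale)
  have wv: "w \<bullet> v = 0" unfolding w_def inner_diff_left inner_scaleR_left nv(2) by (simp add: l_def inner_commute)
  have Avw: "(A *v v) \<bullet> w = w \<bullet> w"
  proof -
    have "A *v v = w + l *\<^sub>R v" by (simp add: w_def)
    then have "(A *v v) \<bullet> w = w \<bullet> w + l * (v \<bullet> w)" by (metis inner_add_left inner_scaleR_left)
    then show ?thesis using wv by (simp add: inner_commute)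
  qed
  define C where "C = l * (w \<bullet> w) - w \<bullet> (A *v w)"
  \<comment> \<open>The first-order term in \<open>t\<close> must not exceed a second-order one. A
    small positive \<open>t\<close> then forces \<open>w \<bullet> w = 0\<close>.\<close>
  have quad: "2 * t * (w \<bullet> w) \<le> t\<^sup>2 * C" for t
  proof -
    have E1: "(v + t *\<^sub>R w) \<bullet> (A *v (v + t *\<^sub>R w)) \<le> l * ((v + t *\<^sub>R w) \<bullet> (v + t *\<^sub>R w))"
      using vS wS S by (intro max subspace_add subspace_scale)
    have E2: "(v + t *\<^sub>R w) \<bullet> (A *v (v + t *\<^sub>R w)) = l + 2 * t * (w \<bullet> w) + t\<^sup>2 * (w \<bullet> (A *v w))"
    proof -
      have "v \<bullet> (A *v w) = w \<bullet> w" using symmetric_matrix_inner[OF sym] Avw by simp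
      moreover have "w \<bullet> (A *v v) = w \<bullet> w" using Avw by (simp add: inner_commute)
      ultimately show ?thesis
        by (simp add: matrix_vector_right_distrib matrix_vector_mult_scaleR inner_add_left inner_add_right
            l_def power2_eq_square algebra_simps)
    qed
    have E3: "(v + t *\<^sub>R w) \<bullet> (v + t *\<^sub>R w) = 1 + t\<^sup>2 * (w \<bullet> w)"
      using wv nv by (simp add: inner_add_left inner_add_right inner_commute power2_eq_square)
    show ?thesis using E1 unfolding E2 E3 C_def by (simp add: algebra_simps)
  qed
  have "w \<bullet> w = 0"
  proof (rule ccontr)
    assume "w \<bullet> w \<noteq> 0"
    then have pos: "w \<bullet> w > 0" by simp
    define t where "t = (w \<bullet> w) / (\<bar>C\<bar> + 1)"
    have t: "t > 0" using pos by (simp add: t_def)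
    have "t * (2 * (w \<bullet> w)) \<le> t * (t * C)" using quad[of t] by (simp add: power2_eq_square algebra_simps)
    then have "2 * (w \<bullet> w) \<le> t * C" using t by simp
    also have "\<dots> \<le> t * (\<bar>C\<bar> + 1)" using t by (intro mult_left_mono) auto
    also have "\<dots> = w \<bullet> w" by (simp add: t_def)
    finally show False using pos by simp
  qed
  then have "A *v v = l *\<^sub>R v" by (simp add: w_def)
  then show thesis using that vS nv by blast
qed

text \<open>Induction on the dimension: by symmetry the orthogonal complement of an eigenvector
  within \<open>S\<close> is again invariant.\<close>

lemma symmetric_eigenbasis_subspace:
  fixes A :: "real ^ 'n ^ 'n"
  assumes sym: "transpose A = A" and "subspace S" "\<And>x. x \<in> S \<Longrightarrow> A *v x \<in> S"
  shows "\<exists>B. B \<subseteq> S \<and> S \<subseteq> span B \<and> pairwise orthogonal B \<and> (\<forall>b\<in>B. norm b = 1 \<and> (\<exists>l. A *v b = l *\<^sub>R b))"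
  using assms(2,3)
proof (induction "dim S" arbitrary: S rule: less_induct)
  case less
  show ?case
  proof (cases "S = {0}")
    case True
    then show ?thesis by (intro exI[of _ "{}"]) auto
  next
    case False
    obtain v l where v: "v \<in> S" "norm v = 1" "A *v v = l *\<^sub>R v"
      by (rule symmetric_eigenvector_in_subspace[OF sym less.prems False])
    define T where "T = S \<inter> {x. v \<bullet> x = 0}"
    have T: "subspace T" unfolding T_def using less.prems(1) subspace_hyperplane by (rule subspace_inter)
    have vv: "v \<bullet> v = 1" using v(2) by (simp add: norm_eq_1)
    have "v \<notin> T" using vv by (simp add: T_def)
    then have "T \<subset> S" using v(1) T_def by blast
    then have "dim T < dim S"
      using T less.prems(1) dim_psubset[of T S] by (simp add: span_eq_iff[THEN iffD2])
    moreover have "A *v x \<in> T" if "x \<in> T" for x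
      using that less.prems(2) symmetric_matrix_inner[OF sym, of v x] by (auto simp: T_def v(3))
    ultimately obtain B where B: "B \<subseteq> T" "T \<subseteq> span B" "pairwise orthogonal B"
      "\<forall>b\<in>B. norm b = 1 \<and> (\<exists>l. A *v b = l *\<^sub>R b)"
      using less.hyps[of T] T by meson
    show ?thesis
    proof (intro exI[of _ "insert v B"] conjI)
      show "insert v B \<subseteq> S" using v B by (auto simp: T_def)
      show "S \<subseteq> span (insert v B)"
      proof
        fix x assume x: "x \<in> S"
        have "x - (v \<bullet> x) *\<^sub>R v \<in> T"
          using x v(1) vv less.prems(1) by (auto simp: T_def inner_diff_right intro: subspace_diff subspace_scale)
        then have "x - (v \<bullet> x) *\<^sub>R v \<in> span B" using B(2) by blast
        then show "x \<in> span (insert v B)" unfolding span_insert by blast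
      qed
      show "pairwise orthogonal (insert v B)"
        using B(1,3) by (auto simp: pairwise_insert orthogonal_def T_def inner_commute)
      show "\<forall>b\<in>insert v B. norm b = 1 \<and> (\<exists>l. A *v b = l *\<^sub>R b)" using B(4) v by auto
    qed
  qed
qed

text \<open>Indexed by the coordinate type, so that the family has full size and is a basis, and its
  members can be paired with the components of \<open>eigenvalues A\<close>.\<close>

definition orthonormal_family :: "('n \<Rightarrow> real ^ 'n) \<Rightarrow> bool" where
  "orthonormal_family q \<longleftrightarrow> (\<forall>i j. q i \<bullet> q j = (if i = j then 1 else 0))"

lemma orthonormal_family_expand:
  fixes q :: "'n::finite \<Rightarrow> real ^ 'n"
  assumes q: "orthonormal_family q"
  shows "inj q" "independent (q ` I)" "(\<Sum>i\<in>UNIV. (x \<bullet> q i) *\<^sub>R q i) = x"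
proof -
  show inj: "inj q"
  proof (rule injI)
    fix i j assume "q i = q j"
    then have "q i \<bullet> q j = 1" using q by (auto simp: orthonormal_family_def)
    then show "i = j" using q by (auto simp: orthonormal_family_def split: if_splits)
  qed
  have orth: "pairwise orthogonal (q ` I)" for I
    using q inj by (auto simp: pairwise_def orthogonal_def orthonormal_family_def)
  have nz: "0 \<notin> q ` I" for I
    using q unfolding orthonormal_family_def by (metis imageE inner_zero_left zero_neq_one)
  show ind: "independent (q ` I)" for I
    using orth nz by (rule pairwise_orthogonal_independent)
  have "card (range q) = CARD('n)" using inj by (simp add: card_image)
  then have "span (range q) = UNIV"
    using ind[of UNIV] card_eq_dim[of "range q" UNIV] dim_UNIV
    by (metis UNIV_eq_I card_ge_dim_independent dim_eq_card_independent dim_eq_full dim_UNIV DIM_cart DIM_real mult_1_right top_greatest subset_UNIV)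
  then have "(\<Sum>b\<in>range q. (x \<bullet> b) *\<^sub>R b) = x"
    using orth[of UNIV] q
    by (intro orthonormal_basis_expand) (auto simp: norm_eq_1 orthonormal_family_def)
  then show "(\<Sum>i\<in>UNIV. (x \<bullet> q i) *\<^sub>R q i) = x"
    using inj by (simp add: sum.reindex)
qed

theorem spectral_theorem:
  fixes A :: "real ^ 'n ^ 'n"
  assumes sym: "transpose A = A"
  obtains q d where "orthonormal_family q" "\<And>i. A *v q i = d i *\<^sub>R q i"
proof -
  obtain B where B: "UNIV \<subseteq> span B" "pairwise orthogonal B"
    "\<And>b. b \<in> B \<Longrightarrow> norm b = 1 \<and> (\<exists>l. A *v b = l *\<^sub>R b)"
    using symmetric_eigenbasis_subspace[OF sym subspace_UNIV] by blast
  have ind: "independent B" using B(2,3) by (intro pairwise_orthogonal_independent) force+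
  then have fin: "finite B" by (rule finiteI_independent)
  have "card B = CARD('n)"
  proof -
    have "card B = dim B" using ind by (simp add: dim_eq_card_independent)
    also have "\<dots> = dim (span B)" by simp
    also have "span B = UNIV" using B(1) by blast
    finally show ?thesis by simp
  qed
  then obtain q where q: "bij_betw q (UNIV :: 'n set) B"
    using fin by (metis finite_same_card_bij finite_class.finite_UNIV)
  have qB: "q i \<in> B" for i using q by (auto simp: bij_betw_def)
  have "orthonormal_family q"
    unfolding orthonormal_family_def
  proof (intro allI)
    fix i j
    show "q i \<bullet> q j = (if i = j then 1 else 0)"
    proof (cases "i = j")
      case True
      then show ?thesis using B(3)[OF qB[of i]] by (simp add: norm_eq_1)
    next
      case False
      then have "q i \<noteq> q j" using q by (auto simp: bij_betw_def inj_def)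
      then show ?thesis using B(2) qB False by (auto simp: pairwise_def orthogonal_def)
    qed
  qed
  moreover have "\<forall>i. \<exists>l. A *v q i = l *\<^sub>R q i" using B(3) qB by blast
  ultimately show thesis using that by metis
qed

text \<open>Polynomials with equal values are equal and hence have the same multiset of roots. This
  is the link between the vector picked by \<open>SOME\<close> in \<open>eigenvalues\<close> and a
  concrete diagonalisation.\<close>

lemma prod_linear_factors_eq_permutes:
  fixes a b :: "'n::finite \<Rightarrow> real"
  assumes "\<And>t. (\<Prod>i\<in>UNIV. t - a i) = (\<Prod>i\<in>UNIV. t - b i)"
  obtains p where "p permutes UNIV" "\<And>i. a i = b (p i)"
proof -
  let ?P = "\<lambda>a. \<Prod>i\<in>UNIV. [:- a i, 1:]"
  have "poly (?P a) t = poly (?P b) t" for t using assms[of t] by (simp add: poly_prod)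
  then have eq: "?P a = ?P b" by (simp add: poly_eq_poly_eq_iff[symmetric] fun_eq_iff)
  have "proots (?P c) = image_mset c (mset_set UNIV)" for c :: "'n \<Rightarrow> real"
  proof -
    have "proots (?P c) = (\<Sum>i\<in>UNIV. proots [:- c i, 1:])" by (intro proots_prod) auto
    moreover have "(\<Sum>i\<in>F. proots [:- c i, 1:]) = image_mset c (mset_set F)" if "finite F" for F
      using that by induction auto
    ultimately show ?thesis by simp
  qed
  then have "image_mset a (mset_set UNIV) = image_mset b (mset_set UNIV)" using eq by metis
  then obtain p where "p permutes UNIV" "\<forall>i\<in>UNIV. a i = b (p i)"
    by (rule image_mset_eq_implies_permutes[OF finite_class.finite_UNIV])
  then show thesis using that by blast
qed

text \<open>With the eigenvectors as columns of \<open>Q\<close>, the matrix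
  \<open>mat t - A\<close> is conjugate to the diagonal matrix \<open>E\<close>.\<close>

lemma charpoly_of_eigenbasis:
  fixes A :: "real ^ 'n ^ 'n"
  assumes q: "orthonormal_family q" and ev: "\<And>i. A *v q i = d i *\<^sub>R q i"
  shows "det (mat t - A) = (\<Prod>i\<in>UNIV. t - d i)"
proof -
  define Q :: "real ^ 'n ^ 'n" where "Q = (\<chi> i j. q j $ i)"
  define E :: "real ^ 'n ^ 'n" where "E = (\<chi> i j. if i = j then t - d i else 0)"
  have "orthogonal_matrix Q"
    unfolding orthogonal_matrix_orthonormal_columns
    using q by (auto simp: Q_def column_def orthogonal_def orthonormal_family_def norm_eq_1)
  then have dQ: "det Q \<noteq> 0" using det_orthogonal_matrix by fastforce
  have "((mat t - A) ** Q) $ i $ j = (Q ** E) $ i $ j" for i j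
  proof -
    have "((mat t - A) ** Q) $ i $ j = ((mat t - A) *v q j) $ i"
      by (simp add: matrix_matrix_mult_def matrix_vector_mult_def Q_def)
    also have "\<dots> = (t - d j) * q j $ i"
    proof -
      have "mat t *v x = t *\<^sub>R x" for x :: "real ^ 'n"
        by (simp add: vec_eq_iff matrix_vector_mult_def mat_def if_distrib[of "\<lambda>c. c * _"] cong: if_cong)
      then show ?thesis by (simp add: matrix_vector_mult_diff_rdistrib ev algebra_simps)
    qed
    also have "\<dots> = (Q ** E) $ i $ j"
      by (simp add: matrix_matrix_mult_def Q_def E_def if_distrib[of "(*) _"] cong: if_cong)
    finally show ?thesis .
  qed
  then have "(mat t - A) ** Q = Q ** E" by (simp add: vec_eq_iff)
  then have "det (mat t - A) * det Q = det Q * det E" by (metis det_mul)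
  moreover have "det E = (\<Prod>i\<in>UNIV. t - d i)" by (subst det_diagonal) (auto simp: E_def)
  ultimately show ?thesis using dQ by simp
qed

lemma eigenvalues_eq_permuted:
  fixes A :: "real ^ 'n ^ 'n"
  assumes "orthonormal_family q" "\<And>i. A *v q i = d i *\<^sub>R q i"
  obtains p where "p permutes UNIV" "\<And>i. eigenvalues A $ i = d (p i)"
proof -
  have "\<forall>t. det (mat t - A) = (\<Prod>i\<in>UNIV. t - (\<chi> i. d i) $ i)" using charpoly_of_eigenbasis[OF assms] by simp
  then have "\<forall>t. det (mat t - A) = (\<Prod>i\<in>UNIV. t - eigenvalues A $ i)"
    unfolding eigenvalues_def by (rule someI)
  then have "\<And>t. (\<Prod>i\<in>UNIV. t - eigenvalues A $ i) = (\<Prod>i\<in>UNIV. t - d i)"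
    using charpoly_of_eigenbasis[OF assms] by metis
  then show thesis using prod_linear_factors_eq_permutes that by metis
qed

text \<open>The unspecified order of \<open>eigenvalues\<close> is absorbed into the labelling of
  the eigenvectors.\<close>

lemma eigenvalues_eigenbasis:
  fixes A :: "real ^ 'n ^ 'n"
  assumes "transpose A = A"
  obtains q where "orthonormal_family q" "\<And>i. A *v q i = (eigenvalues A $ i) *\<^sub>R q i"
proof -
  obtain q d where q: "orthonormal_family q" "\<And>i. A *v q i = d i *\<^sub>R q i"
    using spectral_theorem[OF assms] by blast
  obtain p where p: "p permutes UNIV" "\<And>i. eigenvalues A $ i = d (p i)"
    using eigenvalues_eq_permuted[OF q] by blast
  have "inj p" using p(1) permutes_inj by blast
  then have "orthonormal_family (\<lambda>i. q (p i))"
    using q(1) by (auto simp: orthonormal_family_def inj_eq)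
  then show thesis using that[of "\<lambda>i. q (p i)"] q(2) p(2) by auto
qed

lemma quadratic_form_eigenbasis:
  fixes A :: "real ^ 'n ^ 'n"
  assumes q: "orthonormal_family q" and ev: "\<And>i. A *v q i = a i *\<^sub>R q i"
  shows "x \<bullet> (A *v x) = (\<Sum>i\<in>UNIV. a i * (x \<bullet> q i)\<^sup>2)" "x \<bullet> x = (\<Sum>i\<in>UNIV. (x \<bullet> q i)\<^sup>2)"
proof -
  note ex = orthonormal_family_expand(3)[OF q, of x]
  have "A *v x = (\<Sum>i\<in>UNIV. (x \<bullet> q i) *\<^sub>R (a i *\<^sub>R q i))"
    by (subst ex[symmetric], simp only: linear_sum[OF matrix_vector_mul_linear] matrix_vector_mult_scaleR ev)
  then have "x \<bullet> (A *v x) = x \<bullet> (\<Sum>i\<in>UNIV. (x \<bullet> q i) *\<^sub>R (a i *\<^sub>R q i))" by simp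
  then show "x \<bullet> (A *v x) = (\<Sum>i\<in>UNIV. a i * (x \<bullet> q i)\<^sup>2)"
    by (simp add: inner_sum_right power2_eq_square mult_ac)
  have "x \<bullet> x = x \<bullet> (\<Sum>i\<in>UNIV. (x \<bullet> q i) *\<^sub>R q i)" by (simp add: ex)
  then show "x \<bullet> x = (\<Sum>i\<in>UNIV. (x \<bullet> q i)\<^sup>2)" by (simp only: inner_sum_right inner_scaleR_right power2_eq_square)
qed

section \<open>Monotonicity of eigenvalues under the order of quadratic forms\<close>

text \<open>The counting hypothesis says that the decreasing rearrangements are ordered. Matching a
  largest element with a largest element keeps it valid: up to the level \<open>a i\<close> both
  counts drop by one, above that level the left count is zero.\<close>

lemma monotone_matching:
  fixes a :: "'a \<Rightarrow> real" and b :: "'b \<Rightarrow> real"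
  assumes "finite S" "finite T" "card S = card T"
    and "\<And>t. card {i \<in> S. t \<le> a i} \<le> card {j \<in> T. t \<le> b j}"
  shows "\<exists>f. bij_betw f S T \<and> (\<forall>i\<in>S. a i \<le> b (f i))"
  using assms
proof (induction "card S" arbitrary: S T)
  case 0
  then show ?case by (auto simp: bij_betw_def)
next
  case (Suc n)
  have ne: "S \<noteq> {}" "T \<noteq> {}" using Suc by auto
  have "Max (a ` S) \<in> a ` S" using ne Suc.prems(1) by (intro Max_in) auto
  then obtain i where i0: "Max (a ` S) = a i" "i \<in> S" by (rule imageE)
  have i: "i \<in> S" "\<And>k. k \<in> S \<Longrightarrow> a k \<le> a i"
    unfolding i0(1)[symmetric] using i0(2) Suc.prems(1) by (auto intro: Max_ge)
  have "Max (b ` T) \<in> b ` T" using ne Suc.prems(2) by (intro Max_in) auto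
  then obtain j where j0: "Max (b ` T) = b j" "j \<in> T" by (rule imageE)
  have j: "j \<in> T" "\<And>k. k \<in> T \<Longrightarrow> b k \<le> b j"
    unfolding j0(1)[symmetric] using j0(2) Suc.prems(2) by (auto intro: Max_ge)
  have "0 < card {k \<in> S. a i \<le> a k}" using i(1) Suc.prems(1) by (auto simp: card_gt_0_iff)
  also have "\<dots> \<le> card {k \<in> T. a i \<le> b k}" by (rule Suc.prems(4))
  finally obtain k where "k \<in> T" "a i \<le> b k" by (auto simp: card_gt_0_iff)
  then have ij: "a i \<le> b j" using j(2) by force
  have "\<exists>f. bij_betw f (S - {i}) (T - {j}) \<and> (\<forall>k\<in>S - {i}. a k \<le> b (f k))"
  proof (rule Suc.hyps(1))
    show "n = card (S - {i})" "finite (S - {i})" "finite (T - {j})" "card (S - {i}) = card (T - {j})"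
      using Suc i j by auto
    fix t
    show "card {k \<in> S - {i}. t \<le> a k} \<le> card {k \<in> T - {j}. t \<le> b k}"
    proof (cases "t \<le> a i")
      case True
      have "{k \<in> S - {i}. t \<le> a k} = {k \<in> S. t \<le> a k} - {i}" "{k \<in> T - {j}. t \<le> b k} = {k \<in> T. t \<le> b k} - {j}" by auto
      then show ?thesis using Suc.prems(4)[of t] True i(1) j(1) ij by (simp add: card_Diff_singleton_if)
    next
      case False
      then have "{k \<in> S - {i}. t \<le> a k} = {}" using i(2) by fastforce
      then show ?thesis by (metis card.empty le0)
    qed
  qed
  then obtain f where f: "bij_betw f (S - {i}) (T - {j})" "\<forall>k\<in>S - {i}. a k \<le> b (f k)" by blast
  have "bij_betw (f(i := j)) (S - {i}) (T - {j})"
    using f(1) by (subst bij_betw_cong[where g = f]) auto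
  then have "bij_betw (f(i := j)) ((S - {i}) \<union> {i}) ((T - {j}) \<union> {(f(i := j)) i})"
    by (intro notIn_Un_bij_betw) auto
  then show ?case using f(2) ij i(1) j(1) by (intro exI[of _ "f(i := j)"]) (auto simp: insert_absorb)
qed

text \<open>Courant-Fischer in counting form. If \<open>A\<close> had more eigenvalues \<ge> t than
  \<open>B\<close>, the eigenspaces of \<open>A\<close> for values \<ge> t and of \<open>B\<close>
  for values < t would have dimensions adding up to more than n. A common nonzero vector then
  violates the order of the forms.\<close>

theorem eigenvalues_monotone:
  fixes A B :: "real ^ 'n ^ 'n"
  assumes A: "transpose A = A" and B: "transpose B = B"
    and le: "\<And>x. x \<bullet> (A *v x) \<le> x \<bullet> (B *v x)"
  obtains p where "p permutes UNIV" "\<And>i. eigenvalues A $ i \<le> eigenvalues B $ p i"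
proof -
  let ?a = "\<lambda>i. eigenvalues A $ i" and ?b = "\<lambda>i. eigenvalues B $ i"
  obtain q where q: "orthonormal_family q" "\<And>i. A *v q i = ?a i *\<^sub>R q i" using eigenvalues_eigenbasis[OF A] by blast
  obtain r where r: "orthonormal_family r" "\<And>i. B *v r i = ?b i *\<^sub>R r i" using eigenvalues_eigenbasis[OF B] by blast
  have coeff0: "x \<bullet> s i = 0" if "orthonormal_family s" "x \<in> span (s ` I)" "i \<notin> I" for s :: "'n \<Rightarrow> real ^ 'n" and x I i
  proof -
    have "orthogonal (s i) x"
    proof (rule orthogonal_to_span[OF that(2)])
      fix y assume "y \<in> s ` I"
      then show "orthogonal (s i) y" using that(1,3) by (auto simp: orthogonal_def orthonormal_family_def)
    qed
    then show ?thesis by (simp add: orthogonal_def inner_commute)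
  qed
  have "card {i. t \<le> ?a i} \<le> card {j. t \<le> ?b j}" for t
  proof (rule ccontr)
    let ?I = "{i. t \<le> ?a i}" and ?J = "{j. ?b j < t}"
    assume "\<not> ?thesis"
    moreover have "card {j. t \<le> ?b j} + card ?J = CARD('n)"
    proof -
      have "{j. t \<le> ?b j} \<union> ?J = UNIV" "{j. t \<le> ?b j} \<inter> ?J = {}" by auto
      then show ?thesis by (metis card_Un_disjoint finite)
    qed
    ultimately have big: "card ?I + card ?J > CARD('n)" by linarith
    let ?S = "span (q ` ?I)" and ?T = "span (r ` ?J)"
    have "dim ?S = card ?I"
      using orthonormal_family_expand(1,2)[OF q(1)]
      by (metis card_image dim_eq_card_independent dim_span inj_on_subset subset_UNIV)
    moreover have "dim ?T = card ?J"
      using orthonormal_family_expand(1,2)[OF r(1)]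
      by (metis card_image dim_eq_card_independent dim_span inj_on_subset subset_UNIV)
    moreover have "dim {x + y |x y. x \<in> ?S \<and> y \<in> ?T} + dim (?S \<inter> ?T) = dim ?S + dim ?T"
      by (intro dim_sums_Int) auto
    moreover have "dim {x + y |x y. x \<in> ?S \<and> y \<in> ?T} \<le> CARD('n)"
      using dim_subset_UNIV[of "{x + y |x y. x \<in> ?S \<and> y \<in> ?T}"] by simp
    ultimately have "dim (?S \<inter> ?T) \<noteq> 0" using big by linarith
    then obtain x where x: "x \<in> ?S" "x \<in> ?T" "x \<noteq> 0" by (auto simp: dim_eq_0)
    have "t * (x \<bullet> x) \<le> x \<bullet> (A *v x)"
      unfolding quadratic_form_eigenbasis[OF q] sum_distrib_left
    proof (rule sum_mono)
      fix i
      show "t * (x \<bullet> q i)\<^sup>2 \<le> ?a i * (x \<bullet> q i)\<^sup>2"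
        using coeff0[OF q(1) x(1), of i] by (cases "t \<le> ?a i") (auto intro: mult_right_mono)
    qed
    also have "\<dots> \<le> x \<bullet> (B *v x)" by (rule le)
    also have "\<dots> < t * (x \<bullet> x)"
      unfolding quadratic_form_eigenbasis[OF r] sum_distrib_left
    proof (rule sum_strict_mono_ex1)
      show "\<forall>i\<in>UNIV. ?b i * (x \<bullet> r i)\<^sup>2 \<le> t * (x \<bullet> r i)\<^sup>2"
      proof
        fix i
        show "?b i * (x \<bullet> r i)\<^sup>2 \<le> t * (x \<bullet> r i)\<^sup>2"
          using coeff0[OF r(1) x(2), of i] by (cases "?b i < t") (auto intro: mult_right_mono)
      qed
      have "(\<Sum>i\<in>UNIV. (x \<bullet> r i)\<^sup>2) \<noteq> 0" using x(3) quadratic_form_eigenbasis(2)[OF r, of x] by auto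
      then obtain i where i: "(x \<bullet> r i)\<^sup>2 \<noteq> 0" by (meson sum.neutral)
      then have "?b i < t" using coeff0[OF r(1) x(2), of i] by auto
      then have "?b i * (x \<bullet> r i)\<^sup>2 < t * (x \<bullet> r i)\<^sup>2" using i by (intro mult_strict_right_mono) auto
      then show "\<exists>i\<in>UNIV. ?b i * (x \<bullet> r i)\<^sup>2 < t * (x \<bullet> r i)\<^sup>2" by blast
    qed simp
    finally show False by simp
  qed
  then obtain f where "bij_betw f (UNIV :: 'n set) (UNIV :: 'n set)" "\<forall>i\<in>UNIV. ?a i \<le> ?b (f i)"
    using monotone_matching[of "UNIV :: 'n set" "UNIV :: 'n set" ?a ?b] by auto
  then show thesis using that[of f] bij_imp_permutes[of f UNIV] by auto
qed

lemma sum_eigenvalues_eq_trace: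
  fixes A :: "real ^ 'n ^ 'n"
  assumes "transpose A = A"
  shows "(\<Sum>i\<in>UNIV. eigenvalues A $ i) = trace A"
proof -
  obtain q where q: "orthonormal_family q" "\<And>i. A *v q i = (eigenvalues A $ i) *\<^sub>R q i"
    using eigenvalues_eigenbasis[OF assms] by blast
  have "trace A = (\<Sum>k\<in>UNIV. axis k 1 \<bullet> (A *v axis k 1))"
    by (simp add: trace_def inner_axis' matrix_vector_mult_basis column_def)
  also have "\<dots> = (\<Sum>k\<in>UNIV. \<Sum>i\<in>UNIV. eigenvalues A $ i * (axis k 1 \<bullet> q i)\<^sup>2)"
    by (simp only: quadratic_form_eigenbasis(1)[OF q])
  also have "\<dots> = (\<Sum>i\<in>UNIV. \<Sum>k\<in>UNIV. eigenvalues A $ i * (q i $ k)\<^sup>2)"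
    by (subst sum.swap) (simp add: inner_axis')
  also have "\<dots> = (\<Sum>i\<in>UNIV. eigenvalues A $ i * (q i \<bullet> q i))"
    by (simp add: sum_distrib_left inner_vec_def power2_eq_square)
  finally show ?thesis using q(1) by (simp add: orthonormal_family_def)
qed

lemma abs_eigenvalues_le:
  fixes A :: "real ^ 'n ^ 'n"
  assumes "transpose A = A" and "\<And>x. \<bar>x \<bullet> (A *v x)\<bar> \<le> c * (x \<bullet> x)"
  shows "\<bar>eigenvalues A $ i\<bar> \<le> c"
proof -
  obtain q where q: "orthonormal_family q" "\<And>i. A *v q i = (eigenvalues A $ i) *\<^sub>R q i"
    using eigenvalues_eigenbasis[OF assms(1)] by blast
  have "\<bar>q i \<bullet> (A *v q i)\<bar> \<le> c * (q i \<bullet> q i)" by (rule assms(2))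
  then show ?thesis using q by (simp add: orthonormal_family_def)
qed

section \<open>Ellipticity\<close>

lemma nonneg_in_closure_Gamma_pos:
  fixes \<mu> :: "real ^ 'n"
  assumes "\<And>i. 0 \<le> \<mu> $ i"
  shows "\<mu> \<in> closure Gamma_pos"
  unfolding closure_approachable
proof (intro allI impI)
  fix e :: real assume e: "e > 0"
  let ?one = "(\<chi> i. 1) :: real ^ 'n"
  define y where "y = \<mu> + (e / (2 * (norm ?one + 1))) *\<^sub>R ?one"
  have pos: "0 < e / (2 * (norm ?one + 1))" using e by (simp add: add_nonneg_pos)
  have "y \<in> Gamma_pos" using assms pos by (auto simp: y_def Gamma_pos_def intro: add_nonneg_pos)
  moreover have "dist y \<mu> < e"
  proof -
    have "dist y \<mu> = e / 2 * (norm ?one / (norm ?one + 1))" using pos e by (simp add: y_def dist_norm)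
    also have "\<dots> \<le> e / 2 * 1" using e by (intro mult_left_mono) (auto simp: divide_le_eq add_nonneg_pos)
    finally show ?thesis using e by simp
  qed
  ultimately show "\<exists>y\<in>Gamma_pos. dist y \<mu> < e" by blast
qed

lemma S1_permute_iff:
  assumes "S1 f \<Gamma>" "p permutes UNIV"
  shows "(\<chi> i. l $ p i) \<in> \<Gamma> \<longleftrightarrow> l \<in> \<Gamma>" "l \<in> \<Gamma> \<Longrightarrow> f (\<chi> i. l $ p i) = f l"
proof -
  have *: "(\<chi> i. (\<chi> i. l $ p i) $ inv p i) = l"
    using permutes_inverses(1)[OF assms(2)] by (simp add: vec_eq_iff)
  show "(\<chi> i. l $ p i) \<in> \<Gamma> \<longleftrightarrow> l \<in> \<Gamma>"
    using assms permutes_inv[OF assms(2)] * unfolding S1_def by metis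
  show "l \<in> \<Gamma> \<Longrightarrow> f (\<chi> i. l $ p i) = f l" using assms unfolding S1_def by blast
qed

lemma sum_components_le_card_norm:
  fixes \<mu> :: "real ^ 'n"
  shows "(\<Sum>i\<in>UNIV. \<mu> $ i) \<le> real CARD('n) * norm \<mu>"
proof -
  have "(\<Sum>i\<in>UNIV. \<mu> $ i) \<le> (\<Sum>i\<in>(UNIV :: 'n set). norm \<mu>)"
    using component_le_norm_cart[of \<mu>] by (intro sum_mono) (auto simp: abs_le_iff)
  then show ?thesis by simp
qed

lemma quadratic_form_shift:
  fixes A :: "real ^ 'n ^ 'n"
  shows "(A - c *\<^sub>R mat 1) *v x = A *v x - c *\<^sub>R x"
  by (simp add: matrix_vector_mult_diff_rdistrib flip: scaleR_matrix_vector_assoc)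

text \<open>Condition (S3) pays for the shift by \<open>c\<close> through (S4): the eigenvalues drop by \<open>c\<close> each, and
  the rank-one gain raises their sum by \<open>\<zeta> \<bullet> \<zeta>\<close>.\<close>

lemma rank_one_gain_beats_shift:
  fixes f :: "real ^ 'n \<Rightarrow> real" and \<Gamma> :: "(real ^ 'n) set"
  assumes \<Gamma>: "open \<Gamma>" and cont: "continuous_on (closure \<Gamma>) f"
    and S1: "S1 f \<Gamma>" and S2: "S2 f \<Gamma>" and S3: "S3 f \<Gamma>" and S4: "S4 f \<Gamma>" and S5: "S5 f \<Gamma>"
  obtains c0 K where "0 < c0" "0 \<le> K"
    "\<And>M1 M2 c \<zeta>. \<lbrakk>transpose M1 = M1; transpose M2 = M2; \<And>x. \<bar>x \<bullet> (M2 *v x)\<bar> \<le> \<Lambda> * (x \<bullet> x);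
       eigenvalues M2 \<in> closure \<Gamma>; 1 \<le> f (eigenvalues M2); 0 \<le> c; c \<le> c0; K * c < \<zeta> \<bullet> \<zeta>;
       \<And>x. x \<bullet> (M2 *v x) - c * (x \<bullet> x) + (\<zeta> \<bullet> x)\<^sup>2 \<le> x \<bullet> (M1 *v x)\<rbrakk>
      \<Longrightarrow> eigenvalues M1 \<in> \<Gamma> \<and> 1 < f (eigenvalues M1)"
proof -
  let ?one = "(\<chi> i. 1) :: real ^ 'n"
  let ?n = "real CARD('n)"
  \<comment> \<open>These are all vectors that can occur as eigenvalues of an admissible
    \<open>M2\<close>. Condition (S5) puts them in the open set \<Gamma>, so compactness leaves a
    uniform margin \<open>e\<close>.\<close>
  define K0 where "K0 = (closure \<Gamma> \<inter> f -` {1..}) \<inter> cball 0 (?n * \<Lambda>)"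
  have "closed (closure \<Gamma> \<inter> f -` {1..})" by (intro continuous_closed_preimage cont) auto
  then have cK0: "compact K0" unfolding K0_def by (intro closed_Int_compact compact_cball)
  have K0\<Gamma>: "K0 \<subseteq> \<Gamma>" using S5 unfolding S5_def K0_def by auto
  obtain e where e: "e > 0" "(\<Union>l\<in>K0. ball l e) \<subseteq> \<Gamma>"
    using compact_subset_open_imp_ball_epsilon_subset[OF cK0 \<Gamma> K0\<Gamma>] by blast
  define c0 where "c0 = e / (2 * (norm ?one + 1))"
  have c0: "c0 > 0" using e(1) by (simp add: c0_def add_nonneg_pos)
  \<comment> \<open>All downward shifts of \<open>K0\<close> by at most \<open>c0\<close>. As
    \<open>c0\<close> uses half of the margin, \<open>K1\<close> is a compact subset of \<Gamma>,
    and the constants of (S3) and (S4) on it serve for every \<open>c\<close>.\<close>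
  define K1 where "K1 = (\<lambda>(l, c). l - c *\<^sub>R ?one) ` (K0 \<times> {0..c0})"
  have "compact K1"
    unfolding K1_def case_prod_beta
    by (intro compact_continuous_image compact_Times cK0 compact_Icc continuous_intros)
  moreover have "K1 \<subseteq> \<Gamma>"
  proof
    fix v assume "v \<in> K1"
    then obtain l c where l: "l \<in> K0" "0 \<le> c" "c \<le> c0" "v = l - c *\<^sub>R ?one" by (auto simp: K1_def)
    have "dist l v = c * norm ?one" using l by (simp add: dist_norm)
    also have "\<dots> \<le> c0 * norm ?one" using l by (intro mult_right_mono) auto
    also have "\<dots> = e / 2 * (norm ?one / (norm ?one + 1))" by (simp add: c0_def)
    also have "\<dots> \<le> e / 2 * 1" using e by (intro mult_left_mono) (auto simp: divide_le_eq add_nonneg_pos)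
    also have "\<dots> < e" using e by simp
    finally have "v \<in> ball l e" by simp
    then show "v \<in> \<Gamma>" using e(2) l(1) by blast
  qed
  ultimately have K1: "compact K1 \<and> K1 \<subseteq> \<Gamma>" by blast
  obtain \<delta> where \<delta>: "\<delta> > 0" "\<And>l \<mu>. l \<in> K1 \<Longrightarrow> \<mu> \<in> closure Gamma_pos \<Longrightarrow> \<delta> * norm \<mu> \<le> f (l + \<mu>) - f l"
    using S3 K1 unfolding S3_def by metis
  obtain C where C: "C > 0" "\<And>l l'. l \<in> K1 \<Longrightarrow> l' \<in> K1 \<Longrightarrow> \<bar>f l' - f l\<bar> \<le> C * norm (l' - l)"
    using S4 K1 unfolding S4_def by metis
  \<comment> \<open>\<open>C * norm ?one * c\<close> is the loss in \<open>f\<close> caused by the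
    shift, \<delta> times the norm of \<mu> the gain; the factor \<open>?n\<close> converts the sum
    of the components of \<mu> into its norm.\<close>
  define K where "K = C * norm ?one * ?n / \<delta>"
  show thesis
  proof (rule that[OF c0])
    show "0 \<le> K" using C \<delta> by (simp add: K_def)
    fix M1 M2 :: "real ^ 'n ^ 'n" and c :: real and \<zeta> :: "real ^ 'n"
    assume sym1: "transpose M1 = M1" and sym2: "transpose M2 = M2"
      and bnd: "\<And>x. \<bar>x \<bullet> (M2 *v x)\<bar> \<le> \<Lambda> * (x \<bullet> x)"
      and sup: "eigenvalues M2 \<in> closure \<Gamma>" "1 \<le> f (eigenvalues M2)"
      and c: "0 \<le> c" "c \<le> c0" and gain: "K * c < \<zeta> \<bullet> \<zeta>"
      and form: "\<And>x. x \<bullet> (M2 *v x) - c * (x \<bullet> x) + (\<zeta> \<bullet> x)\<^sup>2 \<le> x \<bullet> (M1 *v x)"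
    let ?l2 = "eigenvalues M2"
    have "norm ?l2 \<le> (\<Sum>i\<in>UNIV. \<bar>?l2 $ i\<bar>)" by (rule norm_le_l1_cart)
    also have "\<dots> \<le> (\<Sum>i\<in>(UNIV :: 'n set). \<Lambda>)" using abs_eigenvalues_le[OF sym2 bnd] by (intro sum_mono)
    finally have l2: "?l2 \<in> K0" using sup by (simp add: K0_def)
    define l where "l = ?l2 - c *\<^sub>R ?one"
    have lK: "l \<in> K1" using l2 c by (auto simp: K1_def l_def)
    have l2K: "?l2 \<in> K1" unfolding K1_def using l2 c0 by (intro image_eqI[of _ _ "(?l2, 0)"]) auto
    define A where "A = M2 - c *\<^sub>R mat 1"
    have Ax: "A *v x = M2 *v x - c *\<^sub>R x" for x unfolding A_def by (rule quadratic_form_shift)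
    have symA: "transpose A = A"
      using sym2 by (simp add: A_def transpose_def mat_def vec_eq_iff)
    obtain q where q: "orthonormal_family q" "\<And>i. M2 *v q i = (?l2 $ i) *\<^sub>R q i"
      using eigenvalues_eigenbasis[OF sym2] by blast
    have "A *v q i = (l $ i) *\<^sub>R q i" for i by (simp add: Ax q(2) l_def scaleR_left_diff_distrib)
    then obtain p where p: "p permutes UNIV" "\<And>i. eigenvalues A $ i = l $ p i"
      using eigenvalues_eq_permuted[OF q(1)] by blast
    have le: "x \<bullet> (A *v x) + (\<zeta> \<bullet> x)\<^sup>2 \<le> x \<bullet> (M1 *v x)" for x
      using form[of x] by (simp add: Ax inner_diff_right)
    have "x \<bullet> (A *v x) \<le> x \<bullet> (M1 *v x)" for x
      using le[of x] zero_le_power2[of "\<zeta> \<bullet> x"] by linarith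
    then obtain \<sigma> where \<sigma>: "\<sigma> permutes UNIV" "\<And>i. eigenvalues A $ i \<le> eigenvalues M1 $ \<sigma> i"
      using eigenvalues_monotone[OF symA sym1] by blast
    \<comment> \<open>Composing the two permutations aligns the eigenvalues of \<open>M1\<close>
      with \<open>l\<close>, so that the difference \<mu> is componentwise nonnegative.\<close>
    define \<tau> where "\<tau> = \<sigma> \<circ> inv p"
    have \<tau>: "\<tau> permutes UNIV" unfolding \<tau>_def using permutes_compose[OF permutes_inv[OF p(1)] \<sigma>(1)] .
    define w where "w = (\<chi> j. eigenvalues M1 $ \<tau> j)"
    define \<mu> where "\<mu> = w - l"
    have \<mu>0: "0 \<le> \<mu> $ j" for j
      using \<sigma>(2)[of "inv p j"] p(2)[of "inv p j"] permutes_inverses(1)[OF p(1)]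
      by (simp add: \<mu>_def w_def \<tau>_def)
    then have \<mu>: "\<mu> \<in> closure Gamma_pos" by (rule nonneg_in_closure_Gamma_pos)
    have wl: "l + \<mu> = w" by (simp add: \<mu>_def)
    have w\<Gamma>: "w \<in> \<Gamma>" using S2 lK K1 \<mu> wl unfolding S2_def by (metis subsetD)
    \<comment> \<open>Monotonicity alone gives no amount for the gain. The traces do: summing the
      form inequality over the coordinate axes adds \<zeta> \<bullet> \<zeta>.\<close>
    have "\<zeta> \<bullet> \<zeta> \<le> (\<Sum>j\<in>UNIV. \<mu> $ j)"
    proof -
      have "(\<Sum>j\<in>UNIV. w $ j) = trace M1"
        using sum_eigenvalues_eq_trace[OF sym1] sum.permute[OF \<tau>, of "\<lambda>j. eigenvalues M1 $ j"]
        by (simp add: w_def comp_def)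
      moreover have "(\<Sum>j\<in>UNIV. l $ j) = trace A"
        using sum_eigenvalues_eq_trace[OF symA] sum.permute[OF p(1), of "\<lambda>j. l $ j"]
        by (simp add: p(2) comp_def)
      moreover have "trace A + \<zeta> \<bullet> \<zeta> \<le> trace M1"
      proof -
        have tr: "trace B = (\<Sum>k\<in>UNIV. axis k 1 \<bullet> (B *v axis k 1))" for B :: "real ^ 'n ^ 'n"
          by (simp add: trace_def inner_axis' matrix_vector_mult_basis column_def)
        have "\<zeta> \<bullet> \<zeta> = (\<Sum>k\<in>UNIV. (\<zeta> \<bullet> axis k 1)\<^sup>2)" by (simp add: inner_axis) (simp add: inner_vec_def power2_eq_square)
        then show ?thesis unfolding tr using le by (simp only: sum.distrib[symmetric]) (intro sum_mono)
      qed
      ultimately show ?thesis by (simp add: \<mu>_def sum_subtractf)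
    qed
    also have "\<dots> \<le> ?n * norm \<mu>" by (rule sum_components_le_card_norm)
    finally have "\<zeta> \<bullet> \<zeta> \<le> ?n * norm \<mu>" .
    then have "K * c < ?n * norm \<mu>" using gain by linarith
    then have "C * norm ?one * c < \<delta> * norm \<mu>" using \<delta>(1) by (simp add: K_def field_simps)
    moreover have "\<bar>f l - f ?l2\<bar> \<le> C * norm (l - ?l2)" by (rule C(2)[OF l2K lK])
    moreover have "C * norm (l - ?l2) = C * norm ?one * c" using c by (simp add: l_def)
    moreover have "\<delta> * norm \<mu> \<le> f w - f l" using \<delta>(2)[OF lK \<mu>] wl by simp
    ultimately have "1 < f w" using sup(2) by linarith
    then show "eigenvalues M1 \<in> \<Gamma> \<and> 1 < f (eigenvalues M1)"
      using S1_permute_iff[OF S1 \<tau>, of "eigenvalues M1"] w\<Gamma> unfolding w_def by simp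
  qed
qed

text \<open>The conformal Hessian of \<open>exp w\<close> at a point with \<open>w = s\<close>, \<open>\<nabla>w = p\<close>, \<open>\<nabla>\<^sup>2w = X\<close>. In terms of \<open>w\<close> all
  powers of \<open>u\<close> merge into one exponential factor.\<close>

definition log_conformal_hessian :: "real \<Rightarrow> real ^ 'n \<Rightarrow> real ^ 'n ^ 'n \<Rightarrow> real ^ 'n ^ 'n" where
  "log_conformal_hessian s p X =
     (let a = 2 / (real CARD('n) - 2) in
      exp (- 2 * a * s) *\<^sub>R (- a *\<^sub>R X + a\<^sup>2 *\<^sub>R (\<chi> i j. p $ i * p $ j) - (a\<^sup>2 / 2 * (norm p)\<^sup>2) *\<^sub>R mat 1))"

lemma transpose_log_conformal_hessian:
  assumes "transpose X = X"
  shows "transpose (log_conformal_hessian s p X) = log_conformal_hessian s p X"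
proof -
  have "X $ i $ j = X $ j $ i" for i j by (metis assms transpose_def vec_lambda_beta)
  then show ?thesis by (simp add: log_conformal_hessian_def Let_def transpose_def mat_def vec_eq_iff mult.commute)
qed

lemma log_conformal_hessian_form:
  fixes X :: "real ^ 'n ^ 'n"
  defines "a \<equiv> 2 / (real CARD('n) - 2)"
  shows "x \<bullet> (log_conformal_hessian s p X *v x) =
    exp (- 2 * a * s) * (- a * (x \<bullet> (X *v x)) + a\<^sup>2 * (p \<bullet> x)\<^sup>2 - a\<^sup>2 / 2 * (norm p)\<^sup>2 * (x \<bullet> x))"
proof -
  have pp: "(\<chi> i j. p $ i * p $ j) *v x = (p \<bullet> x) *\<^sub>R p"
    by (simp add: vec_eq_iff matrix_vector_mult_def inner_vec_def sum_distrib_left sum_distrib_right mult_ac)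
  show ?thesis
    unfolding log_conformal_hessian_def Let_def a_def[symmetric]
    by (simp add: matrix_vector_mult_diff_rdistrib matrix_vector_mult_add_rdistrib pp inner_diff_right inner_add_right
        inner_commute[of x p] power2_eq_square flip: scaleR_matrix_vector_assoc)
qed

lemma abs_exp_diff_le:
  fixes u v B :: real
  assumes "u \<le> B" "v \<le> B"
  shows "\<bar>exp u - exp v\<bar> \<le> exp B * \<bar>u - v\<bar>"
proof -
  have *: "exp u - exp v \<le> exp B * (u - v)" if "v \<le> u" "u \<le> B" for u v :: real
  proof -
    have "exp u - exp v = exp u * (1 - exp (v - u))" by (simp add: algebra_simps flip: exp_add)
    also have "\<dots> \<le> exp u * (u - v)"
    proof (rule mult_left_mono)
      show "1 - exp (v - u) \<le> u - v" using exp_ge_add_one_self[of "v - u"] by linarith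
    qed simp
    also have "\<dots> \<le> exp B * (u - v)" using that by (intro mult_right_mono) auto
    finally show ?thesis .
  qed
  show ?thesis
  proof (cases "v \<le> u")
    case True
    then show ?thesis using *[of v u] assms by simp
  next
    case False
    then show ?thesis using *[of u v] assms by simp
  qed
qed

section \<open>Pointwise viscosity inequalities in logarithmic variables\<close>

text \<open>The inequality required of a super-solution at a test function whose logarithm has value
  \<open>s\<close>, gradient \<open>p\<close> and Hessian \<open>X\<close> at the touching point.
  \<open>sub_jet\<close> is the counterpart for sub-solutions.\<close>

definition super_jet :: "(real ^ 'n \<Rightarrow> real) \<Rightarrow> (real ^ 'n) set \<Rightarrow> real \<Rightarrow> real ^ 'n \<Rightarrow> real ^ 'n ^ 'n \<Rightarrow> bool" where
  "super_jet f \<Gamma> s p X \<longleftrightarrow> eigenvalues (log_conformal_hessian s p X) \<in> closure \<Gamma> \<and>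
     1 \<le> f (eigenvalues (log_conformal_hessian s p X))"

definition sub_jet :: "(real ^ 'n \<Rightarrow> real) \<Rightarrow> (real ^ 'n) set \<Rightarrow> real \<Rightarrow> real ^ 'n \<Rightarrow> real ^ 'n ^ 'n \<Rightarrow> bool" where
  "sub_jet f \<Gamma> s p X \<longleftrightarrow> eigenvalues (log_conformal_hessian s p X) \<notin> closure \<Gamma> \<or>
     f (eigenvalues (log_conformal_hessian s p X)) \<le> 1"

text \<open>The jets compared here differ by the jet of \<open>\<epsilon> exp (- \<alpha> |z|\<^sup>2)\<close> at \<open>z\<close>, up to errors of smaller
  order in \<open>\<alpha>\<close>; \<open>\<tau>\<close> is the value of this barrier.\<close>

lemma barrier_makes_strict:
  fixes f :: "real ^ 'n \<Rightarrow> real" and \<Gamma> :: "(real ^ 'n) set"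
  assumes n: "CARD('n) \<ge> 3" and \<Gamma>: "open \<Gamma>" and cont: "continuous_on (closure \<Gamma>) f"
    and S1: "S1 f \<Gamma>" and S2: "S2 f \<Gamma>" and S3: "S3 f \<Gamma>" and S4: "S4 f \<Gamma>" and S5: "S5 f \<Gamma>"
    and \<Lambda>: "\<Lambda> > 0" and R: "R > 0"
  obtains \<alpha> \<epsilon>0 where "1 \<le> \<alpha>" "0 < \<epsilon>0"
    "\<And>\<epsilon> \<tau> s1 s2 p1 p2 X1 X2 z. \<lbrakk>0 < \<epsilon>; \<epsilon> \<le> \<epsilon>0; R / 2 \<le> norm z; norm z \<le> R; \<tau> = \<epsilon> * exp (- \<alpha> * (norm z)\<^sup>2);
       transpose X1 = X1; transpose X2 = X2; \<bar>s1\<bar> \<le> \<Lambda>; \<bar>s2\<bar> \<le> \<Lambda>; norm p1 \<le> \<Lambda>; norm p2 \<le> \<Lambda>;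
       \<And>x. \<bar>x \<bullet> (X2 *v x)\<bar> \<le> \<Lambda> * (x \<bullet> x); \<bar>s1 - s2\<bar> \<le> 2 * \<tau>; norm (p1 - p2) \<le> (2 * \<alpha> * R + 1) * \<tau>;
       \<And>x. x \<bullet> (X1 *v x) \<le> x \<bullet> (X2 *v x) - 4 * \<alpha>\<^sup>2 * \<tau> * (z \<bullet> x)\<^sup>2 + 4 * \<alpha> * \<tau> * (x \<bullet> x);
       super_jet f \<Gamma> s2 p2 X2\<rbrakk> \<Longrightarrow> \<not> sub_jet f \<Gamma> s1 p1 X1"
proof -
  define a where "a = 2 / (real CARD('n) - 2)"
  have a: "a > 0" using n by (simp add: a_def)
  define m where "m = exp (- 2 * a * \<Lambda>)"
  define E where "E = exp (2 * a * \<Lambda>)"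
  have mE: "m > 0" "E > 0" by (auto simp: m_def E_def)
  \<comment> \<open>\<beta> bounds the bracket in \<open>log_conformal_hessian_form\<close> for a
    jet of size \<Lambda>, while \<open>m\<close> and \<open>E\<close> bound its exponential factor
    from both sides.\<close>
  define \<beta> where "\<beta> = a * \<Lambda> + 3 / 2 * a\<^sup>2 * \<Lambda>\<^sup>2"
  have \<beta>: "\<beta> > 0" using a \<Lambda> by (simp add: \<beta>_def add_pos_pos)
  obtain c0 K where c0: "0 < c0" and K: "0 \<le> K"
    and gain: "\<And>M1 M2 c \<zeta>. \<lbrakk>transpose M1 = M1; transpose M2 = M2; \<And>x. \<bar>x \<bullet> (M2 *v x)\<bar> \<le> (E * \<beta>) * (x \<bullet> x);
       eigenvalues M2 \<in> closure \<Gamma>; 1 \<le> f (eigenvalues M2); 0 \<le> c; c \<le> c0; K * c < \<zeta> \<bullet> \<zeta>;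
       \<And>x. x \<bullet> (M2 *v x) - c * (x \<bullet> x) + (\<zeta> \<bullet> x)\<^sup>2 \<le> x \<bullet> (M1 *v x)\<rbrakk>
      \<Longrightarrow> eigenvalues M1 \<in> \<Gamma> \<and> 1 < f (eigenvalues M1)"
    using rank_one_gain_beats_shift[OF \<Gamma> cont S1 S2 S3 S4 S5, of "E * \<beta>"] by blast
  define C1 where "C1 = E * (4 * a + 3 * a\<^sup>2 * \<Lambda> * (2 * R + 1) + 4 * a * \<beta>)"
  have C1: "C1 > 0" unfolding C1_def using mE a \<beta> \<Lambda> R by (intro mult_pos_pos add_pos_pos) auto
  \<comment> \<open>The rank-one gain is of order \<alpha>^2 \<tau> and all losses together are at
    most C1 \<alpha> \<tau>. Hence \<alpha> is taken large enough that the gain wins with the factor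
    \<open>K\<close>, and then \<open>\<epsilon>0\<close> so small that the losses stay below the
    admissible shift \<open>c0\<close>.\<close>
  define \<alpha> where "\<alpha> = 1 + K * C1 / (m * a * R\<^sup>2)"
  have \<alpha>1: "1 \<le> \<alpha>" using K C1 mE a R by (simp add: \<alpha>_def)
  have \<alpha>2: "K * C1 < m * a * R\<^sup>2 * \<alpha>" using mE a R by (simp add: \<alpha>_def field_simps)
  define \<epsilon>0 where "\<epsilon>0 = c0 / (C1 * \<alpha>)"
  have \<epsilon>0: "\<epsilon>0 > 0" using c0 C1 \<alpha>1 by (simp add: \<epsilon>0_def)
  show thesis
  proof (rule that[OF \<alpha>1 \<epsilon>0])
    fix \<epsilon> \<tau> s1 s2 :: real and p1 p2 z :: "real ^ 'n" and X1 X2 :: "real ^ 'n ^ 'n"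
    assume \<epsilon>: "0 < \<epsilon>" "\<epsilon> \<le> \<epsilon>0" and z: "R / 2 \<le> norm z" "norm z \<le> R" and \<tau>_def: "\<tau> = \<epsilon> * exp (- \<alpha> * (norm z)\<^sup>2)"
      and sym: "transpose X1 = X1" "transpose X2 = X2"
      and s: "\<bar>s1\<bar> \<le> \<Lambda>" "\<bar>s2\<bar> \<le> \<Lambda>" and p: "norm p1 \<le> \<Lambda>" "norm p2 \<le> \<Lambda>"
      and X2: "\<And>x. \<bar>x \<bullet> (X2 *v x)\<bar> \<le> \<Lambda> * (x \<bullet> x)"
      and ds: "\<bar>s1 - s2\<bar> \<le> 2 * \<tau>" and dp: "norm (p1 - p2) \<le> (2 * \<alpha> * R + 1) * \<tau>"
      and dX: "\<And>x. x \<bullet> (X1 *v x) \<le> x \<bullet> (X2 *v x) - 4 * \<alpha>\<^sup>2 * \<tau> * (z \<bullet> x)\<^sup>2 + 4 * \<alpha> * \<tau> * (x \<bullet> x)"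
      and sup_jet: "super_jet f \<Gamma> s2 p2 X2"
    have \<tau>: "0 < \<tau>" "\<tau> \<le> \<epsilon>"
    proof -
      show "0 < \<tau>" using \<epsilon> by (simp add: \<tau>_def)
      have "exp (- \<alpha> * (norm z)\<^sup>2) \<le> 1" using \<alpha>1 by simp
      then show "\<tau> \<le> \<epsilon>" using \<epsilon> by (simp add: \<tau>_def mult_left_le)
    qed
    define b where "b = (\<lambda>(p :: real ^ 'n) (X :: real ^ 'n ^ 'n) x. - a * (x \<bullet> (X *v x)) + a\<^sup>2 * (p \<bullet> x)\<^sup>2 - a\<^sup>2 / 2 * (norm p)\<^sup>2 * (x \<bullet> x))"
    have form: "x \<bullet> (log_conformal_hessian s p X *v x) = exp (- 2 * a * s) * b p X x" for s p x and X :: "real ^ 'n ^ 'n"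
      unfolding b_def a_def by (rule log_conformal_hessian_form)
    have es: "m \<le> exp (- 2 * a * s)" "exp (- 2 * a * s) \<le> E" if "\<bar>s\<bar> \<le> \<Lambda>" for s
    proof -
      have "a * s \<le> a * \<Lambda>" using that a by (intro mult_left_mono) auto
      moreover have "- (a * \<Lambda>) \<le> a * s" using mult_left_mono[of "- \<Lambda>" s a] that a by auto
      ultimately show "m \<le> exp (- 2 * a * s)" "exp (- 2 * a * s) \<le> E"
        unfolding m_def E_def exp_le_cancel_iff by linarith+
    qed
    have xx: "(p \<bullet> x)\<^sup>2 \<le> (norm p)\<^sup>2 * (x \<bullet> x)" for p x :: "real ^ 'n"
      using Cauchy_Schwarz_ineq[of p x] by (simp add: power2_norm_eq_inner)
    have b2: "\<bar>b p2 X2 x\<bar> \<le> \<beta> * (x \<bullet> x)" for x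
    proof -
      have np: "(norm p2)\<^sup>2 \<le> \<Lambda>\<^sup>2" using p by (intro power_mono) auto
      have 1: "\<bar>a * (x \<bullet> (X2 *v x))\<bar> \<le> a * \<Lambda> * (x \<bullet> x)" using X2[of x] a by (simp add: abs_mult mult.assoc)
      have 3: "(norm p2)\<^sup>2 * (x \<bullet> x) \<le> \<Lambda>\<^sup>2 * (x \<bullet> x)" using np by (intro mult_right_mono) auto
      have "(p2 \<bullet> x)\<^sup>2 \<le> \<Lambda>\<^sup>2 * (x \<bullet> x)" using xx[of p2 x] 3 by linarith
      then have 2: "a\<^sup>2 * (p2 \<bullet> x)\<^sup>2 \<le> a\<^sup>2 * (\<Lambda>\<^sup>2 * (x \<bullet> x))" by (intro mult_left_mono) auto
      have 4: "a\<^sup>2 / 2 * ((norm p2)\<^sup>2 * (x \<bullet> x)) \<le> a\<^sup>2 / 2 * (\<Lambda>\<^sup>2 * (x \<bullet> x))" using 3 by (intro mult_left_mono) auto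
      have 5: "0 \<le> a\<^sup>2 * (p2 \<bullet> x)\<^sup>2" "0 \<le> a\<^sup>2 / 2 * ((norm p2)\<^sup>2 * (x \<bullet> x))" by auto
      have "\<bar>b p2 X2 x\<bar> \<le> a * \<Lambda> * (x \<bullet> x) + a\<^sup>2 * (\<Lambda>\<^sup>2 * (x \<bullet> x)) + a\<^sup>2 / 2 * (\<Lambda>\<^sup>2 * (x \<bullet> x))"
        unfolding b_def mult.assoc[of "a\<^sup>2 / 2"] using 1 2 4 5 by linarith
      then show ?thesis by (simp add: \<beta>_def algebra_simps)
    qed
    let ?M1 = "log_conformal_hessian s1 p1 X1" and ?M2 = "log_conformal_hessian s2 p2 X2"
    have sup: "eigenvalues ?M2 \<in> closure \<Gamma>" "1 \<le> f (eigenvalues ?M2)"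
      using sup_jet by (simp_all add: super_jet_def)
    let ?c = "C1 * \<alpha> * \<tau>"
    \<comment> \<open>Its square is the second derivative of the barrier in direction
      \<open>z\<close>, multiplied by the least possible exponential factor \<open>m\<close> and by
      the coefficient \<open>a\<close>.\<close>
    define \<zeta> where "\<zeta> = (sqrt (m * 4 * a * \<tau>) * \<alpha>) *\<^sub>R z"
    have \<zeta>: "(\<zeta> \<bullet> x)\<^sup>2 = m * 4 * a * \<tau> * \<alpha>\<^sup>2 * (z \<bullet> x)\<^sup>2" for x
      using mE a \<tau> by (simp add: \<zeta>_def power_mult_distrib)
    have "eigenvalues ?M1 \<in> \<Gamma> \<and> 1 < f (eigenvalues ?M1)"
    proof (rule gain[OF _ _ _ sup])
      show "transpose ?M1 = ?M1" "transpose ?M2 = ?M2" using sym by (auto intro: transpose_log_conformal_hessian)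
      show "\<bar>x \<bullet> (?M2 *v x)\<bar> \<le> E * \<beta> * (x \<bullet> x)" for x
        unfolding form abs_mult using es[OF s(2)] b2[of x] mE
        by (simp add: mult.assoc) (intro mult_mono, auto)
      show "0 \<le> ?c" using C1 \<alpha>1 \<tau> by simp
      have "?c \<le> C1 * \<alpha> * \<epsilon>0" using C1 \<alpha>1 \<tau> \<epsilon> by (intro mult_left_mono) auto
      also have "\<dots> = c0" using C1 \<alpha>1 by (simp add: \<epsilon>0_def)
      finally show "?c \<le> c0" .
      show "K * ?c < \<zeta> \<bullet> \<zeta>"
      proof -
        have "\<zeta> \<bullet> \<zeta> = m * 4 * a * \<tau> * \<alpha>\<^sup>2 * (norm z)\<^sup>2"
        proof -
          have "\<zeta> \<bullet> \<zeta> = (sqrt (m * 4 * a * \<tau>))\<^sup>2 * \<alpha>\<^sup>2 * (norm z)\<^sup>2"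
            unfolding \<zeta>_def power2_norm_eq_inner inner_scaleR_left inner_scaleR_right
            by (simp only: power2_eq_square mult_ac)
          also have "(sqrt (m * 4 * a * \<tau>))\<^sup>2 = m * 4 * a * \<tau>" using mE a \<tau> by (intro real_sqrt_pow2) auto
          finally show ?thesis .
        qed
        moreover have "(R / 2)\<^sup>2 \<le> (norm z)\<^sup>2" using z R by (intro power_mono) auto
        then have "m * 4 * a * \<tau> * \<alpha>\<^sup>2 * (R / 2)\<^sup>2 \<le> m * 4 * a * \<tau> * \<alpha>\<^sup>2 * (norm z)\<^sup>2"
          using mE a \<tau> by (intro mult_left_mono) auto
        moreover have "m * 4 * a * \<tau> * \<alpha>\<^sup>2 * (R / 2)\<^sup>2 = (\<tau> * \<alpha>) * (m * a * R\<^sup>2 * \<alpha>)" by (simp add: power2_eq_square)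
        moreover have "(\<tau> * \<alpha>) * (K * C1) < (\<tau> * \<alpha>) * (m * a * R\<^sup>2 * \<alpha>)"
          using \<alpha>2 \<tau> \<alpha>1 by (intro mult_strict_left_mono) auto
        moreover have "K * ?c = (\<tau> * \<alpha>) * (K * C1)" by simp
        ultimately show ?thesis by linarith
      qed
      fix x
      let ?Q = "x \<bullet> x" and ?T = "(z \<bullet> x)\<^sup>2"
      let ?e1 = "exp (- 2 * a * s1)" and ?e2 = "exp (- 2 * a * s2)"
      define g1 where "g1 = 4 * a * \<tau> * \<alpha>\<^sup>2"
      \<comment> \<open>The first summand is the tangential part of the barrier Hessian. In the
        second, the two gradient terms contribute 2 and 1 times a^2 \<Lambda> times the slope
        difference.\<close>
      define g2 where "g2 = \<tau> * (4 * a * \<alpha> + 3 * a\<^sup>2 * \<Lambda> * (2 * \<alpha> * R + 1))"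
      have Q: "0 \<le> ?Q" by simp
      have g: "0 \<le> g1" "0 \<le> g2" using a \<tau> \<alpha>1 \<Lambda> R by (auto simp: g1_def g2_def)
      let ?d = "(2 * \<alpha> * R + 1) * \<tau>"
      have d: "0 \<le> ?d" using \<alpha>1 R \<tau> by simp
      have i1: "\<bar>(p1 \<bullet> x)\<^sup>2 - (p2 \<bullet> x)\<^sup>2\<bar> \<le> 2 * \<Lambda> * ?d * ?Q"
      proof -
        have "(p1 \<bullet> x)\<^sup>2 - (p2 \<bullet> x)\<^sup>2 = ((p1 - p2) \<bullet> x) * ((p1 + p2) \<bullet> x)"
          by (simp add: power2_eq_square inner_diff_left inner_add_left algebra_simps)
        then have "\<bar>(p1 \<bullet> x)\<^sup>2 - (p2 \<bullet> x)\<^sup>2\<bar> = \<bar>(p1 - p2) \<bullet> x\<bar> * \<bar>(p1 + p2) \<bullet> x\<bar>" by (simp add: abs_mult)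
        also have "\<dots> \<le> (norm (p1 - p2) * norm x) * (norm (p1 + p2) * norm x)"
          by (intro mult_mono Cauchy_Schwarz_ineq2) auto
        also have "\<dots> \<le> (?d * norm x) * ((2 * \<Lambda>) * norm x)"
          using dp d norm_triangle_ineq[of p1 p2] p by (intro mult_mono mult_right_mono) auto
        also have "\<dots> = 2 * \<Lambda> * ?d * (norm x)\<^sup>2" by (simp add: power2_eq_square)
        finally show ?thesis by (simp add: power2_norm_eq_inner)
      qed
      have i2: "\<bar>(norm p1)\<^sup>2 - (norm p2)\<^sup>2\<bar> \<le> 2 * \<Lambda> * ?d"
      proof -
        have "(norm p1)\<^sup>2 - (norm p2)\<^sup>2 = (norm p1 - norm p2) * (norm p1 + norm p2)"
          by (simp add: power2_eq_square algebra_simps)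
        then have "\<bar>(norm p1)\<^sup>2 - (norm p2)\<^sup>2\<bar> = \<bar>norm p1 - norm p2\<bar> * (norm p1 + norm p2)" by (simp add: abs_mult)
        also have "\<dots> \<le> ?d * (2 * \<Lambda>)"
          using dp d norm_triangle_ineq3[of p1 p2] p by (intro mult_mono) auto
        finally show ?thesis by (simp add: mult_ac)
      qed
      have bb: "g1 * ?T - g2 * ?Q \<le> b p1 X1 x - b p2 X2 x"
      proof -
        have 1: "a * (x \<bullet> (X1 *v x)) \<le> a * (x \<bullet> (X2 *v x) - 4 * \<alpha>\<^sup>2 * \<tau> * ?T + 4 * \<alpha> * \<tau> * ?Q)"
          using dX[of x] a by (intro mult_left_mono) auto
        have 2: "a\<^sup>2 * \<bar>(p1 \<bullet> x)\<^sup>2 - (p2 \<bullet> x)\<^sup>2\<bar> \<le> a\<^sup>2 * (2 * \<Lambda> * ?d * ?Q)" using i1 by (intro mult_left_mono) auto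
        have 3: "a\<^sup>2 / 2 * (\<bar>(norm p1)\<^sup>2 - (norm p2)\<^sup>2\<bar> * ?Q) \<le> a\<^sup>2 / 2 * (2 * \<Lambda> * ?d * ?Q)"
          using i2 Q by (intro mult_left_mono mult_right_mono) auto
        have 4: "a\<^sup>2 * ((p1 \<bullet> x)\<^sup>2 - (p2 \<bullet> x)\<^sup>2) \<ge> - (a\<^sup>2 * \<bar>(p1 \<bullet> x)\<^sup>2 - (p2 \<bullet> x)\<^sup>2\<bar>)"
          using mult_left_mono[of "- \<bar>(p1 \<bullet> x)\<^sup>2 - (p2 \<bullet> x)\<^sup>2\<bar>" "(p1 \<bullet> x)\<^sup>2 - (p2 \<bullet> x)\<^sup>2" "a\<^sup>2"] by simp
        have 5: "a\<^sup>2 / 2 * (((norm p1)\<^sup>2 - (norm p2)\<^sup>2) * ?Q) \<le> a\<^sup>2 / 2 * (\<bar>(norm p1)\<^sup>2 - (norm p2)\<^sup>2\<bar> * ?Q)"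
          using Q by (intro mult_left_mono mult_right_mono) auto
        have "b p1 X1 x - b p2 X2 x = - (a * (x \<bullet> (X1 *v x))) + a * (x \<bullet> (X2 *v x))
          + a\<^sup>2 * ((p1 \<bullet> x)\<^sup>2 - (p2 \<bullet> x)\<^sup>2) - a\<^sup>2 / 2 * (((norm p1)\<^sup>2 - (norm p2)\<^sup>2) * ?Q)"
          by (simp add: b_def algebra_simps)
        also have "\<dots> \<ge> - (a * (x \<bullet> (X2 *v x) - 4 * \<alpha>\<^sup>2 * \<tau> * ?T + 4 * \<alpha> * \<tau> * ?Q)) + a * (x \<bullet> (X2 *v x))
          - a\<^sup>2 * (2 * \<Lambda> * ?d * ?Q) - a\<^sup>2 / 2 * (2 * \<Lambda> * ?d * ?Q)"
          using 1 2 3 4 5 by linarith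
        also have "- (a * (x \<bullet> (X2 *v x) - 4 * \<alpha>\<^sup>2 * \<tau> * ?T + 4 * \<alpha> * \<tau> * ?Q)) + a * (x \<bullet> (X2 *v x))
          - a\<^sup>2 * (2 * \<Lambda> * ?d * ?Q) - a\<^sup>2 / 2 * (2 * \<Lambda> * ?d * ?Q) = g1 * ?T - g2 * ?Q"
          by (simp add: g1_def g2_def algebra_simps)
        finally show ?thesis .
      qed
      have "?e1 * (g1 * ?T - g2 * ?Q) \<le> ?e1 * (b p1 X1 x - b p2 X2 x)" using bb by (intro mult_left_mono) auto
      moreover have "m * (g1 * ?T) \<le> ?e1 * (g1 * ?T)" using es(1)[OF s(1)] g by (intro mult_right_mono) auto
      moreover have "?e1 * (g2 * ?Q) \<le> E * (g2 * ?Q)" using es(2)[OF s(1)] g by (intro mult_right_mono) auto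
      moreover have "\<bar>(?e1 - ?e2) * b p2 X2 x\<bar> \<le> (E * (4 * a * \<tau>)) * (\<beta> * ?Q)"
      proof -
        have "\<bar>?e1 - ?e2\<bar> \<le> E * \<bar>- 2 * a * s1 - - 2 * a * s2\<bar>"
          unfolding E_def using es(2)[OF s(1)] es(2)[OF s(2)] by (intro abs_exp_diff_le) (simp_all only: E_def exp_le_cancel_iff)
        also have "\<bar>- 2 * a * s1 - - 2 * a * s2\<bar> = 2 * a * \<bar>s1 - s2\<bar>"
        proof -
          have "- 2 * a * s1 - - 2 * a * s2 = - (2 * a) * (s1 - s2)" by (simp add: algebra_simps)
          then show ?thesis using a by (simp only: abs_mult)
        qed
        also have "E * (2 * a * \<bar>s1 - s2\<bar>) \<le> E * (2 * a * (2 * \<tau>))" using mE a ds by (intro mult_left_mono) auto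
        finally have "\<bar>?e1 - ?e2\<bar> \<le> E * (4 * a * \<tau>)" by simp
        then show ?thesis unfolding abs_mult using b2[of x] mE a \<tau> by (intro mult_mono) auto
      qed
      \<comment> \<open>The brackets are compared under one common factor. The change of the factor
        multiplies only the bracket of \<open>X2\<close>, the one for which a two-sided bound is
        available.\<close>
      moreover have "x \<bullet> (?M1 *v x) - x \<bullet> (?M2 *v x) = ?e1 * (b p1 X1 x - b p2 X2 x) + (?e1 - ?e2) * b p2 X2 x"
        unfolding form by (simp add: algebra_simps)
      moreover have "?e1 * (g1 * ?T - g2 * ?Q) = ?e1 * (g1 * ?T) - ?e1 * (g2 * ?Q)" by (simp add: algebra_simps)
      ultimately have low: "m * (g1 * ?T) - E * (g2 * ?Q) - (E * (4 * a * \<tau>)) * (\<beta> * ?Q) \<le> x \<bullet> (?M1 *v x) - x \<bullet> (?M2 *v x)"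
        unfolding abs_le_iff by linarith
      have "E * (g2 * ?Q) + (E * (4 * a * \<tau>)) * (\<beta> * ?Q) = (E * \<tau> * ?Q) * (4 * a * \<alpha> + 3 * a\<^sup>2 * \<Lambda> * (2 * \<alpha> * R + 1) + 4 * a * \<beta>)"
        by (simp add: g2_def algebra_simps)
      also have "\<dots> \<le> (E * \<tau> * ?Q) * (\<alpha> * (4 * a + 3 * a\<^sup>2 * \<Lambda> * (2 * R + 1) + 4 * a * \<beta>))"
      proof (rule mult_left_mono)
        \<comment> \<open>As \<alpha> \<ge> 1, a factor \<alpha> can be taken out of all losses. The
          rest is \<open>C1\<close>, which must not depend on \<alpha>.\<close>
        have 1: "3 * a\<^sup>2 * \<Lambda> * (2 * \<alpha> * R + 1) \<le> 3 * a\<^sup>2 * \<Lambda> * (\<alpha> * (2 * R + 1))"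
          using a \<Lambda> \<alpha>1 by (intro mult_left_mono) (auto simp: algebra_simps)
        have 2: "1 * (4 * a * \<beta>) \<le> \<alpha> * (4 * a * \<beta>)" using a \<beta> \<alpha>1 by (intro mult_right_mono) auto
        show "4 * a * \<alpha> + 3 * a\<^sup>2 * \<Lambda> * (2 * \<alpha> * R + 1) + 4 * a * \<beta> \<le> \<alpha> * (4 * a + 3 * a\<^sup>2 * \<Lambda> * (2 * R + 1) + 4 * a * \<beta>)"
          using 1 2 by (simp add: algebra_simps)
      qed (use mE \<tau> in auto)
      also have "\<dots> = ?c * ?Q" by (simp add: C1_def)
      finally have "E * (g2 * ?Q) + (E * (4 * a * \<tau>)) * (\<beta> * ?Q) \<le> ?c * ?Q" .
      moreover have "m * (g1 * ?T) = (\<zeta> \<bullet> x)\<^sup>2" unfolding \<zeta> by (simp add: g1_def)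
      ultimately show "x \<bullet> (?M2 *v x) - ?c * ?Q + (\<zeta> \<bullet> x)\<^sup>2 \<le> x \<bullet> (?M1 *v x)" using low by linarith
    qed
    \<comment> \<open>Membership in \<Gamma> together with a value of \<open>f\<close> above 1
      excludes both alternatives in \<open>sub_jet\<close>.\<close>
    then show "\<not> sub_jet f \<Gamma> s1 p1 X1" unfolding sub_jet_def using closure_subset by fastforce
  qed
qed

section \<open>Test functions\<close>

lemma grad_eqI:
  assumes "(u has_derivative (\<lambda>h. g \<bullet> h)) (at x)"
  shows "grad u x = g"
proof -
  have "frechet_derivative u (at x) = (\<lambda>h. g \<bullet> h)" using assms by (metis frechet_derivative_at)
  then show ?thesis by (simp add: grad_def vec_eq_iff inner_axis)
qed

lemma hessian_eqI:
  assumes "(grad u has_derivative D) (at x)"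
  shows "hessian u x = matrix D"
  using frechet_derivative_at[OF assms] by (simp add: hessian_def jacobian_def)

text \<open>Positive and C^2 on the whole space, so it is admissible on every \<Omega>, and touching
  has to be checked only near the contact point.\<close>

definition exp_quadratic :: "real ^ 'n \<Rightarrow> real \<Rightarrow> real ^ 'n \<Rightarrow> real ^ 'n ^ 'n \<Rightarrow> real ^ 'n \<Rightarrow> real" where
  "exp_quadratic x0 s p X x = exp (s + p \<bullet> (x - x0) + (X *v (x - x0)) \<bullet> (x - x0) / 2)"

lemma exp_quadratic_derivatives:
  fixes X :: "real ^ 'n ^ 'n" and x0 p :: "real ^ 'n" and s :: real
  assumes sym: "transpose X = X"
  defines "v \<equiv> \<lambda>x. p + X *v (x - x0)" and "\<phi> \<equiv> exp_quadratic x0 s p X"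
  shows "(\<phi> has_derivative (\<lambda>h. (\<phi> x *\<^sub>R v x) \<bullet> h)) (at x)"
    and "grad \<phi> x = \<phi> x *\<^sub>R v x"
    and "(grad \<phi> has_derivative (\<lambda>h. ((\<phi> x *\<^sub>R v x) \<bullet> h) *\<^sub>R v x + \<phi> x *\<^sub>R (X *v h))) (at x)"
    and "hessian \<phi> x = \<phi> x *\<^sub>R ((\<chi> i j. v x $ i * v x $ j) + X)"
proof -
  have blX: "bounded_linear ((*v) X)" by (rule matrix_vector_mul_bounded_linear)
  have dX: "((\<lambda>x. X *v (x - x0)) has_derivative (\<lambda>h. X *v h)) (at x)" for x
    by (rule has_derivative_eq_rhs[OF bounded_linear.has_derivative[OF blX]]) (auto intro!: derivative_eq_intros)
  show d1: "(\<phi> has_derivative (\<lambda>h. (\<phi> x *\<^sub>R v x) \<bullet> h)) (at x)" for x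
  proof -
    have *: "(\<phi> has_derivative (\<lambda>h. exp (s + p \<bullet> (x - x0) + (X *v (x - x0)) \<bullet> (x - x0) / 2) *
      (p \<bullet> h + ((X *v (x - x0)) \<bullet> h + (X *v h) \<bullet> (x - x0)) / 2))) (at x)"
      unfolding \<phi>_def exp_quadratic_def by (auto intro!: derivative_eq_intros dX)
    show ?thesis
    proof (rule has_derivative_eq_rhs[OF *], rule ext)
      fix h
      have "(X *v h) \<bullet> (x - x0) = (X *v (x - x0)) \<bullet> h"
        using symmetric_matrix_inner[OF sym, of "x - x0" h] by (metis inner_commute)
      then have "p \<bullet> h + ((X *v (x - x0)) \<bullet> h + (X *v h) \<bullet> (x - x0)) / 2 = v x \<bullet> h"
        unfolding v_def inner_add_left by simp
      then show "exp (s + p \<bullet> (x - x0) + (X *v (x - x0)) \<bullet> (x - x0) / 2) *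
          (p \<bullet> h + ((X *v (x - x0)) \<bullet> h + (X *v h) \<bullet> (x - x0)) / 2) = (\<phi> x *\<^sub>R v x) \<bullet> h"
        unfolding \<phi>_def exp_quadratic_def inner_scaleR_left by (simp only:)
    qed
  qed
  have gr: "grad \<phi> = (\<lambda>x. \<phi> x *\<^sub>R v x)" by (rule ext) (rule grad_eqI[OF d1])
  then show "grad \<phi> x = \<phi> x *\<^sub>R v x" by simp
  have dv: "(v has_derivative (\<lambda>h. X *v h)) (at x)"
    unfolding v_def by (auto intro!: derivative_eq_intros dX)
  show d2: "(grad \<phi> has_derivative (\<lambda>h. ((\<phi> x *\<^sub>R v x) \<bullet> h) *\<^sub>R v x + \<phi> x *\<^sub>R (X *v h))) (at x)"
    unfolding gr by (rule has_derivative_eq_rhs[OF has_derivative_scaleR[OF d1 dv]]) (simp add: add.commute)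
  show "hessian \<phi> x = \<phi> x *\<^sub>R ((\<chi> i j. v x $ i * v x $ j) + X)"
    unfolding hessian_eqI[OF d2]
    by (simp add: matrix_def vec_eq_iff inner_axis matrix_vector_mult_basis column_def algebra_simps)
qed

lemma C2_on_exp_quadratic:
  assumes sym: "transpose X = X"
  shows "C2_on S (exp_quadratic x0 s p X)"
proof -
  note d = exp_quadratic_derivatives[OF sym]
  have "continuous_on S (hessian (exp_quadratic x0 s p X))"
  proof -
    have c1: "continuous_on S (exp_quadratic x0 s p X)"
      using d(1) by (meson continuous_at_imp_continuous_on has_derivative_continuous)
    have cX: "continuous_on S (\<lambda>x. X *v (x - x0))"
      by (rule continuous_on_compose2[OF matrix_vector_mult_linear_continuous_on[of UNIV X]]) (auto intro!: continuous_intros)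
    have ci: "continuous_on S (\<lambda>x. (p + X *v (x - x0)) $ i)" for i
      by (rule continuous_on_component) (intro continuous_on_add continuous_on_const cX)
    have "continuous_on S (\<lambda>x. exp_quadratic x0 s p X x *\<^sub>R
        ((\<chi> i j. (p + X *v (x - x0)) $ i * (p + X *v (x - x0)) $ j) + X))"
      by (rule continuous_on_scaleR[OF c1], rule continuous_on_add[OF _ continuous_on_const],
          rule continuous_on_vec_lambda, rule continuous_on_vec_lambda, rule continuous_on_mult[OF ci ci])
    moreover have "hessian (exp_quadratic x0 s p X) = (\<lambda>x. exp_quadratic x0 s p X x *\<^sub>R
        ((\<chi> i j. (p + X *v (x - x0)) $ i * (p + X *v (x - x0)) $ j) + X))"
      by (rule ext) (rule d(4))
    ultimately show ?thesis by simp
  qed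
  then show ?thesis
    unfolding C2_on_def by (intro conjI ballI differentiableI[OF d(1)] differentiableI[OF d(3)])
qed

text \<open>Here k = n - 2. The Hessian of an exponential contains the square of the gradient, which
  lowers the coefficient of that term from 2 (k + 2) / k^2 by 2 / k to (2 / k)^2.\<close>

lemma conformal_coefficients:
  fixes k e P Y q I :: real
  assumes "k \<noteq> 0"
  shows "- (2 / k) * e * (P + Y) + 2 * (k + 2) / k\<^sup>2 * e * P - 2 / k\<^sup>2 * e * q * I =
    e * (- (2 / k) * Y + (2 / k)\<^sup>2 * P - (2 / k)\<^sup>2 / 2 * q * I)"
  using assms by (simp add: field_simps power2_eq_square)

lemma conformal_hessian_exp_quadratic:
  fixes X :: "real ^ 'n ^ 'n"
  assumes sym: "transpose X = X" and n: "CARD('n) \<ge> 3"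
  shows "conformal_hessian (exp_quadratic x0 s p X) x0 = log_conformal_hessian s p X"
proof -
  note d = exp_quadratic_derivatives[OF sym, of x0 s p x0]
  let ?n = "real CARD('n)"
  define k where "k = ?n - 2"
  have k: "k > 0" "?n = k + 2" using n by (auto simp: k_def)
  define e where "e = exp (- 4 * s / k)"
  have u: "exp_quadratic x0 s p X x0 = exp s" by (simp add: exp_quadratic_def)
  have g: "grad (exp_quadratic x0 s p X) x0 = exp s *\<^sub>R p" using d(2) by (simp add: u)
  have h: "hessian (exp_quadratic x0 s p X) x0 = exp s *\<^sub>R ((\<chi> i j. p $ i * p $ j) + X)" using d(4) by (simp add: u)
  have e1: "exp s powr (- ((?n + 2) / (?n - 2))) * exp s = e"
  proof -
    have "- ((?n + 2) / (?n - 2)) * s + s = - 4 * s / k" using k by (simp add: field_simps)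
    then show ?thesis by (simp add: powr_def e_def exp_add[symmetric] del: exp_add)
  qed
  have e2: "exp s powr (- (2 * ?n / (?n - 2))) * (exp s * exp s) = e"
  proof -
    have "- (2 * ?n / (?n - 2)) * s + (s + s) = - 4 * s / k" using k by (simp add: field_simps)
    then show ?thesis by (simp add: powr_def e_def exp_add[symmetric] del: exp_add)
  qed
  have e3: "exp (- 2 * (2 / (?n - 2)) * s) = e" using k by (simp add: e_def)
  have ng: "(norm (exp s *\<^sub>R p))\<^sup>2 = exp s * exp s * (norm p)\<^sup>2" by (simp add: power2_eq_square)
  have "conformal_hessian (exp_quadratic x0 s p X) x0 $ i $ j = log_conformal_hessian s p X $ i $ j" for i j
  proof -
    let ?P = "p $ i * p $ j" and ?I = "(mat 1 :: real ^ 'n ^ 'n) $ i $ j"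
    let ?A = "exp s powr (- ((?n + 2) / (?n - 2)))" and ?B = "exp s powr (- (2 * ?n / (?n - 2)))"
    have "conformal_hessian (exp_quadratic x0 s p X) x0 $ i $ j =
      (- (2 / k) * ?A) * (exp s * (?P + X $ i $ j)) + (2 * ?n / k\<^sup>2 * ?B) * ((exp s * p $ i) * (exp s * p $ j))
      - (2 / k\<^sup>2 * ?B * (exp s * exp s * (norm p)\<^sup>2)) * ?I"
      unfolding conformal_hessian_def Let_def g h u ng k_def
      by (simp only: vector_add_component vector_minus_component vector_scaleR_component vec_lambda_beta real_scaleR_def)
    also have "\<dots> = - (2 / k) * (?A * exp s) * (?P + X $ i $ j) + 2 * (k + 2) / k\<^sup>2 * (?B * (exp s * exp s)) * ?P
      - 2 / k\<^sup>2 * (?B * (exp s * exp s)) * (norm p)\<^sup>2 * ?I"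
      unfolding k(2)[symmetric] by (simp only: mult_ac)
    also have "\<dots> = e * (- (2 / k) * X $ i $ j + (2 / k)\<^sup>2 * ?P - (2 / k)\<^sup>2 / 2 * (norm p)\<^sup>2 * ?I)"
      unfolding e1 e2 using k(1) by (intro conformal_coefficients) simp
    also have "\<dots> = log_conformal_hessian s p X $ i $ j"
      unfolding log_conformal_hessian_def Let_def e3 unfolding k_def
      by (simp only: vector_add_component vector_minus_component vector_scaleR_component vec_lambda_beta real_scaleR_def)
    finally show ?thesis .
  qed
  then show ?thesis by (simp add: vec_eq_iff)
qed

text \<open>The derivative of a gradient at an isolated point of differentiability is not known to
  be symmetric. Only its quadratic form enters the expansions, and test functions are built from a
  symmetric matrix.\<close>

lemma bounded_linear_symmetric_part:
  fixes D :: "real ^ 'n \<Rightarrow> real ^ 'n"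
  assumes "bounded_linear D"
  obtains X where "transpose X = X" "\<And>h. (X *v h) \<bullet> h = D h \<bullet> h"
proof
  let ?A = "matrix D"
  let ?X = "(1/2) *\<^sub>R (?A + transpose ?A)"
  show "transpose ?X = ?X" by (simp add: transpose_def vec_eq_iff add.commute)
  fix h
  have A: "?A *v h = D h" using assms by (simp add: bounded_linear.linear matrix_works)
  have "(transpose ?A *v h) \<bullet> h = (?A *v h) \<bullet> h"
    by (metis dot_lmul_matrix inner_commute transpose_matrix_vector)
  moreover have "?X *v h = (1/2) *\<^sub>R (?A *v h + transpose ?A *v h)"
    by (simp add: matrix_vector_mult_add_rdistrib scaleR_add_right flip: scaleR_matrix_vector_assoc)
  ultimately show "(?X *v h) \<bullet> h = D h \<bullet> h" by (simp add: inner_add_left A)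
qed

lemma lipschitz_has_derivative_bound:
  fixes G :: "'a::real_normed_vector \<Rightarrow> 'b::real_normed_vector"
  assumes lip: "L-lipschitz_on S G" and S: "open S" "x \<in> S" and D: "(G has_derivative D) (at x)"
  shows "norm (D h) \<le> L * norm h"
proof -
  have bl: "bounded_linear D" using D by (rule has_derivative_bounded_linear)
  show ?thesis
  proof (rule field_le_epsilon)
    fix \<epsilon> :: real assume \<epsilon>: "\<epsilon> > 0"
    define e where "e = \<epsilon> / (norm h + 1)"
    have e: "e > 0" "e * norm h \<le> \<epsilon>"
    proof -
      show "e > 0" using \<epsilon> by (simp add: e_def add_nonneg_pos)
      have "e * norm h = \<epsilon> * (norm h / (norm h + 1))" by (simp add: e_def)
      also have "\<dots> \<le> \<epsilon> * 1" using \<epsilon> by (intro mult_left_mono) (auto simp: divide_le_eq add_nonneg_pos)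
      finally show "e * norm h \<le> \<epsilon>" by simp
    qed
    obtain d where d: "d > 0" "\<And>y. norm (y - x) < d \<Longrightarrow> norm (G y - G x - D (y - x)) \<le> e * norm (y - x)"
      using D e(1) unfolding has_derivative_at_alt by blast
    obtain r where r: "r > 0" "ball x r \<subseteq> S" using S openE by blast
    define t where "t = min d r / (2 * (norm h + 1))"
    have t: "t > 0" using d(1) r(1) by (simp add: t_def add_nonneg_pos)
    have "t * norm h < min d r"
    proof -
      have "t * norm h = min d r * (norm h / (2 * (norm h + 1)))" by (simp add: t_def)
      also have "\<dots> < min d r * 1" using d(1) r(1) by (intro mult_strict_left_mono) (auto simp: divide_less_eq add_nonneg_pos)
      finally show ?thesis by simp
    qed
    then have th: "norm (t *\<^sub>R h) < d" "norm (t *\<^sub>R h) < r" using t by auto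
    then have "x + t *\<^sub>R h \<in> S" using r(2) by (auto simp: dist_norm)
    then have 1: "norm (G (x + t *\<^sub>R h) - G x) \<le> L * (t * norm h)"
      using lipschitz_onD[OF lip, of "x + t *\<^sub>R h" x] S(2) t by (simp add: dist_norm)
    have "norm (G (x + t *\<^sub>R h) - G x - D (t *\<^sub>R h)) \<le> e * norm (t *\<^sub>R h)"
      using d(2)[of "x + t *\<^sub>R h"] th by simp
    then have 2: "norm (G (x + t *\<^sub>R h) - G x - D (t *\<^sub>R h)) \<le> e * (t * norm h)" using t by simp
    have "t * norm (D h) = norm (D (t *\<^sub>R h))" using bl t by (simp add: linear_simps)
    also have "\<dots> \<le> norm (G (x + t *\<^sub>R h) - G x) + norm (G (x + t *\<^sub>R h) - G x - D (t *\<^sub>R h))"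
      using norm_triangle_ineq4[of "G (x + t *\<^sub>R h) - G x" "G (x + t *\<^sub>R h) - G x - D (t *\<^sub>R h)"] by simp
    also have "\<dots> \<le> t * (L * norm h + e * norm h)" using 1 2 by (simp add: algebra_simps)
    finally have "norm (D h) \<le> L * norm h + e * norm h" using t by simp
    then show "norm (D h) \<le> L * norm h + \<epsilon>" using e(2) by linarith
  qed
qed

section \<open>Interior balls\<close>

lemma has_derivative_grad:
  fixes u :: "real ^ 'n \<Rightarrow> real"
  assumes "u differentiable (at x)"
  shows "(u has_derivative (\<lambda>h. grad u x \<bullet> h)) (at x)"
proof -
  let ?D = "frechet_derivative u (at x)"
  have D: "(u has_derivative ?D) (at x)" using assms by (simp add: frechet_derivative_works)
  then have lin: "linear ?D" using has_derivative_linear by blast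
  have "?D h = grad u x \<bullet> h" for h
  proof -
    have "h = (\<Sum>i\<in>UNIV. h $ i *\<^sub>R axis i 1)"
      by (simp add: vec_eq_iff axis_def if_distrib cong: if_cong)
    then have "?D h = ?D (\<Sum>i\<in>UNIV. h $ i *\<^sub>R axis i 1)" by simp
    also have "\<dots> = (\<Sum>i\<in>UNIV. h $ i * ?D (axis i 1))"
      using lin by (simp add: linear_sum linear_scale)
    also have "\<dots> = grad u x \<bullet> h" by (simp add: grad_def inner_vec_def mult.commute)
    finally show ?thesis .
  qed
  then show ?thesis using D by (metis (no_types, lifting) ext)
qed

text \<open>Writing d = x - xh, membership in the ball means \<nu> \<bullet> d \<le> - |d|^2 / (2
  R). For small \<open>R\<close> this linear term of the defining function dominates its quadratic
  remainder M |d|^2, so the function is negative at \<open>x\<close>.\<close>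

lemma interior_ball:
  fixes \<Omega> :: "(real ^ 'n) set"
  assumes xh: "xh \<in> frontier \<Omega>" and \<nu>: "outward_unit_normal \<Omega> xh \<nu>"
  obtains R where "R > 0" "norm \<nu> = 1" "cball (xh - R *\<^sub>R \<nu>) R - {xh} \<subseteq> \<Omega>"
proof -
  obtain U \<rho> where "C2_defining_function \<Omega> xh U \<rho>" and \<nu>eq: "\<nu> = grad \<rho> xh /\<^sub>R norm (grad \<rho> xh)"
    using \<nu> unfolding outward_unit_normal_def by blast
  then have U: "open U" "xh \<in> U" and C2: "C2_on U \<rho>" and \<Omega>U: "\<Omega> \<inter> U = {x \<in> U. \<rho> x < 0}"
    and fr: "frontier \<Omega> \<inter> U = {x \<in> U. \<rho> x = 0}" and nz: "\<forall>x \<in> frontier \<Omega> \<inter> U. grad \<rho> x \<noteq> 0"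
    unfolding C2_defining_function_def by auto
  have \<rho>0: "\<rho> xh = 0" using fr xh U(2) by blast
  define g where "g = norm (grad \<rho> xh)"
  have g: "g > 0" using nz xh U(2) by (simp add: g_def)
  have \<nu>g: "grad \<rho> xh = g *\<^sub>R \<nu>" "norm \<nu> = 1" using g by (auto simp: \<nu>eq g_def)
  obtain r where r: "r > 0" "ball xh r \<subseteq> U" "\<And>y. y \<in> ball xh r \<Longrightarrow> norm (hessian \<rho> y) \<le> norm (hessian \<rho> xh) + 1"
  proof -
    have "continuous (at xh) (hessian \<rho>)"
      using C2 U unfolding C2_on_def by (simp add: continuous_on_eq_continuous_at)
    then obtain d where d: "d > 0" "\<And>y. dist y xh < d \<Longrightarrow> dist (hessian \<rho> y) (hessian \<rho> xh) < 1"
      unfolding continuous_at_eps_delta using zero_less_one by blast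
    obtain d' where d': "d' > 0" "ball xh d' \<subseteq> U" using U openE by blast
    show thesis
    proof (rule that[of "min d d'"])
      fix y assume "y \<in> ball xh (min d d')"
      then have "norm (hessian \<rho> y - hessian \<rho> xh) < 1" using d(2)[of y] by (auto simp: dist_norm norm_minus_commute)
      then show "norm (hessian \<rho> y) \<le> norm (hessian \<rho> xh) + 1"
        using norm_triangle_ineq2[of "hessian \<rho> y" "hessian \<rho> xh"] by linarith
    qed (use d d' in auto)
  qed
  define M where "M = real CARD('n) * real CARD('n) * (norm (hessian \<rho> xh) + 1)"
  have M: "M > 0" by (simp add: M_def add_nonneg_pos)
  have lip: "norm (grad \<rho> y - grad \<rho> xh) \<le> M * norm (y - xh)" if "y \<in> ball xh r" for y
  proof (rule differentiable_bound[where S = "ball xh r"])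
    fix w assume w: "w \<in> ball xh r"
    then have "grad \<rho> differentiable (at w)" using C2 r(2) unfolding C2_on_def by blast
    then have "(grad \<rho> has_derivative (\<lambda>h. hessian \<rho> w *v h)) (at w)"
      unfolding hessian_def by (simp add: jacobian_works)
    then show "(grad \<rho> has_derivative (*v) (hessian \<rho> w)) (at w within ball xh r)"
      by (auto intro: has_derivative_at_withinI)
    show "onorm ((*v) (hessian \<rho> w)) \<le> M"
      unfolding M_def
    proof (rule onorm_le_matrix_component)
      fix i j
      have "\<bar>hessian \<rho> w $ i $ j\<bar> \<le> norm (hessian \<rho> w $ i)" by (rule component_le_norm_cart)
      also have "\<dots> \<le> norm (hessian \<rho> w)" by (rule Finite_Cartesian_Product.norm_nth_le)
      finally show "\<bar>hessian \<rho> w $ i $ j\<bar> \<le> norm (hessian \<rho> xh) + 1" using r(3)[OF w] by linarith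
    qed
  qed (use that r(1) in auto)
  have d\<rho>: "(\<rho> has_derivative (\<lambda>h. grad \<rho> y \<bullet> h)) (at y)" if "y \<in> ball xh r" for y
    using C2 r(2) that unfolding C2_on_def by (intro has_derivative_grad) blast
  \<comment> \<open>The first entry makes g / (2 R) exceed \<open>M\<close>; the second keeps the
    whole ball inside the neighbourhood where the expansion holds.\<close>
  define R where "R = min (g / (4 * M)) (r / 4)"
  have R: "R > 0" "2 * R < r" using g M r(1) by (auto simp: R_def)
  have RM: "M < g / (2 * R)"
  proof -
    have "R \<le> g / (4 * M)" unfolding R_def by (rule min.cobounded1)
    then have "4 * M * R \<le> g" using M by (simp add: field_simps)
    then have "2 * M * R < g" using M R(1) mult_pos_pos[of M R] by linarith
    then show ?thesis using R(1) by (simp add: field_simps)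
  qed
  show thesis
  proof (rule that[OF R(1) \<nu>g(2)], rule subsetI)
    fix x assume x: "x \<in> cball (xh - R *\<^sub>R \<nu>) R - {xh}"
    define d where "d = x - xh"
    have d0: "d \<noteq> 0" using x by (simp add: d_def)
    have nd: "norm (d + R *\<^sub>R \<nu>) \<le> R" using x by (simp add: d_def dist_norm norm_minus_commute algebra_simps)
    have "(norm (d + R *\<^sub>R \<nu>))\<^sup>2 \<le> R\<^sup>2" using nd by (intro power_mono) auto
    then have "(norm d)\<^sup>2 + 2 * R * (\<nu> \<bullet> d) \<le> 0"
      using \<nu>g(2) by (simp add: norm_add_power2 inner_commute power_mult_distrib)
    then have \<nu>d: "\<nu> \<bullet> d \<le> - (norm d)\<^sup>2 / (2 * R)" using R(1) by (simp add: field_simps)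
    have "norm d \<le> norm (d + R *\<^sub>R \<nu>) + norm (R *\<^sub>R \<nu>)" using norm_triangle_ineq4[of "d + R *\<^sub>R \<nu>" "R *\<^sub>R \<nu>"] by simp
    also have "\<dots> \<le> 2 * R" using nd R(1) \<nu>g(2) by simp
    finally have xb: "x \<in> ball xh r" using R(2) by (simp add: d_def dist_norm norm_minus_commute)
    have "\<bar>\<rho> x - \<rho> xh - grad \<rho> xh \<bullet> (x - xh)\<bar> \<le> M * (norm (x - xh))\<^sup>2"
      using xb r(1) lip d\<rho> M by (intro gradient_lipschitz_at_expansion[where S = "ball xh r"]) auto
    then have "\<rho> x \<le> g * (\<nu> \<bullet> d) + M * (norm d)\<^sup>2" unfolding \<rho>0 \<nu>g(1) d_def[symmetric] by simp
    also have "\<dots> \<le> g * (- (norm d)\<^sup>2 / (2 * R)) + M * (norm d)\<^sup>2" using \<nu>d g by (intro add_right_mono mult_left_mono) auto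
    also have "\<dots> = (M - g / (2 * R)) * (norm d)\<^sup>2" by (simp add: algebra_simps)
    also have "\<dots> < 0" using RM d0 by (intro mult_neg_pos) auto
    finally show "x \<in> \<Omega>" using \<Omega>U xb r(2) by blast
  qed
qed

section \<open>The barrier\<close>

definition barrier :: "real \<Rightarrow> real \<Rightarrow> 'a::euclidean_space \<Rightarrow> 'a \<Rightarrow> real" where
  "barrier \<alpha> R y x = exp (- \<alpha> * (norm (x - y))\<^sup>2) - exp (- \<alpha> * R\<^sup>2)"

definition barrier_grad :: "real \<Rightarrow> 'a::euclidean_space \<Rightarrow> 'a \<Rightarrow> 'a" where
  "barrier_grad \<alpha> y x = (- 2 * \<alpha> * exp (- \<alpha> * (norm (x - y))\<^sup>2)) *\<^sub>R (x - y)"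

definition barrier_hess :: "real \<Rightarrow> 'a::euclidean_space \<Rightarrow> 'a \<Rightarrow> 'a \<Rightarrow> 'a" where
  "barrier_hess \<alpha> y x h = exp (- \<alpha> * (norm (x - y))\<^sup>2) *\<^sub>R ((4 * \<alpha>\<^sup>2 * ((x - y) \<bullet> h)) *\<^sub>R (x - y) - (2 * \<alpha>) *\<^sub>R h)"

lemma has_derivative_exp_norm_power2:
  fixes x y :: "'a::euclidean_space"
  shows "((\<lambda>x. exp (- \<alpha> * (norm (x - y))\<^sup>2)) has_derivative
    (\<lambda>h. exp (- \<alpha> * (norm (x - y))\<^sup>2) * (- 2 * \<alpha> * ((x - y) \<bullet> h)))) (at x)"
proof -
  have "((\<lambda>x. - \<alpha> * ((x - y) \<bullet> (x - y))) has_derivative (\<lambda>h. - \<alpha> * ((x - y) \<bullet> h + h \<bullet> (x - y)))) (at x)"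
    by (auto intro!: derivative_eq_intros)
  then have "((\<lambda>x. - \<alpha> * (norm (x - y))\<^sup>2) has_derivative (\<lambda>h. - 2 * \<alpha> * ((x - y) \<bullet> h))) (at x)"
    unfolding power2_norm_eq_inner
    by (rule has_derivative_eq_rhs) (rule ext, simp add: inner_commute)
  from has_derivative_exp[OF this] show ?thesis by (simp only: mult.commute)
qed

lemma has_derivative_barrier:
  "(barrier \<alpha> R y has_derivative (\<lambda>h. barrier_grad \<alpha> y x \<bullet> h)) (at x)"
proof -
  have "((\<lambda>x. exp (- \<alpha> * (norm (x - y))\<^sup>2) - exp (- \<alpha> * R\<^sup>2)) has_derivative
    (\<lambda>h. exp (- \<alpha> * (norm (x - y))\<^sup>2) * (- 2 * \<alpha> * ((x - y) \<bullet> h)) - 0)) (at x)"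
    by (intro has_derivative_diff has_derivative_exp_norm_power2 has_derivative_const)
  then show ?thesis
    unfolding barrier_def[abs_def]
    by (rule has_derivative_eq_rhs) (rule ext, simp add: barrier_grad_def)
qed

lemma has_derivative_barrier_grad:
  "(barrier_grad \<alpha> y has_derivative barrier_hess \<alpha> y x) (at x)"
proof -
  let ?E = "exp (- \<alpha> * (norm (x - y))\<^sup>2)"
  have 1: "((\<lambda>x. - 2 * \<alpha> * exp (- \<alpha> * (norm (x - y))\<^sup>2)) has_derivative
    (\<lambda>h. - 2 * \<alpha> * (?E * (- 2 * \<alpha> * ((x - y) \<bullet> h))))) (at x)"
    by (intro has_derivative_mult_right has_derivative_exp_norm_power2)
  have 2: "((\<lambda>x. x - y) has_derivative (\<lambda>h. h)) (at x)" by (auto intro!: derivative_eq_intros)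
  show ?thesis
    unfolding barrier_grad_def[abs_def]
  proof (rule has_derivative_eq_rhs[OF has_derivative_scaleR[OF 1 2]], rule ext)
    fix h
    show "(- 2 * \<alpha> * ?E) *\<^sub>R h + (- 2 * \<alpha> * (?E * (- 2 * \<alpha> * ((x - y) \<bullet> h)))) *\<^sub>R (x - y) = barrier_hess \<alpha> y x h"
      unfolding barrier_hess_def scaleR_diff_right scaleR_scaleR
      by (simp add: power2_eq_square mult_ac)
  qed
qed

lemma barrier_hess_inner:
  "barrier_hess \<alpha> y x h \<bullet> h =
    exp (- \<alpha> * (norm (x - y))\<^sup>2) * (4 * \<alpha>\<^sup>2 * ((x - y) \<bullet> h)\<^sup>2 - 2 * \<alpha> * (h \<bullet> h))"
  by (simp add: barrier_hess_def inner_diff_left power2_eq_square)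

lemma norm_barrier_hess_le:
  assumes "\<alpha> \<ge> 0" "norm (x - y) \<le> R"
  shows "norm (barrier_hess \<alpha> y x h) \<le> (4 * \<alpha>\<^sup>2 * R\<^sup>2 + 2 * \<alpha>) * norm h"
proof -
  let ?E = "exp (- \<alpha> * (norm (x - y))\<^sup>2)"
  have E: "?E \<le> 1" using assms(1) by simp
  let ?v = "(4 * \<alpha>\<^sup>2 * ((x - y) \<bullet> h)) *\<^sub>R (x - y) - (2 * \<alpha>) *\<^sub>R h"
  have 1: "norm ?v \<le> norm ((4 * \<alpha>\<^sup>2 * ((x - y) \<bullet> h)) *\<^sub>R (x - y)) + norm ((2 * \<alpha>) *\<^sub>R h)"
    by (rule norm_triangle_ineq4)
  have 2: "norm ((4 * \<alpha>\<^sup>2 * ((x - y) \<bullet> h)) *\<^sub>R (x - y)) = 4 * \<alpha>\<^sup>2 * (\<bar>(x - y) \<bullet> h\<bar> * norm (x - y))"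
    by (simp add: abs_mult)
  have 3: "\<bar>(x - y) \<bullet> h\<bar> * norm (x - y) \<le> (R * norm h) * R"
  proof (intro mult_mono)
    have "\<bar>(x - y) \<bullet> h\<bar> \<le> norm (x - y) * norm h" by (rule Cauchy_Schwarz_ineq2)
    also have "\<dots> \<le> R * norm h" using assms(2) by (intro mult_right_mono) auto
    finally show "\<bar>(x - y) \<bullet> h\<bar> \<le> R * norm h" .
    show "0 \<le> R * norm h" using order_trans[OF norm_ge_zero assms(2)] by simp
  qed (use assms in auto)
  have 4: "norm ((2 * \<alpha>) *\<^sub>R h) = 2 * \<alpha> * norm h" using assms(1) by simp
  have "4 * \<alpha>\<^sup>2 * (\<bar>(x - y) \<bullet> h\<bar> * norm (x - y)) \<le> 4 * \<alpha>\<^sup>2 * ((R * norm h) * R)"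
    using 3 by (intro mult_left_mono) auto
  then have "norm ?v \<le> 4 * \<alpha>\<^sup>2 * ((R * norm h) * R) + 2 * \<alpha> * norm h" using 1 2 4 by linarith
  also have "\<dots> = (4 * \<alpha>\<^sup>2 * R\<^sup>2 + 2 * \<alpha>) * norm h" by (simp add: power2_eq_square distrib_right)
  finally have v: "norm ?v \<le> (4 * \<alpha>\<^sup>2 * R\<^sup>2 + 2 * \<alpha>) * norm h" .
  have "norm (barrier_hess \<alpha> y x h) = ?E * norm ?v" by (simp add: barrier_hess_def)
  also have "\<dots> \<le> 1 * norm ?v" using E by (intro mult_right_mono) auto
  finally show ?thesis using v by simp
qed

text \<open>If \<open>g - v - \<epsilon> barrier\<close> is negative somewhere, its minimum lies in the interior of the region, and
  there a vertical translate of \<open>v + \<epsilon> barrier\<close> touches \<open>g\<close> from below.\<close>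

lemma barrier_below_or_contact:
  fixes g v :: "'a::euclidean_space \<Rightarrow> real" and G :: "'a \<Rightarrow> 'a"
  assumes R: "R > 0" and \<alpha>: "\<alpha> > 0" and r: "r > 0"
    and xh: "dist y0 xh = R" and \<Omega>: "cball y0 R - {xh} \<subseteq> \<Omega>" "xh \<notin> \<Omega>" "open \<Omega>"
    and lsc: "lsc_on (cball y0 R \<inter> cball xh r) g" and contv: "continuous_on (cball y0 R \<inter> cball xh r) v"
    and dv: "\<And>x. x \<in> \<Omega> \<Longrightarrow> (v has_derivative (\<lambda>h. G x \<bullet> h)) (at x)"
    and lip: "L-lipschitz_on (\<Omega> \<inter> cball xh r) G"
    and less: "\<And>x. x \<in> cball y0 R \<inter> cball xh r \<Longrightarrow> x \<noteq> xh \<Longrightarrow> v x < g x" and eq: "g xh = v xh"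
  shows "\<exists>\<epsilon>1>0. \<forall>\<epsilon>. 0 < \<epsilon> \<and> \<epsilon> \<le> \<epsilon>1 \<longrightarrow>
    (\<forall>x\<in>cball y0 R \<inter> cball xh r. v x + \<epsilon> * barrier \<alpha> R y0 x \<le> g x) \<or>
    (\<forall>\<eta>>0. \<exists>x z p D. x \<in> ball y0 R \<inter> ball xh r \<and> z \<in> ball y0 R \<inter> ball xh r \<and>
       (G has_derivative D) (at x) \<and> norm (p - (G x + \<epsilon> *\<^sub>R barrier_grad \<alpha> y0 x)) \<le> \<eta> \<and>
       \<bar>g z - v x\<bar> \<le> \<epsilon> * exp (- \<alpha> * (norm (x - y0))\<^sup>2) + \<eta> \<and>
       (\<forall>\<^sub>F h in nhds 0. g z + p \<bullet> h + (D h + \<epsilon> *\<^sub>R barrier_hess \<alpha> y0 x h) \<bullet> h / 2 - \<eta> * (norm h)\<^sup>2 \<le> g (z + h)))"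
proof -
  define K where "K = cball y0 R \<inter> cball xh r"
  let ?b = "barrier \<alpha> R y0"
  have cK: "compact K" unfolding K_def by (intro compact_Int_closed compact_cball closed_cball)
  have xhK: "xh \<in> K" using xh r by (simp add: K_def)
  have K\<Omega>: "x \<in> \<Omega>" if "x \<in> K" "x \<noteq> xh" for x using that \<Omega>(1) by (auto simp: K_def)
  have contb: "continuous_on S ?b" for S
    using has_derivative_barrier by (meson continuous_at_imp_continuous_on has_derivative_continuous)
  have lscK: "lsc_on K g" using lsc by (simp add: K_def)
  have lscD: "lsc_on K (\<lambda>x. g x + (- v x - \<epsilon> * ?b x))" for \<epsilon>
    using contv by (intro lsc_on_add lscK continuous_on_imp_lsc_on continuous_intros contb) (simp add: K_def)
  have b_le: "?b x \<le> 1" for x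
  proof -
    have "exp (- \<alpha> * (norm (x - y0))\<^sup>2) \<le> 1" using \<alpha> by simp
    then show ?thesis using exp_gt_zero[of "- \<alpha> * R\<^sup>2"] by (simp only: barrier_def)
  qed
  \<comment> \<open>On the part of the boundary at distance \<open>r\<close> from \<open>xh\<close>
    the strict inequality has a uniform gap by compactness. Since the barrier is at most 1, taking
    \<epsilon> at most half of this gap excludes a negative minimum there.\<close>
  obtain c0 where c0: "c0 > 0" "\<And>x. x \<in> K \<Longrightarrow> dist xh x = r \<Longrightarrow> c0 \<le> g x - v x"
  proof (cases "K \<inter> sphere xh r = {}")
    case True
    then show ?thesis by (intro that[of 1]) auto
  next
    case False
    have "compact (K \<inter> sphere xh r)" using cK by (intro compact_Int_closed) auto
    moreover have "lsc_on (K \<inter> sphere xh r) (\<lambda>x. g x + (- v x - 0 * ?b x))"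
      by (rule lsc_on_subset[OF lscD]) auto
    ultimately obtain x where x: "x \<in> K \<inter> sphere xh r"
      "\<And>y. y \<in> K \<inter> sphere xh r \<Longrightarrow> g x + (- v x - 0 * ?b x) \<le> g y + (- v y - 0 * ?b y)"
      using lsc_attains_inf[OF _ False] by blast
    have "v x < g x" using less[of x] x(1) r by (auto simp: K_def)
    then show ?thesis using x(2) by (intro that[of "g x - v x"]) auto
  qed
  show ?thesis
  proof (intro exI[of _ "c0 / 2"] conjI allI impI)
    show "c0 / 2 > 0" using c0 by simp
    fix \<epsilon> assume \<epsilon>: "0 < \<epsilon> \<and> \<epsilon> \<le> c0 / 2"
    let ?below = "\<forall>x\<in>cball y0 R \<inter> cball xh r. v x + \<epsilon> * ?b x \<le> g x"
    let ?jet = "\<lambda>\<eta> x z p D. x \<in> ball y0 R \<inter> ball xh r \<and> z \<in> ball y0 R \<inter> ball xh r \<and>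
       (G has_derivative D) (at x) \<and> norm (p - (G x + \<epsilon> *\<^sub>R barrier_grad \<alpha> y0 x)) \<le> \<eta> \<and>
       \<bar>g z - v x\<bar> \<le> \<epsilon> * exp (- \<alpha> * (norm (x - y0))\<^sup>2) + \<eta> \<and>
       (\<forall>\<^sub>F h in nhds 0. g z + p \<bullet> h + (D h + \<epsilon> *\<^sub>R barrier_hess \<alpha> y0 x h) \<bullet> h / 2 - \<eta> * (norm h)\<^sup>2 \<le> g (z + h))"
    have "\<exists>x z p D. ?jet \<eta> x z p D" if nb: "\<not> ?below" and \<eta>: "\<eta> > 0" for \<eta>
    proof -
      define d where "d = (\<lambda>x. g x + (- v x - \<epsilon> * ?b x))"
      have "K \<noteq> {}" using xhK by auto
      then obtain x0 where x0: "x0 \<in> K" "\<And>y. y \<in> K \<Longrightarrow> d x0 \<le> d y"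
        using lsc_attains_inf[OF cK _ lscD] unfolding d_def by blast
      obtain x1 where x1: "x1 \<in> K" "g x1 < v x1 + \<epsilon> * ?b x1" using nb by (auto simp: K_def not_le)
      have dneg: "d x0 < 0" using x0(2)[OF x1(1)] x1(2) by (simp add: d_def)
      have b0: "?b x = 0" if "norm (x - y0) = R" for x using that by (simp add: barrier_def)
      have "norm (xh - y0) = R" using xh by (simp add: dist_norm norm_minus_commute)
      then have "d xh = 0" using b0 eq by (simp add: d_def)
      then have "x0 \<noteq> xh" using dneg by auto
      then have pos: "v x0 < g x0" using less x0(1) by (simp add: K_def)
      \<comment> \<open>On the sphere of radius \<open>R\<close> the barrier vanishes, so the
        difference is just g - v there, which cannot be negative.\<close>
      have "norm (x0 - y0) \<noteq> R"
      proof
        assume "norm (x0 - y0) = R"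
        then show False using b0[of x0] dneg pos by (simp add: d_def)
      qed
      moreover have "norm (x0 - y0) \<le> R" using x0(1) by (simp add: K_def dist_norm norm_minus_commute)
      ultimately have x0R: "x0 \<in> ball y0 R" by (simp add: dist_norm norm_minus_commute)
      have "dist xh x0 \<noteq> r"
      proof
        assume "dist xh x0 = r"
        then have "c0 \<le> g x0 - v x0" using c0 x0(1) by blast
        moreover have "\<epsilon> * ?b x0 \<le> \<epsilon> * 1" using \<epsilon> b_le by (intro mult_left_mono) auto
        ultimately show False using dneg \<epsilon> c0(1) unfolding d_def by linarith
      qed
      moreover have "dist xh x0 \<le> r" using x0(1) by (simp add: K_def)
      ultimately have x0r: "x0 \<in> ball xh r" by simp
      let ?O = "ball y0 R \<inter> ball xh r"
      have "open ?O" "x0 \<in> ?O" using x0R x0r by auto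
      then obtain s where s: "s > 0" "cball x0 s \<subseteq> ?O" using open_contains_cball by blast
      have OK: "?O \<subseteq> K" by (auto simp: K_def)
      have O\<Omega>: "?O \<subseteq> \<Omega>" using \<Omega>(1) xh by fastforce
      \<comment> \<open>The depth of the negative minimum, and hence the amount by which
        \<open>v + \<epsilon> * ?b\<close> is lowered to touch \<open>g\<close> at
        \<open>x0\<close>.\<close>
      define m where "m = - d x0"
      define W where "W = (\<lambda>x. v x + \<epsilon> * ?b x - m)"
      let ?GW = "\<lambda>x. G x + \<epsilon> *\<^sub>R barrier_grad \<alpha> y0 x"
      have Wle: "W x \<le> g x" if "x \<in> cball x0 s" for x
      proof -
        have "x \<in> K" using that s OK by blast
        from x0(2)[OF this] show ?thesis unfolding W_def m_def d_def by linarith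
      qed
      have Weq: "g x0 = W x0" unfolding W_def m_def d_def by linarith
      have dW: "(W has_derivative (\<lambda>h. ?GW x \<bullet> h)) (at x)" if "x \<in> cball x0 s" for x
      proof -
        have "x \<in> \<Omega>" using that s O\<Omega> by blast
        then have "(W has_derivative (\<lambda>h. G x \<bullet> h + \<epsilon> * (barrier_grad \<alpha> y0 x \<bullet> h) - 0)) (at x)"
          unfolding W_def by (intro has_derivative_diff has_derivative_add dv has_derivative_mult_right has_derivative_barrier has_derivative_const)
        then show ?thesis by (simp add: inner_add_left)
      qed
      have lipW: "(L + \<bar>\<epsilon>\<bar> * (4 * \<alpha>\<^sup>2 * R\<^sup>2 + 2 * \<alpha>))-lipschitz_on (cball x0 s) ?GW"
      proof (rule lipschitz_on_add)
        have "cball x0 s \<subseteq> \<Omega> \<inter> cball xh r" using s(2) O\<Omega> by force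
        then show "L-lipschitz_on (cball x0 s) G" by (rule lipschitz_on_subset[OF lip])
        have "(4 * \<alpha>\<^sup>2 * R\<^sup>2 + 2 * \<alpha>)-lipschitz_on (cball x0 s) (barrier_grad \<alpha> y0)"
        proof (rule bounded_derivative_imp_lipschitz)
          fix x assume x: "x \<in> cball x0 s"
          show "(barrier_grad \<alpha> y0 has_derivative barrier_hess \<alpha> y0 x) (at x within cball x0 s)"
            by (rule has_derivative_at_withinI[OF has_derivative_barrier_grad])
          have "norm (x - y0) \<le> R" using x s(2) by (force simp: dist_norm norm_minus_commute)
          then show "onorm (barrier_hess \<alpha> y0 x) \<le> 4 * \<alpha>\<^sup>2 * R\<^sup>2 + 2 * \<alpha>"
            using \<alpha> by (intro onorm_le norm_barrier_hess_le) auto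
        qed (use \<alpha> in auto)
        then show "(\<bar>\<epsilon>\<bar> * (4 * \<alpha>\<^sup>2 * R\<^sup>2 + 2 * \<alpha>))-lipschitz_on (cball x0 s) (\<lambda>x. \<epsilon> *\<^sub>R barrier_grad \<alpha> y0 x)"
          by (rule lipschitz_on_cmult)
      qed
      have "continuous (at x0) ?b" using has_derivative_barrier has_derivative_continuous by blast
      \<comment> \<open>The height estimate holds at \<open>x0\<close> while the jet sits at a
        nearby \<open>x\<close>. Continuity of the barrier transfers it with an error below \<eta> /
        4.\<close>
      then obtain t where t: "t > 0" "\<And>x. dist x x0 < t \<Longrightarrow> dist (?b x) (?b x0) < \<eta> / (4 * \<epsilon>)"
        unfolding continuous_at_eps_delta using \<eta> \<epsilon> by (metis divide_pos_pos mult_pos_pos zero_less_numeral)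
      define \<eta>' where "\<eta>' = min t (\<eta> / 4)"
      have \<eta>': "\<eta>' > 0" "\<eta>' \<le> \<eta> / 4" "\<eta>' \<le> t" using t \<eta> by (auto simp: \<eta>'_def)
      have lscs: "lsc_on (cball x0 s) g" using s(2) OK by (intro lsc_on_subset[OF lscK]) blast
      obtain x y p D where J: "x \<in> ball x0 s" "x \<in> ball x0 \<eta>'" "y \<in> ball x0 s" "y \<in> ball x0 \<eta>'"
        "(?GW has_derivative D) (at x)" "norm (p - ?GW x) \<le> \<eta>'" "\<bar>g y - W x\<bar> \<le> \<eta>'"
        "\<forall>\<^sub>F h in nhds 0. g y + p \<bullet> h + D h \<bullet> h / 2 - \<eta>' * (norm h)\<^sup>2 \<le> g (y + h)"
        by (rule perturbed_contact_point[OF s(1) lscs Wle Weq dW lipW \<eta>'(1)])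
      \<comment> \<open>Subtracting the barrier's second derivative, which exists everywhere,
        returns the differentiability of \<open>G\<close> itself at \<open>x\<close>.\<close>
      define D' where "D' = (\<lambda>h. D h - \<epsilon> *\<^sub>R barrier_hess \<alpha> y0 x h)"
      have "((\<lambda>x. ?GW x - \<epsilon> *\<^sub>R barrier_grad \<alpha> y0 x) has_derivative D') (at x)"
        unfolding D'_def by (intro has_derivative_diff J(5) has_derivative_scaleR_right has_derivative_barrier_grad)
      then have dG: "(G has_derivative D') (at x)" by simp
      have xy: "x \<in> ?O" "y \<in> ?O" using J(1,3) s(2) ball_subset_cball by blast+
      have val: "\<bar>g y - v x\<bar> \<le> \<epsilon> * exp (- \<alpha> * (norm (x - y0))\<^sup>2) + \<eta>"
      proof -
        have "dist (?b x) (?b x0) < \<eta> / (4 * \<epsilon>)" using t(2)[of x] J(2) \<eta>'(3) by (simp add: dist_commute)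
        then have bb: "\<epsilon> * \<bar>?b x - ?b x0\<bar> < \<eta> / 4" using \<epsilon> by (simp add: dist_real_def field_simps)
        have "?b x \<le> exp (- \<alpha> * (norm (x - y0))\<^sup>2)" by (simp add: barrier_def)
        then have be: "\<epsilon> * ?b x \<le> \<epsilon> * exp (- \<alpha> * (norm (x - y0))\<^sup>2)" using \<epsilon> by (intro mult_left_mono) auto
        have ee: "0 \<le> \<epsilon> * exp (- \<alpha> * (norm (x - y0))\<^sup>2)" using \<epsilon> by simp
        have "\<epsilon> * ?b x - \<epsilon> * ?b x0 \<le> \<epsilon> * \<bar>?b x - ?b x0\<bar>" "\<epsilon> * ?b x0 - \<epsilon> * ?b x \<le> \<epsilon> * \<bar>?b x - ?b x0\<bar>"
          unfolding right_diff_distrib[symmetric] using \<epsilon> by (auto intro!: mult_left_mono)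
        moreover have "m > 0" using dneg by (simp add: m_def)
        \<comment> \<open>As \<open>v\<close> is strictly below \<open>g\<close> at
          \<open>x0\<close>, the translation is smaller than the barrier term. This keeps the values
          at the two contact points within the order of that term.\<close>
        moreover have "m < \<epsilon> * ?b x0" using pos unfolding m_def d_def by linarith
        ultimately have "g y - v x \<le> \<epsilon> * exp (- \<alpha> * (norm (x - y0))\<^sup>2) + \<eta>"
          "- (g y - v x) \<le> \<epsilon> * exp (- \<alpha> * (norm (x - y0))\<^sup>2) + \<eta>"
          using J(7) \<eta>'(2) bb be ee unfolding W_def abs_le_iff by linarith+
        then show ?thesis by simp
      qed
      have np: "norm (p - ?GW x) \<le> \<eta>" using J(6) \<eta>' \<eta> by linarith
      have ev: "\<forall>\<^sub>F h in nhds 0. g y + p \<bullet> h + (D' h + \<epsilon> *\<^sub>R barrier_hess \<alpha> y0 x h) \<bullet> h / 2 - \<eta> * (norm h)\<^sup>2 \<le> g (y + h)"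
        using J(8)
      proof eventually_elim
        case (elim h)
        have "\<eta>' * (norm h)\<^sup>2 \<le> \<eta> * (norm h)\<^sup>2" using \<eta>' \<eta> by (intro mult_right_mono) auto
        moreover have "D' h + \<epsilon> *\<^sub>R barrier_hess \<alpha> y0 x h = D h" by (simp add: D'_def)
        ultimately show ?case using elim by simp
      qed
      show ?thesis using xy dG np val ev by blast
    qed
    then show "?below \<or> (\<forall>\<eta>>0. \<exists>x z p D. ?jet \<eta> x z p D)" by blast
  qed
qed

text \<open>\<open>touchV\<close> and \<open>touchG\<close> are what the viscosity inequalities say about jets touching \<open>v\<close> from above
  and \<open>g\<close> from below. With \<open>(g, v) = (ln u2, ln u1)\<close> they are the sub- and the super-solution property, with
  \<open>(g, v) = (- ln u1, - ln u2)\<close> the roles are exchanged; \<open>incompatible\<close> covers both. The bound \<open>c\<close> makes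
  room for truncating \<open>g\<close>.\<close>

lemma barrier_below:
  fixes f :: "real ^ 'n \<Rightarrow> real" and \<Gamma> \<Omega> :: "(real ^ 'n) set" and g v :: "real ^ 'n \<Rightarrow> real"
  assumes n: "CARD('n) \<ge> 3" and \<Gamma>: "open \<Gamma>" and cont: "continuous_on (closure \<Gamma>) f"
    and S1: "S1 f \<Gamma>" and S2: "S2 f \<Gamma>" and S3: "S3 f \<Gamma>" and S4: "S4 f \<Gamma>" and S5: "S5 f \<Gamma>"
    and \<Omega>: "open \<Omega>" "xh \<notin> \<Omega>" and R: "R > 0" and xh: "dist y0 xh = R" and ball: "cball y0 R - {xh} \<subseteq> \<Omega>"
    and lsc: "lsc_on (\<Omega> \<union> {xh}) g" and C11: "C11_on (\<Omega> \<union> {xh}) v"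
    and less: "\<And>x. x \<in> \<Omega> \<Longrightarrow> v x < g x \<or> c \<le> g x" and eq: "g xh = v xh" and c: "v xh + 3 \<le> c"
    and V: "\<And>x p X. \<lbrakk>x \<in> \<Omega>; transpose X = X; \<forall>\<^sub>F h in nhds 0. v (x + h) \<le> v x + p \<bullet> h + (X *v h) \<bullet> h / 2\<rbrakk> \<Longrightarrow> touchV (v x) p X"
    and G: "\<And>x p X. \<lbrakk>x \<in> \<Omega>; g x < c; transpose X = X; \<forall>\<^sub>F h in nhds 0. g x + p \<bullet> h + (X *v h) \<bullet> h / 2 \<le> g (x + h)\<rbrakk> \<Longrightarrow> touchG (g x) p X"
    and incompatible: "(touchV = sub_jet f \<Gamma> \<and> touchG = super_jet f \<Gamma>) \<or>
      (touchV = (\<lambda>s p X. super_jet f \<Gamma> (- s) (- p) (- X)) \<and> touchG = (\<lambda>s p X. sub_jet f \<Gamma> (- s) (- p) (- X)))"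
  obtains \<alpha> \<epsilon> r where "\<alpha> > 0" "\<epsilon> > 0" "r > 0"
    "\<And>x. x \<in> cball y0 R \<inter> cball xh r \<Longrightarrow> v x + \<epsilon> * barrier \<alpha> R y0 x \<le> g x"
proof -
  let ?E = "\<Omega> \<union> {xh}"
  obtain Gr where Gr: "\<And>x. x \<in> ?E \<Longrightarrow> (v has_derivative (\<lambda>h. Gr x \<bullet> h)) (at x within ?E)"
    and lipex: "\<And>x. x \<in> ?E \<Longrightarrow> \<exists>r>0. \<exists>L. L-lipschitz_on (?E \<inter> ball x r) Gr"
    using C11 unfolding C11_on_def by blast
  obtain r1 L where r1: "r1 > 0" and lip1: "L-lipschitz_on (?E \<inter> ball xh r1) Gr" using lipex[of xh] by auto
  have L: "L \<ge> 0" using lip1 lipschitz_on_nonneg by blast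
  have contE: "continuous_on ?E v"
    unfolding continuous_on_eq_continuous_within using Gr has_derivative_continuous by blast
  obtain r2 where r2: "r2 > 0" "\<And>x. x \<in> ?E \<Longrightarrow> dist x xh < r2 \<Longrightarrow> \<bar>v x - v xh\<bar> < 1"
  proof -
    have "\<exists>d>0. \<forall>x\<in>?E. dist x xh < d \<longrightarrow> \<bar>v x - v xh\<bar> < 1"
      using contE[unfolded continuous_on_iff dist_real_def, rule_format, of xh 1] by simp
    then show thesis using that by blast
  qed
  \<comment> \<open>Below \<open>r1\<close> the gradient is Lipschitz, below \<open>r2\<close> the
    values of \<open>v\<close> vary by less than 1, and the factor 1 / 2 with \<open>R\<close> keeps
    contact points at distance at least R / 2 from the centre, where the radial gain does not
    degenerate.\<close>
  define r where "r = min (min r1 r2) R / 2"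
  have r: "r > 0" "r < r1" "r < r2" "r \<le> R / 2" using r1 r2 R by (auto simp: r_def)
  have KE: "x \<in> ?E" if "x \<in> cball y0 R" for x using that ball by blast
  have dv: "(v has_derivative (\<lambda>h. Gr x \<bullet> h)) (at x)" if "x \<in> \<Omega>" for x
  proof -
    have "(v has_derivative (\<lambda>h. Gr x \<bullet> h)) (at x within \<Omega>)"
      by (rule has_derivative_subset[OF Gr]) (use that in auto)
    then show ?thesis unfolding at_within_open[OF that \<Omega>(1)] .
  qed
  have lip: "L-lipschitz_on (\<Omega> \<inter> cball xh r) Gr"
    by (rule lipschitz_on_subset[OF lip1]) (use r in auto)
  define B where "B = norm (Gr xh) + L * r"
  have B: "norm (Gr x) \<le> B" if "x \<in> \<Omega>" "dist xh x \<le> r" for x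
  proof -
    have "norm (Gr x - Gr xh) \<le> L * dist x xh"
      using lipschitz_onD[OF lip1, of x xh] that r(2) r1 by (simp add: dist_norm norm_minus_commute)
    also have "\<dots> \<le> L * r" using that L by (intro mult_left_mono) (auto simp: dist_commute)
    finally show ?thesis using norm_triangle_ineq2[of "Gr x" "Gr xh"] by (simp add: B_def)
  qed
  have B0: "B \<ge> 0" using L r by (simp add: B_def)
  \<comment> \<open>Room for values up to |v xh| + 2, slopes up to B + 1 and quadratic forms up to L
    + 1, all fixed before \<alpha> and \<epsilon>.\<close>
  define \<Lambda> where "\<Lambda> = \<bar>v xh\<bar> + B + L + 3"
  have \<Lambda>: "\<Lambda> > 0" using B0 L by (simp add: \<Lambda>_def)
  obtain \<alpha> \<epsilon>0 where \<alpha>: "1 \<le> \<alpha>" and \<epsilon>0: "0 < \<epsilon>0" and strict: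
    "\<And>\<epsilon> \<tau> s1 s2 p1 p2 X1 X2 z. \<lbrakk>0 < \<epsilon>; \<epsilon> \<le> \<epsilon>0; R / 2 \<le> norm z; norm z \<le> R; \<tau> = \<epsilon> * exp (- \<alpha> * (norm z)\<^sup>2);
       transpose X1 = X1; transpose X2 = X2; \<bar>s1\<bar> \<le> \<Lambda>; \<bar>s2\<bar> \<le> \<Lambda>; norm p1 \<le> \<Lambda>; norm p2 \<le> \<Lambda>;
       \<And>x. \<bar>x \<bullet> (X2 *v x)\<bar> \<le> \<Lambda> * (x \<bullet> x); \<bar>s1 - s2\<bar> \<le> 2 * \<tau>; norm (p1 - p2) \<le> (2 * \<alpha> * R + 1) * \<tau>;
       \<And>x. x \<bullet> (X1 *v x) \<le> x \<bullet> (X2 *v x) - 4 * \<alpha>\<^sup>2 * \<tau> * (z \<bullet> x)\<^sup>2 + 4 * \<alpha> * \<tau> * (x \<bullet> x);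
       super_jet f \<Gamma> s2 p2 X2\<rbrakk> \<Longrightarrow> \<not> sub_jet f \<Gamma> s1 p1 X1"
    using barrier_makes_strict[OF n \<Gamma> cont S1 S2 S3 S4 S5 \<Lambda> R] by blast
  have \<alpha>0: "\<alpha> > 0" using \<alpha> by simp
  let ?K = "cball y0 R \<inter> cball xh r"
  have less': "v x < g x" if "x \<in> ?K" "x \<noteq> xh" for x
  proof -
    have "x \<in> \<Omega>" using that ball by blast
    moreover have "\<bar>v x - v xh\<bar> < 1" using r2(2)[of x] KE[of x] that(1) r by (auto simp: dist_commute)
    ultimately show ?thesis using less[of x] c by linarith
  qed
  define below where "below \<epsilon> \<longleftrightarrow> (\<forall>x\<in>?K. v x + \<epsilon> * barrier \<alpha> R y0 x \<le> g x)" for \<epsilon>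
  define jet where "jet \<epsilon> \<eta> x z p D \<longleftrightarrow> x \<in> ball y0 R \<inter> ball xh r \<and> z \<in> ball y0 R \<inter> ball xh r \<and>
       (Gr has_derivative D) (at x) \<and> norm (p - (Gr x + \<epsilon> *\<^sub>R barrier_grad \<alpha> y0 x)) \<le> \<eta> \<and>
       \<bar>g z - v x\<bar> \<le> \<epsilon> * exp (- \<alpha> * (norm (x - y0))\<^sup>2) + \<eta> \<and>
       (\<forall>\<^sub>F h in nhds 0. g z + p \<bullet> h + (D h + \<epsilon> *\<^sub>R barrier_hess \<alpha> y0 x h) \<bullet> h / 2 - \<eta> * (norm h)\<^sup>2 \<le> g (z + h))"
    for \<epsilon> \<eta> :: real and x z p and D
  have lscK: "lsc_on ?K g" by (rule lsc_on_subset[OF lsc]) (use KE in blast)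
  have contK: "continuous_on ?K v" by (rule continuous_on_subset[OF contE]) (use KE in blast)
  have "\<exists>\<epsilon>1>0. \<forall>\<epsilon>. 0 < \<epsilon> \<and> \<epsilon> \<le> \<epsilon>1 \<longrightarrow> below \<epsilon> \<or> (\<forall>\<eta>>0. \<exists>x z p D. jet \<epsilon> \<eta> x z p D)"
    unfolding below_def jet_def
    by (rule barrier_below_or_contact[OF R \<alpha>0 r(1) xh ball \<Omega>(2,1) lscK contK dv lip less' eq])
  then obtain \<epsilon>1 where \<epsilon>1: "\<epsilon>1 > 0"
    and dich: "\<And>\<epsilon>. 0 < \<epsilon> \<Longrightarrow> \<epsilon> \<le> \<epsilon>1 \<Longrightarrow> below \<epsilon> \<or> (\<forall>\<eta>>0. \<exists>x z p D. jet \<epsilon> \<eta> x z p D)" by blast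
  \<comment> \<open>The third entry keeps the barrier's contribution to the quadratic form below 1,
    the fourth its contribution to the slope, and the last one the change 2 \<tau> of the
    value.\<close>
  define \<epsilon> where "\<epsilon> = Min {\<epsilon>0, \<epsilon>1, 1 / (4 * \<alpha>\<^sup>2 * R\<^sup>2 + 2 * \<alpha> + 2), 1 / (2 * \<alpha> * R + 1), 1 / 2}"
  have pos: "4 * \<alpha>\<^sup>2 * R\<^sup>2 + 2 * \<alpha> + 2 > 0" "2 * \<alpha> * R + 1 > 0"
  proof -
    have "0 \<le> 4 * \<alpha>\<^sup>2 * R\<^sup>2" by simp
    then show "4 * \<alpha>\<^sup>2 * R\<^sup>2 + 2 * \<alpha> + 2 > 0" using \<alpha>0 by linarith
    have "0 < \<alpha> * R" using \<alpha>0 R by simp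
    then show "2 * \<alpha> * R + 1 > 0" by simp
  qed
  have \<epsilon>: "\<epsilon> > 0" "\<epsilon> \<le> \<epsilon>0" "\<epsilon> \<le> \<epsilon>1" "\<epsilon> * (4 * \<alpha>\<^sup>2 * R\<^sup>2 + 2 * \<alpha> + 2) \<le> 1" "\<epsilon> * (2 * \<alpha> * R + 1) \<le> 1" "\<epsilon> \<le> 1 / 2"
  proof -
    show "\<epsilon> > 0" using \<epsilon>0 \<epsilon>1 pos by (simp add: \<epsilon>_def)
    show "\<epsilon> \<le> \<epsilon>0" "\<epsilon> \<le> \<epsilon>1" "\<epsilon> \<le> 1 / 2" by (simp_all add: \<epsilon>_def)
    have "\<epsilon> \<le> 1 / (4 * \<alpha>\<^sup>2 * R\<^sup>2 + 2 * \<alpha> + 2)" "\<epsilon> \<le> 1 / (2 * \<alpha> * R + 1)" unfolding \<epsilon>_def by (auto intro: Min_le)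
    then show "\<epsilon> * (4 * \<alpha>\<^sup>2 * R\<^sup>2 + 2 * \<alpha> + 2) \<le> 1" "\<epsilon> * (2 * \<alpha> * R + 1) \<le> 1"
      using pos by (auto simp: pos_le_divide_eq)
  qed
  have "below \<epsilon>"
  proof (rule ccontr)
    assume neg: "\<not> below \<epsilon>"
    \<comment> \<open>A quarter of the least value of \<tau> on the ball, so that 4 \<eta> \<le>
      \<tau> \<le> \<alpha> \<tau> wherever the contact occurs.\<close>
    define \<eta> where "\<eta> = \<epsilon> * exp (- \<alpha> * R\<^sup>2) / 4"
    have \<eta>: "\<eta> > 0" using \<epsilon> by (simp add: \<eta>_def)
    obtain x z p D where "jet \<epsilon> \<eta> x z p D" using dich[OF \<epsilon>(1,3)] neg \<eta> by blast
    then have x: "x \<in> ball y0 R \<inter> ball xh r" and z: "z \<in> ball y0 R \<inter> ball xh r"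
      and D: "(Gr has_derivative D) (at x)" and p: "norm (p - (Gr x + \<epsilon> *\<^sub>R barrier_grad \<alpha> y0 x)) \<le> \<eta>"
      and val: "\<bar>g z - v x\<bar> \<le> \<epsilon> * exp (- \<alpha> * (norm (x - y0))\<^sup>2) + \<eta>"
      and touch: "\<forall>\<^sub>F h in nhds 0. g z + p \<bullet> h + (D h + \<epsilon> *\<^sub>R barrier_hess \<alpha> y0 x h) \<bullet> h / 2 - \<eta> * (norm h)\<^sup>2 \<le> g (z + h)"
      unfolding jet_def by blast+
    have \<Omega>xz: "x \<in> \<Omega>" "z \<in> \<Omega>" using x z ball xh by fastforce+
    define y where "y = x - y0"
    define \<tau> where "\<tau> = \<epsilon> * exp (- \<alpha> * (norm y)\<^sup>2)"
    have y: "norm y \<le> R" "R / 2 \<le> norm y"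
    proof -
      show "norm y \<le> R" using x by (simp add: y_def dist_norm norm_minus_commute)
      have "R \<le> dist y0 x + dist x xh" using dist_triangle[of y0 xh x] xh by simp
      then show "R / 2 \<le> norm y" using x r(4) by (simp add: y_def dist_norm norm_minus_commute)
    qed
    have \<tau>: "0 < \<tau>" "\<tau> \<le> \<epsilon>" "4 * \<eta> \<le> \<tau>"
    proof -
      show "0 < \<tau>" using \<epsilon> by (simp add: \<tau>_def)
      have "exp (- \<alpha> * (norm y)\<^sup>2) \<le> 1" using \<alpha>0 by simp
      then show "\<tau> \<le> \<epsilon>" using \<epsilon> by (simp add: \<tau>_def mult_left_le)
      have "(norm y)\<^sup>2 \<le> R\<^sup>2" using y by (intro power_mono) auto
      then have "exp (- \<alpha> * R\<^sup>2) \<le> exp (- \<alpha> * (norm y)\<^sup>2)" using \<alpha>0 by simp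
      then show "4 * \<eta> \<le> \<tau>" using \<epsilon> by (simp add: \<eta>_def \<tau>_def)
    qed
    have \<alpha>\<tau>: "\<tau> \<le> \<alpha> * \<tau>" using mult_right_mono[OF \<alpha>, of \<tau>] \<tau> by simp
    have vx: "\<bar>v x\<bar> \<le> \<bar>v xh\<bar> + 1" using r2(2)[of x] \<Omega>xz x r by (auto simp: dist_commute)
    have gv: "\<bar>g z - v x\<bar> \<le> 2 * \<tau>" using val \<tau> by (simp add: \<tau>_def y_def)
    have gz: "\<bar>g z\<bar> \<le> \<bar>v xh\<bar> + 2" "g z < c"
    proof -
      have "2 * \<tau> \<le> 1" using \<tau> \<epsilon>(6) by linarith
      then show "\<bar>g z\<bar> \<le> \<bar>v xh\<bar> + 2" using gv vx by linarith
      have "\<bar>v x - v xh\<bar> < 1" using r2(2)[of x] \<Omega>xz x r by (auto simp: dist_commute)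
      then show "g z < c" using gv c \<open>2 * \<tau> \<le> 1\<close> by linarith
    qed
    have Gx: "norm (Gr x) \<le> B" using B \<Omega>xz x by auto
    have pG: "norm (p - Gr x) \<le> (2 * \<alpha> * R + 1) * \<tau>"
    proof -
      have "norm (\<epsilon> *\<^sub>R barrier_grad \<alpha> y0 x) = 2 * \<alpha> * \<tau> * norm y"
        using \<alpha>0 \<epsilon> by (simp add: barrier_grad_def y_def[symmetric] \<tau>_def)
      also have "\<dots> \<le> 2 * \<alpha> * \<tau> * R" using y \<alpha>0 \<tau> by (intro mult_left_mono) auto
      finally have "norm (\<epsilon> *\<^sub>R barrier_grad \<alpha> y0 x) \<le> 2 * \<alpha> * \<tau> * R" .
      moreover have "norm (p - Gr x) \<le> norm (p - (Gr x + \<epsilon> *\<^sub>R barrier_grad \<alpha> y0 x)) + norm (\<epsilon> *\<^sub>R barrier_grad \<alpha> y0 x)"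
        using norm_triangle_ineq[of "p - (Gr x + \<epsilon> *\<^sub>R barrier_grad \<alpha> y0 x)" "\<epsilon> *\<^sub>R barrier_grad \<alpha> y0 x"] by simp
      ultimately have "norm (p - Gr x) \<le> \<tau> + 2 * \<alpha> * \<tau> * R" using p \<tau> \<eta> by linarith
      then show ?thesis by (simp add: algebra_simps)
    qed
    have np: "norm p \<le> B + 1"
    proof -
      have "(2 * \<alpha> * R + 1) * \<tau> \<le> (2 * \<alpha> * R + 1) * \<epsilon>" using pos \<tau> by (intro mult_left_mono) auto
      then have "norm (p - Gr x) \<le> 1" using pG \<epsilon>(5) by (simp add: mult.commute)
      then show ?thesis using Gx norm_triangle_ineq2[of p "Gr x"] by linarith
    qed
    have blD: "bounded_linear D" using D by (rule has_derivative_bounded_linear)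
    obtain X where X: "transpose X = X" "\<And>h. (X *v h) \<bullet> h = D h \<bullet> h"
      using bounded_linear_symmetric_part[OF blD] by blast
    have Xb: "\<bar>h \<bullet> (X *v h)\<bar> \<le> L * (h \<bullet> h)" for h
    proof -
      have "norm (D h) \<le> L * norm h"
      proof (rule lipschitz_has_derivative_bound[OF _ _ _ D])
        show "L-lipschitz_on (\<Omega> \<inter> ball xh r) Gr" by (rule lipschitz_on_subset[OF lip]) auto
        show "open (\<Omega> \<inter> ball xh r)" "x \<in> \<Omega> \<inter> ball xh r" using \<Omega>(1) \<Omega>xz x by auto
      qed
      then have "\<bar>D h \<bullet> h\<bar> \<le> (L * norm h) * norm h"
        using Cauchy_Schwarz_ineq2[of "D h" h] mult_right_mono[of "norm (D h)" "L * norm h" "norm h"] by auto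
      then show ?thesis by (simp add: inner_commute[of h] X(2) power2_norm_eq_inner[symmetric] power2_eq_square mult.assoc)
    qed
    \<comment> \<open>Both expansions hold up to \<eta> |h|^2. Adding 2 \<eta> to the form of
      \<open>v\<close>, and subtracting it from that of \<open>g\<close>, turns them into genuine
      touching from above and from below.\<close>
    define I2 :: "real ^ 'n ^ 'n" where "I2 = (2 * \<eta>) *\<^sub>R mat 1"
    have I2: "I2 *v h = (2 * \<eta>) *\<^sub>R h" for h by (simp add: I2_def flip: scaleR_matrix_vector_assoc)
    have I2t: "transpose I2 = I2" by (simp add: I2_def transpose_def mat_def vec_eq_iff)
    have trans_add: "transpose (M + N) = transpose M + transpose N" "transpose (- M) = - transpose M" for M N :: "real ^ 'n ^ 'n"
      by (simp_all add: transpose_def vec_eq_iff)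
    define X' where "X' = X + I2"
    have X't: "transpose X' = X'" using X(1) I2t by (simp add: X'_def trans_add)
    have X'h: "h \<bullet> (X' *v h) = h \<bullet> (X *v h) + 2 * \<eta> * (h \<bullet> h)" for h
      by (simp add: X'_def matrix_vector_mult_add_rdistrib I2 inner_add_right)
    have "bounded_linear (\<lambda>h. D h + \<epsilon> *\<^sub>R barrier_hess \<alpha> y0 x h - (2 * \<eta>) *\<^sub>R h)"
      using blD has_derivative_bounded_linear[OF has_derivative_barrier_grad]
      by (intro bounded_linear_sub bounded_linear_add bounded_linear_const_scaleR bounded_linear_ident) auto
    then obtain Y where Y: "transpose Y = Y"
      "\<And>h. (Y *v h) \<bullet> h = (D h + \<epsilon> *\<^sub>R barrier_hess \<alpha> y0 x h - (2 * \<eta>) *\<^sub>R h) \<bullet> h"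
      using bounded_linear_symmetric_part by blast
    have Yh: "h \<bullet> (Y *v h) = h \<bullet> (X *v h) + \<tau> * (4 * \<alpha>\<^sup>2 * (y \<bullet> h)\<^sup>2 - 2 * \<alpha> * (h \<bullet> h)) - 2 * \<eta> * (h \<bullet> h)" for h
      unfolding inner_commute[of h "Y *v h"] inner_commute[of h "X *v h"] X(2) Y(2) inner_diff_left inner_add_left
        inner_scaleR_left barrier_hess_inner
      by (simp add: \<tau>_def y_def inner_diff_left)
    have tV: "touchV (v x) (Gr x) X'"
    proof (rule V[OF \<Omega>xz(1) X't])
      have "\<forall>\<^sub>F h in nhds 0. \<bar>v (x + h) - v x - Gr x \<bullet> h - D h \<bullet> h / 2\<bar> \<le> \<eta> * (norm h)\<^sup>2"
        by (rule second_order_expansion[OF \<Omega>(1) \<Omega>xz(1) dv D \<eta>])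
      then show "\<forall>\<^sub>F h in nhds 0. v (x + h) \<le> v x + Gr x \<bullet> h + (X' *v h) \<bullet> h / 2"
      proof eventually_elim
        case (elim h)
        have "(X' *v h) \<bullet> h = D h \<bullet> h + 2 * \<eta> * (norm h)\<^sup>2"
          using X'h[of h] X(2)[of h] by (simp add: inner_commute power2_norm_eq_inner)
        then show ?case using elim unfolding abs_le_iff by linarith
      qed
    qed
    have tG: "touchG (g z) p Y"
    proof (rule G[OF \<Omega>xz(2) gz(2) Y(1)])
      show "\<forall>\<^sub>F h in nhds 0. g z + p \<bullet> h + (Y *v h) \<bullet> h / 2 \<le> g (z + h)"
        using touch
      proof eventually_elim
        case (elim h)
        have "(Y *v h) \<bullet> h = (D h + \<epsilon> *\<^sub>R barrier_hess \<alpha> y0 x h) \<bullet> h - 2 * \<eta> * (norm h)\<^sup>2"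
          unfolding Y(2) inner_diff_left by (simp add: power2_norm_eq_inner)
        then show ?case using elim by linarith
      qed
    qed
    have \<eta>q: "4 * \<eta> * (h \<bullet> h) \<le> \<alpha> * \<tau> * (h \<bullet> h)" for h :: "real ^ 'n"
    proof (rule mult_right_mono)
      show "4 * \<eta> \<le> \<alpha> * \<tau>" using \<tau>(3) \<alpha>\<tau> by linarith
    qed simp
    have \<tau>q: "0 \<le> \<alpha> * \<tau> * (h \<bullet> h)" for h :: "real ^ 'n" using \<alpha>0 \<tau> by simp
    \<comment> \<open>The form of the super-solution needs a two-sided bound by \<Lambda>. In the
      first case this is \<open>Y\<close>, which contains the barrier; in the second it is
      \<open>- X'\<close>, and the sign change makes \<open>- Y\<close> the form of the
      sub-solution.\<close>
    from incompatible show False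
    proof
      assume PQ: "touchV = sub_jet f \<Gamma> \<and> touchG = super_jet f \<Gamma>"
      have "\<not> sub_jet f \<Gamma> (v x) (Gr x) X'"
      proof (rule strict[OF \<epsilon>(1,2) y(2,1) \<tau>_def X't Y(1)])
        show "\<bar>v x\<bar> \<le> \<Lambda>" "\<bar>g z\<bar> \<le> \<Lambda>" "norm (Gr x) \<le> \<Lambda>" "norm p \<le> \<Lambda>"
          using vx gz Gx np B0 L by (auto simp: \<Lambda>_def)
        show "\<bar>v x - g z\<bar> \<le> 2 * \<tau>" using gv by linarith
        show "norm (Gr x - p) \<le> (2 * \<alpha> * R + 1) * \<tau>" using pG by (simp add: norm_minus_commute)
        show "super_jet f \<Gamma> (g z) p Y" using tG PQ by simp
        fix h
        show "h \<bullet> (X' *v h) \<le> h \<bullet> (Y *v h) - 4 * \<alpha>\<^sup>2 * \<tau> * (y \<bullet> h)\<^sup>2 + 4 * \<alpha> * \<tau> * (h \<bullet> h)"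
          unfolding X'h Yh using \<eta>q[of h] \<tau>q[of h] by (simp add: algebra_simps)
        have "\<bar>h \<bullet> (Y *v h)\<bar> \<le> L * (h \<bullet> h) + \<tau> * (4 * \<alpha>\<^sup>2 * R\<^sup>2 + 2 * \<alpha> + 1) * (h \<bullet> h)"
        proof -
          have "(y \<bullet> h)\<^sup>2 \<le> (norm y)\<^sup>2 * (h \<bullet> h)" using Cauchy_Schwarz_ineq[of y h] by (simp add: power2_norm_eq_inner)
          also have "\<dots> \<le> R\<^sup>2 * (h \<bullet> h)" using y by (intro mult_right_mono power_mono) auto
          finally have 1: "\<tau> * 4 * \<alpha>\<^sup>2 * (y \<bullet> h)\<^sup>2 \<le> \<tau> * 4 * \<alpha>\<^sup>2 * (R\<^sup>2 * (h \<bullet> h))" using \<tau> by (intro mult_left_mono) auto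
          have 2: "2 * \<eta> * (h \<bullet> h) \<le> \<tau> * (h \<bullet> h)" using \<tau> \<eta> by (intro mult_right_mono) auto
          have 3: "0 \<le> \<tau> * 4 * \<alpha>\<^sup>2 * (y \<bullet> h)\<^sup>2" "0 \<le> 2 * \<eta> * (h \<bullet> h)" "0 \<le> \<tau> * 2 * \<alpha> * (h \<bullet> h)" using \<tau> \<eta> \<alpha>0 by auto
          have "h \<bullet> (Y *v h) = h \<bullet> (X *v h) + \<tau> * 4 * \<alpha>\<^sup>2 * (y \<bullet> h)\<^sup>2 - \<tau> * 2 * \<alpha> * (h \<bullet> h) - 2 * \<eta> * (h \<bullet> h)"
            unfolding Yh by (simp add: algebra_simps)
          then have "\<bar>h \<bullet> (Y *v h)\<bar> \<le> L * (h \<bullet> h) + \<tau> * 4 * \<alpha>\<^sup>2 * (R\<^sup>2 * (h \<bullet> h)) + \<tau> * 2 * \<alpha> * (h \<bullet> h) + \<tau> * (h \<bullet> h)"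
            using Xb[of h] 1 2 3 by linarith
          then show ?thesis by (simp add: algebra_simps)
        qed
        also have "\<tau> * (4 * \<alpha>\<^sup>2 * R\<^sup>2 + 2 * \<alpha> + 1) * (h \<bullet> h) \<le> 1 * (h \<bullet> h)"
        proof (rule mult_right_mono)
          have "\<tau> * (4 * \<alpha>\<^sup>2 * R\<^sup>2 + 2 * \<alpha> + 1) \<le> \<epsilon> * (4 * \<alpha>\<^sup>2 * R\<^sup>2 + 2 * \<alpha> + 2)"
            using \<tau> \<epsilon> \<alpha>0 by (intro mult_mono) auto
          then show "\<tau> * (4 * \<alpha>\<^sup>2 * R\<^sup>2 + 2 * \<alpha> + 1) \<le> 1" using \<epsilon>(4) by linarith
        qed simp
        finally have "\<bar>h \<bullet> (Y *v h)\<bar> \<le> (L + 1) * (h \<bullet> h)" by (simp add: algebra_simps)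
        also have "\<dots> \<le> \<Lambda> * (h \<bullet> h)" using B0 by (intro mult_right_mono) (auto simp: \<Lambda>_def)
        finally show "\<bar>h \<bullet> (Y *v h)\<bar> \<le> \<Lambda> * (h \<bullet> h)" .
      qed
      then show False using tV PQ by simp
    next
      assume PQ: "touchV = (\<lambda>s p X. super_jet f \<Gamma> (- s) (- p) (- X)) \<and> touchG = (\<lambda>s p X. sub_jet f \<Gamma> (- s) (- p) (- X))"
      have neg: "(- M) *v h = - (M *v h)" for M :: "real ^ 'n ^ 'n" and h
        by (simp add: vec_eq_iff matrix_vector_mult_def sum_negf)
      have "\<not> sub_jet f \<Gamma> (- g z) (- p) (- Y)"
      proof (rule strict[OF \<epsilon>(1,2) y(2,1) \<tau>_def])
        show "transpose (- Y) = - Y" "transpose (- X') = - X'" using Y(1) X't by (simp_all add: trans_add)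
        show "\<bar>- g z\<bar> \<le> \<Lambda>" "\<bar>- v x\<bar> \<le> \<Lambda>" "norm (- p) \<le> \<Lambda>" "norm (- Gr x) \<le> \<Lambda>"
          using vx gz Gx np B0 L by (auto simp: \<Lambda>_def)
        show "\<bar>- g z - - v x\<bar> \<le> 2 * \<tau>" using gv by linarith
        show "norm (- p - - Gr x) \<le> (2 * \<alpha> * R + 1) * \<tau>" using pG by (simp add: norm_minus_commute)
        show "super_jet f \<Gamma> (- v x) (- Gr x) (- X')" using tV PQ by simp
        fix h
        show "h \<bullet> (- Y *v h) \<le> h \<bullet> (- X' *v h) - 4 * \<alpha>\<^sup>2 * \<tau> * (y \<bullet> h)\<^sup>2 + 4 * \<alpha> * \<tau> * (h \<bullet> h)"
          unfolding neg inner_minus_right X'h Yh using \<eta>q[of h] \<tau>q[of h] by (simp add: algebra_simps)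
        have "2 * \<eta> * (h \<bullet> h) \<le> 1 * (h \<bullet> h)" using \<tau> \<epsilon>(6) by (intro mult_right_mono) auto
        moreover have "0 \<le> 2 * \<eta> * (h \<bullet> h)" using \<eta> by simp
        ultimately have "\<bar>h \<bullet> (- X' *v h)\<bar> \<le> (L + 1) * (h \<bullet> h)"
          unfolding neg inner_minus_right X'h distrib_right using Xb[of h] by linarith
        also have "\<dots> \<le> \<Lambda> * (h \<bullet> h)" using B0 by (intro mult_right_mono) (auto simp: \<Lambda>_def)
        finally show "\<bar>h \<bullet> (- X' *v h)\<bar> \<le> \<Lambda> * (h \<bullet> h)" .
      qed
      then show False using tG PQ by simp
    qed
  qed
  then show thesis using that[OF \<alpha>0 \<epsilon>(1) r(1)] unfolding below_def by blast
qed

section \<open>Viscosity solutions and the boundary slope\<close>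

lemma eventually_nhds_shift:
  fixes x0 :: "'a::real_normed_vector"
  shows "(\<forall>\<^sub>F x in nhds x0. P x) \<longleftrightarrow> (\<forall>\<^sub>F h in nhds 0. P (x0 + h))"
proof
  assume "\<forall>\<^sub>F x in nhds x0. P x"
  then obtain d where d: "d > 0" "\<And>x. dist x x0 < d \<Longrightarrow> P x" unfolding eventually_nhds_metric by blast
  have "P (x0 + h)" if "dist h 0 < d" for h using d(2)[of "x0 + h"] that by (simp add: dist_norm)
  then show "\<forall>\<^sub>F h in nhds 0. P (x0 + h)" unfolding eventually_nhds_metric using d(1) by blast
next
  assume "\<forall>\<^sub>F h in nhds 0. P (x0 + h)"
  then obtain d where d: "d > 0" "\<And>h. dist h 0 < d \<Longrightarrow> P (x0 + h)" unfolding eventually_nhds_metric by blast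
  have "P x" if "dist x x0 < d" for x using d(2)[of "x - x0"] that by (simp add: dist_norm)
  then show "\<forall>\<^sub>F x in nhds x0. P x" unfolding eventually_nhds_metric using d(1) by blast
qed

lemma exp_quadratic_shift:
  "exp_quadratic x0 s p X (x0 + h) = exp (s + p \<bullet> h + (X *v h) \<bullet> h / 2)"
  by (simp add: exp_quadratic_def)

lemma subsolution_touched:
  fixes X :: "real ^ 'n ^ 'n"
  assumes sub: "viscosity_subsolution f \<Gamma> \<Omega> u" and n: "CARD('n) \<ge> 3" and x: "x \<in> \<Omega>" and pos: "0 < u x"
    and X: "transpose X = X"
    and touch: "\<forall>\<^sub>F h in nhds 0. u (x + h) \<le> exp (ln (u x) + p \<bullet> h + (X *v h) \<bullet> h / 2)"
  shows "sub_jet f \<Gamma> (ln (u x)) p X"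
proof -
  let ?\<phi> = "exp_quadratic x (ln (u x)) p X"
  have "C2_on \<Omega> ?\<phi>" by (rule C2_on_exp_quadratic[OF X])
  moreover have "\<forall>y\<in>\<Omega>. 0 < ?\<phi> y" by (simp add: exp_quadratic_def)
  moreover have "u x = ?\<phi> x" using pos by (simp add: exp_quadratic_def)
  moreover have "\<forall>\<^sub>F y in nhds x. u y \<le> ?\<phi> y"
    unfolding eventually_nhds_shift[of _ x] exp_quadratic_shift by (rule touch)
  ultimately have "eigenvalues (conformal_hessian ?\<phi> x) \<notin> closure \<Gamma> \<or> f (eigenvalues (conformal_hessian ?\<phi> x)) \<le> 1"
    using sub x unfolding viscosity_subsolution_def by blast
  then show ?thesis unfolding conformal_hessian_exp_quadratic[OF X n] sub_jet_def .
qed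

lemma supersolution_touched:
  fixes X :: "real ^ 'n ^ 'n"
  assumes super: "viscosity_supersolution f \<Gamma> \<Omega> u" and n: "CARD('n) \<ge> 3" and x: "x \<in> \<Omega>"
    and ux: "u x = ereal t" and pos: "0 < t" and X: "transpose X = X"
    and touch: "\<forall>\<^sub>F h in nhds 0. ereal (exp (ln t + p \<bullet> h + (X *v h) \<bullet> h / 2)) \<le> u (x + h)"
  shows "super_jet f \<Gamma> (ln t) p X"
proof -
  let ?\<phi> = "exp_quadratic x (ln t) p X"
  have "C2_on \<Omega> ?\<phi>" by (rule C2_on_exp_quadratic[OF X])
  moreover have "\<forall>y\<in>\<Omega>. 0 < ?\<phi> y" by (simp add: exp_quadratic_def)
  moreover have "u x = ereal (?\<phi> x)" using pos ux by (simp add: exp_quadratic_def)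
  moreover have "\<forall>\<^sub>F y in nhds x. ereal (?\<phi> y) \<le> u y"
    unfolding eventually_nhds_shift[of _ x] exp_quadratic_shift by (rule touch)
  ultimately have "eigenvalues (conformal_hessian ?\<phi> x) \<in> closure \<Gamma> \<and> f (eigenvalues (conformal_hessian ?\<phi> x)) \<ge> 1"
    using super x unfolding viscosity_supersolution_def by blast
  then show ?thesis unfolding conformal_hessian_exp_quadratic[OF X n] super_jet_def .
qed

lemma C11_on_imp_continuous_on:
  assumes "C11_on E w"
  shows "continuous_on E w"
  using assms has_derivative_continuous unfolding C11_on_def continuous_on_eq_continuous_within by blast

lemma C11_on_uminus:
  assumes "C11_on E w"
  shows "C11_on E (\<lambda>x. - w x)"
proof -
  obtain G where G: "\<And>x. x \<in> E \<Longrightarrow> (w has_derivative (\<lambda>h. G x \<bullet> h)) (at x within E)"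
    "\<And>x. x \<in> E \<Longrightarrow> \<exists>r>0. \<exists>L. L-lipschitz_on (E \<inter> ball x r) G"
    using assms unfolding C11_on_def by blast
  show ?thesis unfolding C11_on_def
  proof (intro exI[of _ "\<lambda>x. - G x"] conjI ballI)
    fix x assume x: "x \<in> E"
    show "((\<lambda>x. - w x) has_derivative (\<lambda>h. (- G x) \<bullet> h)) (at x within E)"
      using has_derivative_minus[OF G(1)[OF x]] by simp
    show "\<exists>r>0. \<exists>L. L-lipschitz_on (E \<inter> ball x r) (\<lambda>x. - G x)"
      using G(2)[OF x] lipschitz_on_minus by blast
  qed
qed

text \<open>\<open>real_of_ereal\<close> sends infinity to 0. Capping at a finite \<open>N\<close>
  first makes the conversion faithful where the super-solution is infinite.\<close>

lemma less_real_of_ereal_min: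
  "ereal t < a \<Longrightarrow> t < N \<Longrightarrow> t < real_of_ereal (min a (ereal N))"
  by (cases a) (auto simp: min_def)

lemma ereal_real_of_ereal_min:
  "0 < a \<Longrightarrow> ereal (real_of_ereal (min a (ereal N))) = min a (ereal N)"
  by (cases a) (auto simp: min_def)

text \<open>The truncations \<open>min u2 (exp c)\<close> and, in the other case, \<open>max u1 (exp (- c))\<close> have finite
  logarithms and are still tested by the same functions where they touch below the level \<open>c\<close>.\<close>

lemma barrier_gap:
  fixes f :: "real ^ 'n \<Rightarrow> real" and \<Gamma> \<Omega> :: "(real ^ 'n) set" and u1 :: "real ^ 'n \<Rightarrow> real"
  assumes n: "CARD('n) \<ge> 3" and \<Gamma>: "open \<Gamma>" and cont: "continuous_on (closure \<Gamma>) f"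
    and S1: "S1 f \<Gamma>" and S2: "S2 f \<Gamma>" and S3: "S3 f \<Gamma>" and S4: "S4 f \<Gamma>" and S5: "S5 f \<Gamma>"
    and \<Omega>: "open \<Omega>" "xh \<notin> \<Omega>" and R: "R > 0" and xh: "dist y0 xh = R" and ball: "cball y0 R - {xh} \<subseteq> \<Omega>"
    and usc: "usc_on (\<Omega> \<union> {xh}) u1" and lsc: "lsc_on (\<Omega> \<union> {xh}) u2" and u2: "\<And>x. x \<in> \<Omega> \<union> {xh} \<Longrightarrow> 0 < u2 x"
    and sub: "viscosity_subsolution f \<Gamma> \<Omega> u1" and super: "viscosity_supersolution f \<Gamma> \<Omega> u2"
    and less: "\<And>x. x \<in> \<Omega> \<Longrightarrow> ereal (u1 x) < u2 x" and eq: "ereal (u1 xh) = u2 xh"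
    and reg: "((\<forall>x \<in> \<Omega> \<union> {xh}. 0 < u1 x) \<and> C11_on (\<Omega> \<union> {xh}) (\<lambda>x. ln (u1 x))) \<or>
         ((\<forall>x \<in> \<Omega> \<union> {xh}. u2 x < \<infinity>) \<and> C11_on (\<Omega> \<union> {xh}) (\<lambda>x. ln (real_of_ereal (u2 x))))"
  obtains \<alpha> \<kappa> r where "\<alpha> > 0" "\<kappa> > 0" "r > 0"
    "\<And>x. x \<in> cball y0 R \<inter> cball xh r \<Longrightarrow> ereal (u1 x + \<kappa> * barrier \<alpha> R y0 x) \<le> u2 x"
  using reg
proof
  let ?E = "\<Omega> \<union> {xh}"
  have KE: "x \<in> ?E" if "x \<in> cball y0 R" for x using that ball by blast
  have b0: "0 \<le> barrier \<alpha> R y0 x" if "x \<in> cball y0 R" "\<alpha> > 0" for \<alpha> x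
  proof -
    have "(norm (x - y0))\<^sup>2 \<le> R\<^sup>2" using that by (intro power_mono) (auto simp: dist_norm norm_minus_commute)
    then show ?thesis using that(2) by (simp add: barrier_def)
  qed
  have exp_ge: "1 + t \<le> exp t" for t :: real by (rule exp_ge_add_one_self)
  {
    assume "(\<forall>x \<in> ?E. 0 < u1 x) \<and> C11_on ?E (\<lambda>x. ln (u1 x))"
    then have u1: "\<And>x. x \<in> ?E \<Longrightarrow> 0 < u1 x" and C11: "C11_on ?E (\<lambda>x. ln (u1 x))" by auto
    \<comment> \<open>Three units above the boundary value: near \<open>xh\<close> the function
      \<open>v\<close> moves by less than 1 and a contact value of \<open>g\<close> differs from it
      by at most 1, so contacts stay below the truncation level.\<close>
    define c where "c = ln (u1 xh) + 3"
    have c: "ln (u1 xh) + 3 \<le> c" by (simp add: c_def)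
    define N where "N = exp c"
    define m where "m = (\<lambda>x. real_of_ereal (min (u2 x) (ereal N)))"
    have N: "N > 0" by (simp add: N_def)
    have em: "ereal (m x) = min (u2 x) (ereal N)" if "x \<in> ?E" for x
      unfolding m_def by (rule ereal_real_of_ereal_min[OF u2[OF that]])
    have m0: "0 < m x" if "x \<in> ?E" for x
      unfolding m_def using less_real_of_ereal_min[of 0 "u2 x" N] u2[OF that] N by (simp add: zero_ereal_def)
    have mN: "m x \<le> N" if "x \<in> ?E" for x
      using em[OF that] by (metis ereal_less_eq(3) min.cobounded2)
    have mu: "ereal (m x) \<le> u2 x" if "x \<in> ?E" for x using em[OF that] by simp
    have lscg: "lsc_on ?E (\<lambda>x. ln (m x))"
      unfolding lsc_on_def
    proof (intro ballI allI impI)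
      fix x t assume x: "x \<in> ?E" and t: "t < ln (m x)"
      have "exp t < exp (ln (m x))" using t by simp
      then have tm: "exp t < m x" using m0[OF x] by simp
      then have "ereal (exp t) < u2 x" "exp t < N" using mu[OF x] mN[OF x] by (auto intro: less_le_trans[of _ "ereal (m x)"])
      then have "\<forall>\<^sub>F y in at x within ?E. ereal (exp t) < u2 y" using lsc x unfolding lsc_on_def by blast
      then show "\<forall>\<^sub>F y in at x within ?E. t < ln (m y)"
      proof eventually_elim
        case (elim y)
        have "exp t < m y" unfolding m_def by (rule less_real_of_ereal_min) fact+
        then have "ln (exp t) < ln (m y)" by (subst ln_less_cancel_iff) (auto intro: less_trans[OF exp_gt_zero])
        then show ?case by simp
      qed
    qed
    have less': "ln (u1 x) < ln (m x) \<or> c \<le> ln (m x)" if "x \<in> \<Omega>" for x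
    proof (cases "u1 x < N")
      case True
      then have "u1 x < m x" unfolding m_def using less[OF that] by (intro less_real_of_ereal_min)
      then show ?thesis using u1[of x] m0[of x] that by simp
    next
      \<comment> \<open>Where \<open>u1\<close> reaches the cap, the strict inequality may be lost,
        but the truncated function then equals the cap and the alternative with \<open>c\<close>
        holds.\<close>
      case False
      then have "ereal N \<le> ereal (u1 x)" by simp
      also have "\<dots> < u2 x" by (rule less[OF that])
      finally have "min (u2 x) (ereal N) = ereal N" by (simp add: min_absorb2 less_imp_le)
      then have "m x = N" by (simp add: m_def)
      then show ?thesis by (simp add: N_def)
    qed
    have eq': "ln (m xh) = ln (u1 xh)"
    proof -
      have "ln (u1 xh) < ln N" by (simp add: N_def c_def)
      then have "u1 xh < N" using u1[of xh] N by simp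
      then show ?thesis by (simp add: m_def eq[symmetric] min_def)
    qed
    have ev\<Omega>: "\<forall>\<^sub>F h in nhds 0. x + h \<in> \<Omega>" if "x \<in> \<Omega>" for x
      using eventually_nhds_shift[of "\<lambda>y. y \<in> \<Omega>" x] \<Omega>(1) that by (simp add: eventually_nhds_in_open)
    have V: "sub_jet f \<Gamma> (ln (u1 x)) p X" if x: "x \<in> \<Omega>" and X: "transpose X = X"
      and touch: "\<forall>\<^sub>F h in nhds 0. ln (u1 (x + h)) \<le> ln (u1 x) + p \<bullet> h + (X *v h) \<bullet> h / 2" for x p X
    proof (rule subsolution_touched[OF sub n x _ X])
      show "0 < u1 x" using u1 x by blast
      show "\<forall>\<^sub>F h in nhds 0. u1 (x + h) \<le> exp (ln (u1 x) + p \<bullet> h + (X *v h) \<bullet> h / 2)"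
        using touch ev\<Omega>[OF x]
      proof eventually_elim
        case (elim h)
        have "u1 (x + h) = exp (ln (u1 (x + h)))" using u1[of "x + h"] elim(2) by simp
        then show ?case using elim(1) by (metis exp_le_cancel_iff)
      qed
    qed
    have G: "super_jet f \<Gamma> (ln (m x)) p X" if x: "x \<in> \<Omega>" and cx: "ln (m x) < c" and X: "transpose X = X"
      and touch: "\<forall>\<^sub>F h in nhds 0. ln (m x) + p \<bullet> h + (X *v h) \<bullet> h / 2 \<le> ln (m (x + h))" for x p X
    proof (rule supersolution_touched[OF super n x _ _ X])
      have "exp (ln (m x)) < exp c" using cx by (rule exp_less_mono)
      then have mN: "m x < N" using m0[of x] x by (simp add: N_def)
      \<comment> \<open>Below the cap the truncation is inactive at \<open>x\<close>, and it lies
        below \<open>u2\<close> everywhere in \<Omega>, so touching it from below also means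
        touching \<open>u2\<close>.\<close>
      have emx: "ereal (m x) = min (u2 x) (ereal N)" using em x by blast
      then have "min (u2 x) (ereal N) < ereal N" using mN by (metis less_ereal.simps(1))
      then show "u2 x = ereal (m x)" using emx by (auto simp: min_def split: if_splits)
      show "0 < m x" using m0 x by blast
      show "\<forall>\<^sub>F h in nhds 0. ereal (exp (ln (m x) + p \<bullet> h + (X *v h) \<bullet> h / 2)) \<le> u2 (x + h)"
        using touch ev\<Omega>[OF x]
      proof eventually_elim
        case (elim h)
        have "m (x + h) = exp (ln (m (x + h)))" using m0[of "x + h"] elim(2) by simp
        then have "exp (ln (m x) + p \<bullet> h + (X *v h) \<bullet> h / 2) \<le> m (x + h)" using elim(1) by (metis exp_le_cancel_iff)
        then have "ereal (exp (ln (m x) + p \<bullet> h + (X *v h) \<bullet> h / 2)) \<le> ereal (m (x + h))" by simp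
        also have "\<dots> \<le> u2 (x + h)" using mu elim(2) by blast
        finally show ?case .
      qed
    qed
    obtain \<alpha> \<epsilon> r where ar: "\<alpha> > 0" "\<epsilon> > 0" "r > 0"
      "\<And>x. x \<in> cball y0 R \<inter> cball xh r \<Longrightarrow> ln (u1 x) + \<epsilon> * barrier \<alpha> R y0 x \<le> ln (m x)"
      by (rule barrier_below[where touchV = "sub_jet f \<Gamma>" and touchG = "super_jet f \<Gamma>",
            OF n \<Gamma> cont S1 S2 S3 S4 S5 \<Omega> R xh ball lscg C11 less' eq' c V G], assumption+, rule disjI1, rule conjI, rule refl, rule refl) blast
    obtain r' where r': "r' > 0" "\<And>x. x \<in> ?E \<Longrightarrow> dist x xh < r' \<Longrightarrow> ln (u1 xh) - 1 < ln (u1 x)"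
    proof -
      have "\<exists>d>0. \<forall>x\<in>?E. dist x xh < d \<longrightarrow> dist (ln (u1 x)) (ln (u1 xh)) < 1"
        using C11_on_imp_continuous_on[OF C11] unfolding continuous_on_iff by (metis UnI2 insertI1 zero_less_one)
      then obtain d where d: "d > 0" "\<And>x. x \<in> ?E \<Longrightarrow> dist x xh < d \<Longrightarrow> dist (ln (u1 x)) (ln (u1 xh)) < 1" by blast
      have "ln (u1 xh) - 1 < ln (u1 x)" if "x \<in> ?E" "dist x xh < d" for x
        using d(2)[OF that] unfolding dist_real_def abs_less_iff by linarith
      then show thesis using that d(1) by blast
    qed
    \<comment> \<open>A positive lower bound for \<open>u1\<close> near \<open>xh\<close>. It
      converts the gap of the logarithms into a gap of the functions through exp t \<ge> 1 +
      t.\<close>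
    let ?q = "exp (ln (u1 xh) - 1)"
    let ?r = "min r (r' / 2)"
    have res: "ereal (u1 x + (?q * \<epsilon>) * barrier \<alpha> R y0 x) \<le> u2 x" if x: "x \<in> cball y0 R \<inter> cball xh ?r" for x
    proof -
      have xE: "x \<in> ?E" using KE x by blast
      have "ln (u1 xh) - 1 < ln (u1 x)" using r' xE x by (auto simp: dist_commute)
      then have "?q \<le> exp (ln (u1 x))" by simp
      then have q: "?q \<le> u1 x" using u1[OF xE] by simp
      let ?t = "\<epsilon> * barrier \<alpha> R y0 x"
      have t: "0 \<le> ?t" using ar(2) b0[OF _ ar(1)] x by auto
      have "u1 x + ?q * \<epsilon> * barrier \<alpha> R y0 x \<le> u1 x + u1 x * ?t"
        using mult_right_mono[OF q t] by (simp add: mult.assoc)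
      also have "\<dots> = u1 x * (1 + ?t)" by (simp add: distrib_left)
      also have "\<dots> \<le> u1 x * exp ?t" using exp_ge u1[OF xE] by (intro mult_left_mono) auto
      also have "\<dots> = exp (ln (u1 x) + ?t)" using u1[OF xE] by (simp add: exp_add)
      also have "\<dots> \<le> exp (ln (m x))" using ar(4)[of x] x by auto
      also have "\<dots> = m x" using m0[OF xE] by simp
      finally have "ereal (u1 x + (?q * \<epsilon>) * barrier \<alpha> R y0 x) \<le> ereal (m x)" by simp
      also have "\<dots> \<le> u2 x" by (rule mu[OF xE])
      finally show ?thesis .
    qed
    have "?q * \<epsilon> > 0" "?r > 0" using ar r' by auto
    then show thesis by (rule that[of \<alpha> "?q * \<epsilon>" ?r, OF ar(1) _ _ res])
  next
    assume "(\<forall>x \<in> ?E. u2 x < \<infinity>) \<and> C11_on ?E (\<lambda>x. ln (real_of_ereal (u2 x)))"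
    then have fin: "\<And>x. x \<in> ?E \<Longrightarrow> u2 x < \<infinity>" and C11: "C11_on ?E (\<lambda>x. - ln (real_of_ereal (u2 x)))"
      by (auto intro: C11_on_uminus)
    define U where "U = (\<lambda>x. real_of_ereal (u2 x))"
    have eU: "u2 x = ereal (U x)" and U0: "0 < U x" if "x \<in> ?E" for x
      using u2[OF that] fin[OF that] unfolding U_def by (cases "u2 x"; simp)+
    define c where "c = - ln (U xh) + 3"
    have c: "- ln (U xh) + 3 \<le> c" by (simp add: c_def)
    \<comment> \<open>A positive floor under \<open>u1\<close>, which may vanish in this case. It
      also supplies the lower bound that turns the logarithmic gap into a gap of the
      functions.\<close>
    define \<delta> where "\<delta> = exp (- c)"
    define m where "m = (\<lambda>x. max (u1 x) \<delta>)"
    have m0: "0 < m x" for x by (simp add: m_def \<delta>_def less_max_iff_disj)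
    have lscg: "lsc_on ?E (\<lambda>x. - ln (m x))"
      unfolding lsc_on_def
    proof (intro ballI allI impI)
      fix x t assume x: "x \<in> ?E" and t: "t < - ln (m x)"
      have "exp (ln (m x)) < exp (- t)" using t by simp
      then have tm: "m x < exp (- t)" using m0[of x] by simp
      then have "u1 x < exp (- t)" "\<delta> < exp (- t)" by (auto simp: m_def)
      then have "\<forall>\<^sub>F y in at x within ?E. u1 y < exp (- t)" using usc x unfolding usc_on_def by blast
      then show "\<forall>\<^sub>F y in at x within ?E. t < - ln (m y)"
      proof eventually_elim
        case (elim y)
        have "m y < exp (- t)" using elim \<open>\<delta> < exp (- t)\<close> by (simp add: m_def)
        then have "ln (m y) < ln (exp (- t))" using m0[of y] by (subst ln_less_cancel_iff) auto
        then show ?case by simp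
      qed
    qed
    have less': "- ln (U x) < - ln (m x) \<or> c \<le> - ln (m x)" if "x \<in> \<Omega>" for x
    proof (cases "\<delta> < U x")
      case True
      have "u1 x < U x" using less[OF that] eU[of x] that by simp
      then have "m x < U x" using True by (simp add: m_def)
      then show ?thesis using m0[of x] U0[of x] that by simp
    next
      case False
      have "u1 x < U x" using less[OF that] eU[of x] that by simp
      then have "m x = \<delta>" using False by (simp add: m_def)
      then show ?thesis by (simp add: \<delta>_def)
    qed
    have eq': "- ln (m xh) = - ln (U xh)"
    proof -
      have "ln \<delta> < ln (U xh)" by (simp add: \<delta>_def c_def)
      moreover have "0 < \<delta>" by (simp add: \<delta>_def)
      ultimately have "\<delta> < U xh" using U0[of xh] by simp
      moreover have "u1 xh = U xh" using eq eU[of xh] by simp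
      ultimately show ?thesis by (simp add: m_def)
    qed
    have ev\<Omega>: "\<forall>\<^sub>F h in nhds 0. x + h \<in> \<Omega>" if "x \<in> \<Omega>" for x
      using eventually_nhds_shift[of "\<lambda>y. y \<in> \<Omega>" x] \<Omega>(1) that by (simp add: eventually_nhds_in_open)
    have neg: "(- X) *v h = - (X *v h)" "transpose (- X) = - transpose X" for X :: "real ^ 'n ^ 'n" and h
      by (simp_all add: vec_eq_iff matrix_vector_mult_def sum_negf transpose_def)
    have V: "super_jet f \<Gamma> (- (- ln (U x))) (- p) (- X)" if x: "x \<in> \<Omega>" and X: "transpose X = X"
      and touch: "\<forall>\<^sub>F h in nhds 0. - ln (U (x + h)) \<le> - ln (U x) + p \<bullet> h + (X *v h) \<bullet> h / 2" for x p X
      unfolding minus_minus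
    proof (rule supersolution_touched[OF super n x])
      show "u2 x = ereal (U x)" "0 < U x" using eU U0 x by auto
      show "transpose (- X) = - X" using X by (simp add: neg)
      show "\<forall>\<^sub>F h in nhds 0. ereal (exp (ln (U x) + - p \<bullet> h + (- X *v h) \<bullet> h / 2)) \<le> u2 (x + h)"
        using touch ev\<Omega>[OF x]
      proof eventually_elim
        case (elim h)
        have "ln (U x) + - p \<bullet> h + (- X *v h) \<bullet> h / 2 \<le> ln (U (x + h))"
          unfolding neg inner_minus_left using elim(1) by simp
        moreover have "U (x + h) = exp (ln (U (x + h)))" using U0[of "x + h"] elim(2) by simp
        ultimately have "exp (ln (U x) + - p \<bullet> h + (- X *v h) \<bullet> h / 2) \<le> U (x + h)" by (metis exp_le_cancel_iff)
        then show ?case using eU[of "x + h"] elim(2) by simp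
      qed
    qed
    have G: "sub_jet f \<Gamma> (- (- ln (m x))) (- p) (- X)" if x: "x \<in> \<Omega>" and cx: "- ln (m x) < c" and X: "transpose X = X"
      and touch: "\<forall>\<^sub>F h in nhds 0. - ln (m x) + p \<bullet> h + (X *v h) \<bullet> h / 2 \<le> - ln (m (x + h))" for x p X
    proof -
      have "exp (- c) < exp (ln (m x))" using cx by simp
      then have "\<delta> < m x" using m0[of x] by (simp add: \<delta>_def)
      then have mx: "m x = u1 x" by (auto simp: m_def max_def split: if_splits)
      have "sub_jet f \<Gamma> (ln (u1 x)) (- p) (- X)"
      proof (rule subsolution_touched[OF sub n x])
        show "0 < u1 x" using m0[of x] mx by simp
        show "transpose (- X) = - X" using X by (simp add: neg)
        show "\<forall>\<^sub>F h in nhds 0. u1 (x + h) \<le> exp (ln (u1 x) + - p \<bullet> h + (- X *v h) \<bullet> h / 2)"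
          using touch
        proof eventually_elim
          case (elim h)
          have "ln (m (x + h)) \<le> ln (u1 x) + - p \<bullet> h + (- X *v h) \<bullet> h / 2"
            unfolding neg inner_minus_left mx[symmetric] using elim by simp
          moreover have "m (x + h) = exp (ln (m (x + h)))" using m0[of "x + h"] by simp
          ultimately have "m (x + h) \<le> exp (ln (u1 x) + - p \<bullet> h + (- X *v h) \<bullet> h / 2)" by (metis exp_le_cancel_iff)
          then show ?case by (simp add: m_def)
        qed
      qed
      then show ?thesis by (simp add: mx)
    qed
    have C11': "C11_on ?E (\<lambda>x. - ln (U x))" using C11 by (simp add: U_def)
    obtain \<alpha> \<epsilon> r where ar: "\<alpha> > 0" "\<epsilon> > 0" "r > 0"
      "\<And>x. x \<in> cball y0 R \<inter> cball xh r \<Longrightarrow> - ln (U x) + \<epsilon> * barrier \<alpha> R y0 x \<le> - ln (m x)"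
      by (rule barrier_below[where touchV = "\<lambda>s p X. super_jet f \<Gamma> (- s) (- p) (- X)" and touchG = "\<lambda>s p X. sub_jet f \<Gamma> (- s) (- p) (- X)",
            OF n \<Gamma> cont S1 S2 S3 S4 S5 \<Omega> R xh ball lscg C11' less' eq' c V G], assumption+, rule disjI2, rule conjI, rule refl, rule refl) blast
    have res: "ereal (u1 x + (\<delta> * \<epsilon>) * barrier \<alpha> R y0 x) \<le> u2 x" if x: "x \<in> cball y0 R \<inter> cball xh r" for x
    proof -
      have xE: "x \<in> ?E" using KE x by blast
      let ?t = "\<epsilon> * barrier \<alpha> R y0 x"
      have t: "0 \<le> ?t" using ar(2) b0[OF _ ar(1)] x by auto
      have "u1 x \<le> m x" "\<delta> \<le> m x" by (auto simp: m_def)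
      then have "u1 x + \<delta> * \<epsilon> * barrier \<alpha> R y0 x \<le> m x + m x * ?t"
        using mult_right_mono[OF \<open>\<delta> \<le> m x\<close> t] by (simp add: mult.assoc)
      also have "\<dots> = m x * (1 + ?t)" by (simp add: distrib_left)
      also have "\<dots> \<le> m x * exp ?t" using exp_ge m0[of x] by (intro mult_left_mono) auto
      also have "\<dots> = exp (ln (m x) + ?t)" using m0[of x] by (simp add: exp_add)
      also have "\<dots> \<le> exp (ln (U x))" using ar(4)[OF x] by simp
      also have "\<dots> = U x" using U0[OF xE] by simp
      finally show ?thesis using eU[OF xE] by simp
    qed
    have "\<delta> * \<epsilon> > 0" using ar by (simp add: \<delta>_def)
    then show thesis by (rule that[of \<alpha> "\<delta> * \<epsilon>" r, OF ar(1) _ ar(3) res])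
  }
qed

theorem theorem1p2:
  fixes \<Omega> \<Gamma> :: "(real ^ 'n) set"
    and f :: "real ^ 'n \<Rightarrow> real"
    and u1 :: "real ^ 'n \<Rightarrow> real"
    and u2 :: "real ^ 'n \<Rightarrow> ereal"
    and xh \<nu> :: "real ^ 'n"
  assumes "CARD('n) \<ge> 3"
    and "open \<Omega>" and "xh \<in> frontier \<Omega>"
    and "C2_boundary_near \<Omega> xh" and "outward_unit_normal \<Omega> xh \<nu>"
    and "open \<Gamma>" and "\<Gamma> \<noteq> {}" and "continuous_on (closure \<Gamma>) f"
    and "S1 f \<Gamma>" and "S2 f \<Gamma>" and "S3 f \<Gamma>" and "S4 f \<Gamma>" and "S5 f \<Gamma>"
    and "usc_on (\<Omega> \<union> {xh}) u1" and "\<forall>x \<in> \<Omega> \<union> {xh}. 0 \<le> u1 x"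
    and "lsc_on (\<Omega> \<union> {xh}) u2" and "\<forall>x \<in> \<Omega> \<union> {xh}. 0 < u2 x"
    and "viscosity_subsolution f \<Gamma> \<Omega> u1"
    and "viscosity_supersolution f \<Gamma> \<Omega> u2"
    and "\<forall>x\<in>\<Omega>. ereal (u1 x) < u2 x" and "ereal (u1 xh) = u2 xh"
    and "((\<forall>x \<in> \<Omega> \<union> {xh}. 0 < u1 x) \<and> C11_on (\<Omega> \<union> {xh}) (\<lambda>x. ln (u1 x))) \<or>
         ((\<forall>x \<in> \<Omega> \<union> {xh}. u2 x < \<infinity>) \<and> C11_on (\<Omega> \<union> {xh}) (\<lambda>x. ln (real_of_ereal (u2 x))))"
  shows "Liminf (at_right 0)
           (\<lambda>s::real. (u2 (xh - s *\<^sub>R \<nu>) - ereal (u1 (xh - s *\<^sub>R \<nu>))) / ereal s) > 0"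
proof -
  obtain R where R: "R > 0" and \<nu>: "norm \<nu> = 1" and ball: "cball (xh - R *\<^sub>R \<nu>) R - {xh} \<subseteq> \<Omega>"
    using interior_ball[OF assms(3,5)] by blast
  define y0 where "y0 = xh - R *\<^sub>R \<nu>"
  have xh\<Omega>: "xh \<notin> \<Omega>" using assms(2,3) by (simp add: frontier_def interior_open)
  have dist: "dist y0 xh = R" using R \<nu> by (simp add: y0_def dist_norm)
  obtain \<alpha> \<kappa> r where \<alpha>: "\<alpha> > 0" and \<kappa>: "\<kappa> > 0" and r: "r > 0"
    and gap: "\<And>x. x \<in> cball y0 R \<inter> cball xh r \<Longrightarrow> ereal (u1 x + \<kappa> * barrier \<alpha> R y0 x) \<le> u2 x"
    by (rule barrier_gap[OF assms(1,6,8-13,2) xh\<Omega> R dist ball[folded y0_def] assms(14,16) _ assms(18,19) _ assms(21,22)])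
      (use assms(17,20) in auto)
  \<comment> \<open>Along the normal, R^2 - (R - s)^2 = s (2 R - s) \<ge> s R, and exp d - 1 \<ge> d
    bounds the barrier below by a multiple of \<open>s\<close>.\<close>
  define q where "q = \<kappa> * (exp (- \<alpha> * R\<^sup>2) * (\<alpha> * R))"
  have q: "q > 0" using \<kappa> \<alpha> R by (simp add: q_def)
  have slope: "ereal q \<le> (u2 (xh - s *\<^sub>R \<nu>) - ereal (u1 (xh - s *\<^sub>R \<nu>))) / ereal s" if s: "0 < s" "s < min r R" for s
  proof -
    let ?x = "xh - s *\<^sub>R \<nu>"
    have xy: "?x - y0 = (R - s) *\<^sub>R \<nu>" by (simp add: y0_def algebra_simps)
    then have nx: "norm (?x - y0) = R - s" using s \<nu> by simp
    then have "?x \<in> cball y0 R \<inter> cball xh r" using s \<nu> by (simp add: dist_norm norm_minus_commute[of y0])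
    note le = gap[OF this]
    have "q * s \<le> \<kappa> * barrier \<alpha> R y0 ?x"
    proof -
      let ?a = "- \<alpha> * R\<^sup>2" and ?d = "\<alpha> * (s * (2 * R - s))"
      have "- \<alpha> * (R - s)\<^sup>2 = ?a + ?d" by (simp add: power2_eq_square algebra_simps)
      then have "barrier \<alpha> R y0 ?x = exp (?a + ?d) - exp ?a" unfolding barrier_def nx by (simp only:)
      then have "barrier \<alpha> R y0 ?x = exp ?a * (exp ?d - 1)" by (simp only: exp_add right_diff_distrib mult_1_right)
      moreover have "\<alpha> * (s * R) \<le> ?d" using \<alpha> s by (intro mult_left_mono) auto
      then have "\<alpha> * (s * R) \<le> exp ?d - 1" using exp_ge_add_one_self[of ?d] by linarith
      then have "exp ?a * (\<alpha> * (s * R)) \<le> exp ?a * (exp ?d - 1)" by (intro mult_left_mono) auto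
      ultimately have "\<kappa> * (exp ?a * (\<alpha> * (s * R))) \<le> \<kappa> * barrier \<alpha> R y0 ?x" using \<kappa> by (intro mult_left_mono) auto
      then show ?thesis by (simp add: q_def mult_ac)
    qed
    then have "ereal (u1 ?x + q * s) \<le> ereal (u1 ?x + \<kappa> * barrier \<alpha> R y0 ?x)" by simp
    also note le
    finally have "ereal (u1 ?x + q * s) \<le> u2 ?x" .
    \<comment> \<open>An infinite value of \<open>u2\<close> makes the quotient infinite; only the
      finite case needs the division.\<close>
    then show ?thesis using s by (cases "u2 ?x") (auto simp: pos_le_divide_eq)
  qed
  have "\<forall>\<^sub>F s in at_right 0. ereal q \<le> (u2 (xh - s *\<^sub>R \<nu>) - ereal (u1 (xh - s *\<^sub>R \<nu>))) / ereal s"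
    unfolding eventually_at_right_field using slope r R by (intro exI[of _ "min r R"]) auto
  then have "ereal q \<le> Liminf (at_right 0) (\<lambda>s::real. (u2 (xh - s *\<^sub>R \<nu>) - ereal (u1 (xh - s *\<^sub>R \<nu>))) / ereal s)"
    by (rule Liminf_bounded)
  moreover have "0 < ereal q" using q by simp
  ultimately show ?thesis by (rule less_le_trans[rotated])
qed

end
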